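(* Let $m,n,t\in\mathbb Z_{\le-1}$ be not all equal to $-1$ and let $a,b,c$ be the parameters of $Q^{\pm}(m,n,t)$. The non-trivial irreducible integrable highest weight modules of $Q^{\pm}(m,n,t)$ are exactly the modules $L(\lambda)$ such that, with $\lambda_i=\lambda(h_i)$, $$\begin{pmatrix}\lambda_1\\ \lambda_2\\ \lambda_3\end{pmatrix}=\frac{abc}{1+abc}\begin{pmatrix}1&\frac{-1}{b}&\frac1{bc}\\[2pt] \frac1{ac}&1&\frac{-1}{c}\\[2pt] \frac{-1}{a}&\frac1{ab}&1\end{pmatrix}\begin{pmatrix} x \\ y \\ z \end{pmatrix}$$ with $x,y,z\in\mathbb Z_{>0}$. These weights are typical.
   Context: $Q^{\pm}(m,n,t)$ is the contragredient Lie superalgebra $\mathfrak g(A)$ with $$A=\begin{pmatrix} 0&1&a \\ b&0&1 \\ 1&c&0 \end{pmatrix},\qquad p(1)=p(2)=p(3)=1,$$ where $a,b,c$ are nonzero numbers with $1+a+\frac1b=m$, $1+b+\frac1c=n$, $1+c+\frac1a=t$. There are two solutions, both real: $Q^-(m,n,t)$ has $a,b,c<-1$ and $Q^+(m,n,t)$ has $-1<a,b,c<0$. Here, for an $N\times N$ matrix $A=(a_{ij})$ with parity function $p$: $\mathfrak h$ has dimension $2N-\operatorname{rk}A$ with linearly independent $\alpha_i\in\mathfrak h^*$ and linearly independent $h_i\in\mathfrak h$, $\alpha_j(h_i)=a_{ij}$; $\mathfrak g(A)$ is generated by $\mathfrak h$ (even) and $X_i,Y_i$ of parity $p(i)$ with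 relations $[h,h']=0$, $[h,X_i]=\alpha_i(h)X_i$, $[h,Y_i]=-\alpha_i(h)Y_i$, $[X_i,Y_j]=\delta_{ij}h_i$, modulo the unique maximal ideal intersecting $\mathfrak h$ trivially. (For $Q^\pm(m,n,t)$, $\dim\mathfrak h=3$.) $\mathfrak n_+$ is the subalgebra generated by the $X_i$. $L(\lambda)$ is the irreducible module generated by $v_\lambda\ne0$ with $\mathfrak n_+v_\lambda=0$, $hv_\lambda=\lambda(h)v_\lambda$ for $h\in\mathfrak h$. A root $\beta$ is real if $\beta$ or $\frac12\beta$ is simple in some base obtained from $\{\alpha_i\}$ by a sequence of even reflections (at a simple $\alpha_k$ with $a_{kk}\ne0$, rescaled to $a_{kk}=2$: $\alpha_i\mapsto\alpha_i-\alpha_i(h_k)\alpha_k$) and odd reflections (at a simple odd $\alpha_k$ with $a_{kk}=0$: $\alpha_k\mapsto-\alpha_k$, and for $i\ne k$, $\alpha_i\mapsto\alpha_i+\alpha_k$ if $a_{ik}\ne0$ or $a_{ki}\neq0$, $\alpha_i\mapsto\alpha_i$ otherwise), each new base being given the corresponding Cartan matrix. A weight module is integrable if for every real root $\beta$ the elements of the root space $\mathfrak g_\beta$ act locally nilpotently. For a real root $\beta$, $h_\beta$ denotes a nonzero element of the one-dimensional space $[\mathfrak g_\beta,\mathfrak g_{-\beta}]\subset\mathfrak h$. A real root is isotropic if it is, in such a base, a simple isotropic root (odd with zero diagonal entry). $\rho\in\mathfrak h^*$ satisfies $\rho(h_i)=\frac12a_{ii}$ for all $i$ (so $\rho(h_i)=0$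 here). A weight $\lambda$ is typical if $(\lambda+\rho)(h_\beta)\neq0$ for every real isotropic root $\beta$. *)

theory Defs
  imports "HOL-Analysis.Analysis" "HOL-Library.Z2"
begin

section \<open>Lie superalgebras and their modules\<close>

text \<open>The ground field is the field of complex numbers. Parities are elements of the two-element
  field \<open>bit\<close>; the part of parity \<open>1\<close> is the odd part. Ideals, subalgebras and submodules are
  graded, as usual for superalgebras.\<close>

definition koszul_sign :: "bit \<Rightarrow> bit \<Rightarrow> complex" where
  "koszul_sign i j = (if i = 1 \<and> j = 1 then - 1 else 1)"

record 'v superspace =
  scal :: "complex \<Rightarrow> 'v \<Rightarrow> 'v"
  part :: "bit \<Rightarrow> 'v set"

definition is_superspace :: "('v::ab_group_add, 'z) superspace_scheme \<Rightarrow> bool" where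
  "is_superspace S \<longleftrightarrow>
     vector_space (scal S) \<and>
     (\<forall>i. module.subspace (scal S) (part S i)) \<and>
     part S 0 \<inter> part S 1 = {0} \<and>
     (\<forall>v. \<exists>v0\<in>part S 0. \<exists>v1\<in>part S 1. v = v0 + v1)"

definition graded_subspace :: "('v::ab_group_add, 'z) superspace_scheme \<Rightarrow> 'v set \<Rightarrow> bool" where
  "graded_subspace S W \<longleftrightarrow>
     module.subspace (scal S) W \<and>
     (\<forall>w\<in>W. \<exists>w0\<in>W \<inter> part S 0. \<exists>w1\<in>W \<inter> part S 1. w = w0 + w1)"

record 'g lie_superalgebra = "'g superspace" +
  brk :: "'g \<Rightarrow> 'g \<Rightarrow> 'g"

definition is_lie_superalgebra :: "('g::ab_group_add, 'z) lie_superalgebra_scheme \<Rightarrow> bool" where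
  "is_lie_superalgebra G \<longleftrightarrow>
     is_superspace G \<and>
     (\<forall>x. Vector_Spaces.linear (scal G) (scal G) (\<lambda>y. brk G x y)) \<and>
     (\<forall>y. Vector_Spaces.linear (scal G) (scal G) (\<lambda>x. brk G x y)) \<and>
     (\<forall>i j. \<forall>x\<in>part G i. \<forall>y\<in>part G j. brk G x y \<in> part G (i + j)) \<and>
     (\<forall>i j. \<forall>x\<in>part G i. \<forall>y\<in>part G j.
        brk G x y = scal G (- koszul_sign i j) (brk G y x)) \<and>
     (\<forall>i j. \<forall>x\<in>part G i. \<forall>y\<in>part G j. \<forall>z.
        brk G x (brk G y z) =
          brk G (brk G x y) z + scal G (koszul_sign i j) (brk G y (brk G x z)))"

definition subalgebra :: "('g::ab_group_add, 'z) lie_superalgebra_scheme \<Rightarrow> 'g set \<Rightarrow> bool" where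
  "subalgebra G S \<longleftrightarrow> graded_subspace G S \<and> (\<forall>x\<in>S. \<forall>y\<in>S. brk G x y \<in> S)"

record ('g, 'v) supermodule = "'v superspace" +
  act :: "'g \<Rightarrow> 'v \<Rightarrow> 'v"

definition is_supermodule ::
  "('g::ab_group_add, 'y) lie_superalgebra_scheme \<Rightarrow>
   ('g, 'v::ab_group_add, 'z) supermodule_scheme \<Rightarrow> bool" where
  "is_supermodule G V \<longleftrightarrow>
     is_superspace V \<and>
     (\<forall>x. Vector_Spaces.linear (scal V) (scal V) (\<lambda>v. act V x v)) \<and>
     (\<forall>v. Vector_Spaces.linear (scal G) (scal V) (\<lambda>x. act V x v)) \<and>
     (\<forall>i j. \<forall>x\<in>part G i. \<forall>v\<in>part V j. act V x v \<in> part V (i + j)) \<and>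
     (\<forall>i j. \<forall>x\<in>part G i. \<forall>y\<in>part G j. \<forall>v.
        act V (brk G x y) v =
          act V x (act V y v) - scal V (koszul_sign i j) (act V y (act V x v)))"

definition submodule ::
  "('g, 'v::ab_group_add, 'z) supermodule_scheme \<Rightarrow> 'v set \<Rightarrow> bool" where
  "submodule V W \<longleftrightarrow> graded_subspace V W \<and> (\<forall>x. \<forall>w\<in>W. act V x w \<in> W)"

definition irreducible_module ::
  "('g, 'v::ab_group_add, 'z) supermodule_scheme \<Rightarrow> bool" where
  "irreducible_module V \<longleftrightarrow>
     (\<exists>v::'v. v \<noteq> 0) \<and> (\<forall>W. submodule V W \<longrightarrow> W = {0} \<or> W = UNIV)"

definition nontrivial_module ::
  "('g, 'v::ab_group_add, 'z) supermodule_scheme \<Rightarrow> bool" where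
  "nontrivial_module V \<longleftrightarrow> (\<exists>x v. act V x v \<noteq> 0)"


section \<open>The contragredient Lie superalgebra of a matrix\<close>

text \<open>The Cartan subalgebra is a vector space on a type \<open>'h\<close> of its own, so that its dual
  consists of the linear functions \<open>'h \<Rightarrow> complex\<close>. The index set of the matrix is a finite
  type \<open>'i\<close>.\<close>

record ('h, 'i) realization =
  hscal :: "complex \<Rightarrow> 'h \<Rightarrow> 'h"
  sroot :: "'i \<Rightarrow> 'h \<Rightarrow> complex"
  scoroot :: "'i \<Rightarrow> 'h"

definition dual_space :: "('h::ab_group_add, 'i) realization \<Rightarrow> ('h \<Rightarrow> complex) set" where
  "dual_space R = {f. Vector_Spaces.linear (hscal R) (*) f}"

definition is_realization ::
  "complex^'i^'i \<Rightarrow> ('h::ab_group_add, 'i::finite) realization \<Rightarrow> bool" where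
  "is_realization A R \<longleftrightarrow>
     vector_space (hscal R) \<and>
     vector_space.dim (hscal R) (UNIV :: 'h set) = 2 * CARD('i) - rank A \<and>
     (\<forall>i. sroot R i \<in> dual_space R) \<and>
     (\<forall>u. (\<forall>h. (\<Sum>i\<in>UNIV. u i * sroot R i h) = 0) \<longrightarrow> (\<forall>i. u i = 0)) \<and>
     (\<forall>u. (\<Sum>i\<in>UNIV. hscal R (u i) (scoroot R i)) = 0 \<longrightarrow> (\<forall>i. u i = 0)) \<and>
     (\<forall>i j. sroot R j (scoroot R i) = A $ i $ j)"

text \<open>The Lie superalgebra given by generators and relations is represented by formal terms
  modulo the congruence \<open>pres_eq\<close> generated by the axioms of a Lie superalgebra, the linear
  structure of the Cartan subalgebra and the defining relations.\<close>

datatype ('h, 'i) lie_term =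
    GenH 'h
  | GenX 'i
  | GenY 'i
  | Zero
  | Plus "('h, 'i) lie_term" "('h, 'i) lie_term"
  | Smult complex "('h, 'i) lie_term"
  | Brak "('h, 'i) lie_term" "('h, 'i) lie_term"

inductive homog :: "('i \<Rightarrow> bit) \<Rightarrow> bit \<Rightarrow> ('h, 'i) lie_term \<Rightarrow> bool" for p :: "'i \<Rightarrow> bit" where
  "homog p 0 (GenH h)"
| "homog p (p i) (GenX i)"
| "homog p (p i) (GenY i)"
| "homog p d Zero"
| "homog p d s \<Longrightarrow> homog p d t \<Longrightarrow> homog p d (Plus s t)"
| "homog p d s \<Longrightarrow> homog p d (Smult k s)"
| "homog p d s \<Longrightarrow> homog p e t \<Longrightarrow> homog p (d + e) (Brak s t)"

inductive pres_eq ::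
  "('i \<Rightarrow> bit) \<Rightarrow> ('h::ab_group_add, 'i) realization \<Rightarrow>
   ('h, 'i) lie_term \<Rightarrow> ('h, 'i) lie_term \<Rightarrow> bool"
  for p :: "'i \<Rightarrow> bit" and R :: "('h::ab_group_add, 'i) realization" where
  eq_refl: "pres_eq p R s s"
| eq_sym: "pres_eq p R s t \<Longrightarrow> pres_eq p R t s"
| eq_trans: "pres_eq p R s t \<Longrightarrow> pres_eq p R t u \<Longrightarrow> pres_eq p R s u"
| Plus_cong: "pres_eq p R s s' \<Longrightarrow> pres_eq p R t t' \<Longrightarrow> pres_eq p R (Plus s t) (Plus s' t')"
| Smult_cong: "pres_eq p R s s' \<Longrightarrow> pres_eq p R (Smult k s) (Smult k s')"
| Brak_cong: "pres_eq p R s s' \<Longrightarrow> pres_eq p R t t' \<Longrightarrow> pres_eq p R (Brak s t) (Brak s' t')"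
| Plus_assoc: "pres_eq p R (Plus (Plus s t) u) (Plus s (Plus t u))"
| Plus_comm: "pres_eq p R (Plus s t) (Plus t s)"
| Plus_Zero: "pres_eq p R (Plus s Zero) s"
| Plus_minus: "pres_eq p R (Plus s (Smult (- 1) s)) Zero"
| Smult_one: "pres_eq p R (Smult 1 s) s"
| Smult_Smult: "pres_eq p R (Smult k (Smult l s)) (Smult (k * l) s)"
| Smult_add: "pres_eq p R (Smult (k + l) s) (Plus (Smult k s) (Smult l s))"
| Smult_Plus: "pres_eq p R (Smult k (Plus s t)) (Plus (Smult k s) (Smult k t))"
| Brak_Plus_left: "pres_eq p R (Brak (Plus s t) u) (Plus (Brak s u) (Brak t u))"
| Brak_Plus_right: "pres_eq p R (Brak u (Plus s t)) (Plus (Brak u s) (Brak u t))"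
| Brak_Smult_left: "pres_eq p R (Brak (Smult k s) t) (Smult k (Brak s t))"
| Brak_Smult_right: "pres_eq p R (Brak s (Smult k t)) (Smult k (Brak s t))"
| skew: "homog p d s \<Longrightarrow> homog p e t \<Longrightarrow>
    pres_eq p R (Brak s t) (Smult (- koszul_sign d e) (Brak t s))"
| jacobi: "homog p d s \<Longrightarrow> homog p e t \<Longrightarrow>
    pres_eq p R (Brak s (Brak t u))
      (Plus (Brak (Brak s t) u) (Smult (koszul_sign d e) (Brak t (Brak s u))))"
| GenH_add: "pres_eq p R (GenH (h + h')) (Plus (GenH h) (GenH h'))"
| GenH_scale: "pres_eq p R (GenH (hscal R k h)) (Smult k (GenH h))"
| rel_HH: "pres_eq p R (Brak (GenH h) (GenH h')) Zero"
| rel_HX: "pres_eq p R (Brak (GenH h) (GenX i)) (Smult (sroot R i h) (GenX i))"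
| rel_HY: "pres_eq p R (Brak (GenH h) (GenY i)) (Smult (- sroot R i h) (GenY i))"
| rel_XY: "pres_eq p R (Brak (GenX i) (GenY j)) (if i = j then GenH (scoroot R i) else Zero)"

text \<open>Ideals of the presented superalgebra, as \<open>pres_eq\<close>-saturated sets of terms.\<close>

definition pres_ideal ::
  "('i \<Rightarrow> bit) \<Rightarrow> ('h::ab_group_add, 'i) realization \<Rightarrow> ('h, 'i) lie_term set \<Rightarrow> bool" where
  "pres_ideal p R I \<longleftrightarrow>
     (\<forall>s t. s \<in> I \<longrightarrow> pres_eq p R s t \<longrightarrow> t \<in> I) \<and>
     Zero \<in> I \<and>
     (\<forall>s\<in>I. \<forall>t\<in>I. Plus s t \<in> I) \<and>
     (\<forall>k. \<forall>s\<in>I. Smult k s \<in> I) \<and>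
     (\<forall>s\<in>I. \<forall>t. Brak s t \<in> I \<and> Brak t s \<in> I) \<and>
     (\<forall>s\<in>I. \<exists>s0\<in>I. \<exists>s1\<in>I. homog p 0 s0 \<and> homog p 1 s1 \<and> pres_eq p R s (Plus s0 s1))"

definition meets_cartan_trivially :: "('h::ab_group_add, 'i) lie_term set \<Rightarrow> bool" where
  "meets_cartan_trivially I \<longleftrightarrow> (\<forall>h. GenH h \<in> I \<longrightarrow> h = 0)"

definition is_maximal_ideal ::
  "('i \<Rightarrow> bit) \<Rightarrow> ('h::ab_group_add, 'i) realization \<Rightarrow> ('h, 'i) lie_term set \<Rightarrow> bool" where
  "is_maximal_ideal p R I \<longleftrightarrow>
     pres_ideal p R I \<and> meets_cartan_trivially I \<and>
     (\<forall>J. pres_ideal p R J \<and> meets_cartan_trivially J \<longrightarrow> J \<subseteq> I)"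

record ('h, 'i, 'g) contragredient = "'g lie_superalgebra" +
  cartan :: "('h, 'i) realization"
  incl :: "'h \<Rightarrow> 'g"
  genX :: "'i \<Rightarrow> 'g"
  genY :: "'i \<Rightarrow> 'g"

primrec term_value ::
  "('h, 'i, 'g::ab_group_add) contragredient \<Rightarrow> ('h, 'i) lie_term \<Rightarrow> 'g" where
  "term_value G (GenH h) = incl G h"
| "term_value G (GenX i) = genX G i"
| "term_value G (GenY i) = genY G i"
| "term_value G Zero = 0"
| "term_value G (Plus s t) = term_value G s + term_value G t"
| "term_value G (Smult k s) = scal G k (term_value G s)"
| "term_value G (Brak s t) = brk G (term_value G s) (term_value G t)"

text \<open>\<open>G\<close> is the contragredient Lie superalgebra of \<open>A\<close> and \<open>p\<close>: evaluation of terms identifies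
  \<open>G\<close> with the quotient of the presented superalgebra by its maximal ideal intersecting the Cartan
  subalgebra trivially. This determines \<open>G\<close>, with its generators, up to isomorphism.\<close>

definition is_contragredient ::
  "complex^'i^'i \<Rightarrow> ('i \<Rightarrow> bit) \<Rightarrow>
   ('h::ab_group_add, 'i::finite, 'g::ab_group_add) contragredient \<Rightarrow> bool" where
  "is_contragredient A p G \<longleftrightarrow>
     is_realization A (cartan G) \<and>
     is_lie_superalgebra G \<and>
     surj (term_value G) \<and>
     (\<forall>d s. homog p d s \<longrightarrow> term_value G s \<in> part G d) \<and>
     is_maximal_ideal p (cartan G) {s. term_value G s = 0}"

definition n_plus :: "('h, 'i, 'g::ab_group_add) contragredient \<Rightarrow> 'g set" where
  "n_plus G = subalgebra G hull range (genX G)"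


section \<open>Real roots\<close>

definition root_space ::
  "('h, 'i, 'g::ab_group_add) contragredient \<Rightarrow> ('h \<Rightarrow> complex) \<Rightarrow> 'g set" where
  "root_space G \<beta> = {x. \<forall>h. brk G (incl G h) x = scal G (\<beta> h) x}"

definition is_root ::
  "('h::ab_group_add, 'i, 'g::ab_group_add) contragredient \<Rightarrow> ('h \<Rightarrow> complex) \<Rightarrow> bool" where
  "is_root G \<beta> \<longleftrightarrow>
     \<beta> \<in> dual_space (cartan G) \<and> \<beta> \<noteq> (\<lambda>h. 0) \<and> root_space G \<beta> \<noteq> {0}"

text \<open>\<open>h\<close> is a nonzero element of \<open>[g\<^sub>\<beta>, g\<^sub>-\<^sub>\<beta>]\<close>.\<close>

definition is_coroot ::
  "('h::ab_group_add, 'i, 'g::ab_group_add) contragredient \<Rightarrow> ('h \<Rightarrow> complex) \<Rightarrow> 'h \<Rightarrow> bool" where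
  "is_coroot G \<beta> h \<longleftrightarrow>
     h \<noteq> 0 \<and>
     incl G h \<in> module.span (scal G)
       {brk G x y |x y. x \<in> root_space G \<beta> \<and> y \<in> root_space G (\<lambda>h. - \<beta> h)}"

definition odd_root ::
  "('h::ab_group_add, 'i, 'g::ab_group_add) contragredient \<Rightarrow> ('h \<Rightarrow> complex) \<Rightarrow> bool" where
  "odd_root G \<beta> \<longleftrightarrow> is_root G \<beta> \<and> root_space G \<beta> \<subseteq> part G 1"

text \<open>The Cartan matrix of a base \<open>\<beta>\<close> has the entries \<open>a\<^sub>i\<^sub>j = \<beta>\<^sub>j(h\<^sub>i)\<close> with \<open>h\<^sub>i\<close> a coroot of
  \<open>\<beta>\<^sub>i\<close>; it is determined up to rescaling of its rows, which does not affect the rules below. The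
  rescaling of the diagonal entry to \<open>2\<close> in an even reflection is a choice of the coroot.\<close>

inductive is_base ::
  "('h::ab_group_add, 'i, 'g::ab_group_add) contragredient \<Rightarrow> ('i \<Rightarrow> 'h \<Rightarrow> complex) \<Rightarrow> bool"
  for G :: "('h::ab_group_add, 'i, 'g::ab_group_add) contragredient" where
  initial: "is_base G (sroot (cartan G))"
| even_reflection:
    "is_base G \<beta> \<Longrightarrow> is_coroot G (\<beta> k) hk \<Longrightarrow> \<beta> k hk = 2 \<Longrightarrow>
     is_base G (\<lambda>i h. \<beta> i h - \<beta> i hk * \<beta> k h)"
| odd_reflection:
    "is_base G \<beta> \<Longrightarrow> (\<And>i. is_coroot G (\<beta> i) (hc i)) \<Longrightarrow> odd_root G (\<beta> k) \<Longrightarrow> \<beta> k (hc k) = 0 \<Longrightarrow>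
     is_base G (\<lambda>i h. if i = k then - \<beta> k h
                      else if \<beta> k (hc i) \<noteq> 0 \<or> \<beta> i (hc k) \<noteq> 0 then \<beta> i h + \<beta> k h
                      else \<beta> i h)"

definition real_root ::
  "('h::ab_group_add, 'i, 'g::ab_group_add) contragredient \<Rightarrow> ('h \<Rightarrow> complex) \<Rightarrow> bool" where
  "real_root G \<beta> \<longleftrightarrow>
     is_root G \<beta> \<and> (\<exists>\<gamma> k. is_base G \<gamma> \<and> (\<beta> = \<gamma> k \<or> (\<lambda>h. \<beta> h / 2) = \<gamma> k))"

definition real_isotropic_root ::
  "('h::ab_group_add, 'i, 'g::ab_group_add) contragredient \<Rightarrow> ('h \<Rightarrow> complex) \<Rightarrow> bool" where
  "real_isotropic_root G \<beta> \<longleftrightarrow>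
     real_root G \<beta> \<and>
     (\<exists>\<gamma> k. is_base G \<gamma> \<and> \<beta> = \<gamma> k \<and> odd_root G \<beta> \<and> (\<exists>h. is_coroot G \<beta> h \<and> \<beta> h = 0))"

definition is_weyl_vector ::
  "complex^'i^'i \<Rightarrow> ('h::ab_group_add, 'i::finite, 'g) contragredient \<Rightarrow>
   ('h \<Rightarrow> complex) \<Rightarrow> bool" where
  "is_weyl_vector A G \<rho> \<longleftrightarrow>
     \<rho> \<in> dual_space (cartan G) \<and> (\<forall>i. \<rho> (scoroot (cartan G) i) = A $ i $ i / 2)"

definition typical ::
  "('h::ab_group_add, 'i, 'g::ab_group_add) contragredient \<Rightarrow>
   ('h \<Rightarrow> complex) \<Rightarrow> ('h \<Rightarrow> complex) \<Rightarrow> bool" where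
  "typical G \<rho> lam \<longleftrightarrow>
     (\<forall>\<beta> h. real_isotropic_root G \<beta> \<and> is_coroot G \<beta> h \<longrightarrow> lam h + \<rho> h \<noteq> 0)"


section \<open>Highest weight modules and integrability\<close>

definition weight_space ::
  "('h, 'i, 'g) contragredient \<Rightarrow> ('g, 'v) supermodule \<Rightarrow> ('h \<Rightarrow> complex) \<Rightarrow> 'v set" where
  "weight_space G V \<mu> = {v. \<forall>h. act V (incl G h) v = scal V (\<mu> h) v}"

definition weight_module ::
  "('h::ab_group_add, 'i, 'g) contragredient \<Rightarrow> ('g, 'v::ab_group_add) supermodule \<Rightarrow> bool" where
  "weight_module G V \<longleftrightarrow>
     module.span (scal V) (\<Union>\<mu>\<in>dual_space (cartan G). weight_space G V \<mu>) = UNIV"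

definition integrable_module ::
  "('h::ab_group_add, 'i, 'g::ab_group_add) contragredient \<Rightarrow>
   ('g, 'v::ab_group_add) supermodule \<Rightarrow> bool" where
  "integrable_module G V \<longleftrightarrow>
     weight_module G V \<and>
     (\<forall>\<beta>. real_root G \<beta> \<longrightarrow> (\<forall>x\<in>root_space G \<beta>. \<forall>v. \<exists>k::nat. (act V x ^^ k) v = 0))"

definition has_highest_weight ::
  "('h::ab_group_add, 'i, 'g::ab_group_add) contragredient \<Rightarrow>
   ('g, 'v::ab_group_add) supermodule \<Rightarrow> ('h \<Rightarrow> complex) \<Rightarrow> bool" where
  "has_highest_weight G V lam \<longleftrightarrow>
     lam \<in> dual_space (cartan G) \<and>
     (\<exists>v \<in> part V 0 \<union> part V 1.
        v \<noteq> 0 \<and> (\<forall>x\<in>n_plus G. act V x v = 0) \<and> v \<in> weight_space G V lam \<and>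
        submodule V hull {v} = UNIV)"

text \<open>\<open>V\<close> is (a copy of) the module \<open>L(lam)\<close>.\<close>

definition is_L ::
  "('h::ab_group_add, 'i, 'g::ab_group_add) contragredient \<Rightarrow>
   ('h \<Rightarrow> complex) \<Rightarrow> ('g, 'v::ab_group_add) supermodule \<Rightarrow> bool" where
  "is_L G lam V \<longleftrightarrow> is_supermodule G V \<and> irreducible_module V \<and> has_highest_weight G V lam"


section \<open>The superalgebras of type Q\<close>

definition Q_equations :: "int \<Rightarrow> int \<Rightarrow> int \<Rightarrow> real \<Rightarrow> real \<Rightarrow> real \<Rightarrow> bool" where
  "Q_equations m n t a b c \<longleftrightarrow>
     a \<noteq> 0 \<and> b \<noteq> 0 \<and> c \<noteq> 0 \<and>
     1 + a + 1 / b = of_int m \<and> 1 + b + 1 / c = of_int n \<and> 1 + c + 1 / a = of_int t"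

definition Q_minus_parameters :: "int \<Rightarrow> int \<Rightarrow> int \<Rightarrow> real \<Rightarrow> real \<Rightarrow> real \<Rightarrow> bool" where
  "Q_minus_parameters m n t a b c \<longleftrightarrow>
     Q_equations m n t a b c \<and> a < - 1 \<and> b < - 1 \<and> c < - 1"

definition Q_plus_parameters :: "int \<Rightarrow> int \<Rightarrow> int \<Rightarrow> real \<Rightarrow> real \<Rightarrow> real \<Rightarrow> bool" where
  "Q_plus_parameters m n t a b c \<longleftrightarrow>
     Q_equations m n t a b c \<and> - 1 < a \<and> a < 0 \<and> - 1 < b \<and> b < 0 \<and> - 1 < c \<and> c < 0"

definition Q_matrix :: "complex \<Rightarrow> complex \<Rightarrow> complex \<Rightarrow> complex^3^3" where
  "Q_matrix a b c = vector [vector [0, 1, a],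
                            vector [b, 0, 1],
                            vector [1, c, 0]]"

definition Q_weight_matrix :: "complex \<Rightarrow> complex \<Rightarrow> complex \<Rightarrow> complex^3^3" where
  "Q_weight_matrix a b c = vector [vector [1, - 1 / b, 1 / (b * c)],
                                   vector [1 / (a * c), 1, - 1 / c],
                                   vector [- 1 / a, 1 / (a * b), 1]]"

definition Q_weights ::
  "complex \<Rightarrow> complex \<Rightarrow> complex \<Rightarrow> ('h::ab_group_add, 3, 'g) contragredient \<Rightarrow>
   ('h \<Rightarrow> complex) set" where
  "Q_weights a b c G =
     {lam \<in> dual_space (cartan G). \<exists>x y z :: int. x > 0 \<and> y > 0 \<and> z > 0 \<and>
        (\<chi> i. lam (scoroot (cartan G) i)) =
          (a * b * c / (1 + a * b * c)) *s
            (Q_weight_matrix a b c *v vector [of_int x, of_int y, of_int z])}"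

end

(* Odd reflection at the simple root alpha_k produces a base consisting of - alpha_k and two of the
   even roots beta_i = alpha_i + alpha_(i+1). A vector killed by the negative part of some base
   generates an ideal or a submodule lying above it. This gives the Serre relations for the sl_2-triples
   (E_i, F_i, H_i) attached to the beta_i and, in a highest weight module, the nilpotency of F_i as
   soon as lam(H_i) is a positive integer. Exponentiating these triples gives automorphisms of the
   superalgebra and of the module realizing the reflections in the beta_i; every base is carried by
   them to the original base or to one of its three odd reflections, so integrability only has to be
   tested there. Conversely, integrability makes all lam(H_i) natural numbers, and if
   lam(h_k) = 0 for some k, the negativity of a, b, c forces lam = 0.

   For typicality, let W be generated by the three reflections. The coroots h_i, rescaled, are positive
   combinations of the H_i. The reflections in beta_i and beta_(i+2) permute the rays of the h_i, and the
   one in beta_(i+1) adds to h_i a positive multiple of H_(i+1). Since every root is a positive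
   or negative combination of each of the bases, the W-images of the H_j are positive or negative
   combinations of the H_i, and an induction on the word length shows that all W-images of the
   rescaled h_i are positive combinations of the H_i. *)

theory Submission
  imports Defs
begin

text \<open>The integers m, n, t are the off-diagonal entries \<open>M i\<close> of the Cartan
  matrix of the even roots \<beta>: \<beta>_(i+1) and \<beta>_(i+2) both take the value
  \<open>M i\<close> on H_i. So the Serre exponents are 1 - \<open>M i\<close>, and dividing by
  \<open>M\<close> symmetrizes this matrix. The obstacle is that no base contains all three
  \<beta>_i; each odd reflection shows only two. Signs of coordinates with respect to \<beta> are
  therefore pieced together from three bases, and the mixed patterns that survive are the multiples
  2 s \<alpha>_k, which are not roots. The rescaling of h_i is by K = 1 + 1/(abc), the factor that
  appears when the cyclic system H_i = h_i + h_(i+1)/q_(i+1) is solved for the h_i. The families Q^-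
  and Q^+ are treated together because K and 1 + q_i have opposite signs in both: K > 0 > 1 + q_i
  for Q^-, K < 0 < 1 + q_i for Q^+. The numbers x, y, z are positive, not just nonnegative, because
  Y_i v is a highest weight vector for the base reflected at i, and its H_i-eigenvalue is lam(H_i) -
  1.\<close>

section \<open>Weight vectors and exponentials of locally nilpotent operators\<close>

text \<open>Independence of joint eigenvectors with different weights, by induction on the number of
  terms in a representation of v. The vectors in S may have infinitely many different
  weights.\<close>

lemma (in vector_space) weight_vector_zero:
  assumes lin: "\<And>h. Vector_Spaces.linear scale scale (T h)"
    and v: "v \<in> span S"
    and S: "\<And>s. s \<in> S \<Longrightarrow> \<exists>\<mu>. \<mu> \<noteq> lam \<and> (\<forall>h. T h s = scale (\<mu> h) s)"
    and lam: "\<And>h. T h v = scale (lam h) v"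
  shows "v = 0"
proof -
  obtain \<nu> where \<nu>: "\<And>s. s \<in> S \<Longrightarrow> \<nu> s \<noteq> lam" "\<And>s h. s \<in> S \<Longrightarrow> T h s = scale (\<nu> s h) s"
    using S by metis
  obtain t r where "finite t" "t \<subseteq> S" "v = (\<Sum>a\<in>t. scale (r a) a)"
    using v unfolding span_explicit by blast
  then show ?thesis
  proof (induction t arbitrary: r rule: finite_induct)
    case empty
    then show ?case by simp
  next
    case (insert s t)
    obtain h where h: "\<nu> s h \<noteq> lam h"
      using \<nu>(1)[of s] insert.prems by auto
    interpret Th: Vector_Spaces.linear scale scale "T h" by (rule lin)
    have tS: "a \<in> S" if "a \<in> t" for a using insert.prems that by auto
    \<comment> \<open>Applying \<open>T h\<close> minus the scalar \<open>\<nu> s h\<close> kills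
      the term of s and multiplies v by \<open>lam h - \<nu> s h\<close>, which is nonzero by the
      choice of h; \<open>r'\<close> are the coefficients after division.\<close>
    define r' where "r' a = r a * (\<nu> a h - \<nu> s h) / (lam h - \<nu> s h)" for a
    have "scale (lam h - \<nu> s h) v = T h v - scale (\<nu> s h) v"
      by (simp add: lam scale_left_diff_distrib)
    also have "\<dots> = (\<Sum>a\<in>insert s t. scale (r a * (\<nu> a h - \<nu> s h)) a)"
      using insert.prems
      by (subst insert.prems(2))+
        (auto simp: Th.sum Th.scale \<nu>(2) subset_eq scale_sum_right sum_subtractf[symmetric]
          scale_left_diff_distrib right_diff_distrib mult.commute intro!: sum.cong)
    also have "\<dots> = (\<Sum>a\<in>t. scale (r a * (\<nu> a h - \<nu> s h)) a)"
      using insert.hyps by simp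
    finally have "scale (1 / (lam h - \<nu> s h)) (scale (lam h - \<nu> s h) v) =
        scale (1 / (lam h - \<nu> s h)) (\<Sum>a\<in>t. scale (r a * (\<nu> a h - \<nu> s h)) a)"
      by simp
    then have "v = (\<Sum>a\<in>t. scale (r' a) a)"
      using h by (simp add: scale_sum_right r'_def)
    then show ?case
      using insert.IH insert.prems(1) by blast
  qed
qed

text \<open>Split v = a + b into the part of weight lam and the rest. Then b = v - a also has weight
  lam, so \<open>weight_vector_zero\<close> removes it.\<close>

lemma (in vector_space) weight_vector_span:
  assumes lin: "\<And>h. Vector_Spaces.linear scale scale (T h)"
    and v: "v \<in> span (f ` I)"
    and I: "\<And>i h. i \<in> I \<Longrightarrow> T h (f i) = scale (\<mu> i h) (f i)"
    and lam: "\<And>h. T h v = scale (lam h) v"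
  shows "v \<in> span (f ` {i \<in> I. \<mu> i = lam})"
proof -
  let ?S = "f ` {i \<in> I. \<mu> i = lam}" and ?S' = "f ` {i \<in> I. \<mu> i \<noteq> lam}"
  have "f ` I = ?S \<union> ?S'" by auto
  then obtain a b where ab: "a \<in> span ?S" "b \<in> span ?S'" "v = a + b"
    using v by (auto simp: span_Un)
  have a: "T h a = scale (lam h) a" for h
  proof -
    interpret Th: Vector_Spaces.linear scale scale "T h" by (rule lin)
    show ?thesis using ab(1)
      by (induction rule: span_induct)
        (auto simp: subspace_def Th.add Th.scale scale_right_distrib mult.commute I)
  qed
  have "T h b = scale (lam h) b" for h
  proof -
    interpret Th: Vector_Spaces.linear scale scale "T h" by (rule lin)
    have "b = v - a" using ab(3) by simp
    then show ?thesis by (simp add: Th.diff a lam scale_right_diff_distrib)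
  qed
  then have "b = 0"
    using weight_vector_zero[OF lin ab(2)] I by fastforce
  then show ?thesis using ab by simp
qed

section \<open>Divided powers and exponentials of locally nilpotent operators\<close>

definition divpow ::
  "(complex \<Rightarrow> 'v \<Rightarrow> 'v) \<Rightarrow> ('v \<Rightarrow> 'v) \<Rightarrow> nat \<Rightarrow> 'v \<Rightarrow> 'v::ab_group_add" where
  "divpow s D n v = s (1 / fact n) ((D ^^ n) v)"

text \<open>The exponential series as a finite sum, cut at the first power of D that kills v; it is
  meaningful only at such v.\<close>

definition lexp :: "(complex \<Rightarrow> 'v \<Rightarrow> 'v) \<Rightarrow> ('v \<Rightarrow> 'v) \<Rightarrow> 'v \<Rightarrow> 'v::ab_group_add" where
  "lexp s D v = (\<Sum>n<(LEAST N. (D ^^ N) v = 0). divpow s D n v)"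

definition locally_nilpotent :: "('v \<Rightarrow> 'v::ab_group_add) \<Rightarrow> bool" where
  "locally_nilpotent D \<longleftrightarrow> (\<forall>v. \<exists>n. (D ^^ n) v = 0)"

locale linear_operator = Vector_Spaces.linear s s D
  for s :: "complex \<Rightarrow> 'v::ab_group_add \<Rightarrow> 'v" and D :: "'v \<Rightarrow> 'v"
begin

lemma power_add: "(D ^^ n) (v + w) = (D ^^ n) v + (D ^^ n) w"
  by (induction n) (auto simp: add)

lemma power_scale: "(D ^^ n) (s c v) = s c ((D ^^ n) v)"
  by (induction n) (auto simp: scale)

lemma power_zero [simp]: "(D ^^ n) 0 = 0"
  by (induction n) auto

lemma power_sum: "(D ^^ n) (sum f I) = (\<Sum>i\<in>I. (D ^^ n) (f i))"
  by (induction I rule: infinite_finite_induct) (auto simp: power_add)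

lemma power_eq_0_mono: "(D ^^ n) v = 0 \<Longrightarrow> n \<le> m \<Longrightarrow> (D ^^ m) v = 0"
  by (metis funpow_add le_add_diff_inverse2 o_apply power_zero)

lemma divpow_add: "divpow s D n (v + w) = divpow s D n v + divpow s D n w"
  by (simp add: divpow_def power_add vs1.scale_right_distrib)

lemma divpow_scale: "divpow s D n (s c v) = s c (divpow s D n v)"
  by (simp add: divpow_def power_scale mult.commute)

lemma divpow_Suc: "D (divpow s D n v) = s (of_nat (Suc n)) (divpow s D (Suc n) v)"
  by (simp add: divpow_def scale) (metis of_nat_Suc of_nat_eq_0_iff nat.distinct(1) nonzero_mult_divide_mult_cancel_left mult.right_neutral)

text \<open>Any sufficiently large bound may replace the least one, so that several vectors can
  share a bound.\<close>

lemma lexp_eq: 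
  assumes "(D ^^ N) v = 0"
  shows "lexp s D v = (\<Sum>n<N. divpow s D n v)"
proof -
  let ?L = "LEAST N. (D ^^ N) v = 0"
  have L: "?L \<le> N" "(D ^^ ?L) v = 0"
    using assms by (auto intro: Least_le LeastI)
  show ?thesis unfolding lexp_def
    using L by (intro sum.mono_neutral_left) (auto simp: divpow_def power_eq_0_mono[OF L(2)])
qed

end

locale nilpotent_operator = linear_operator s D
  for s :: "complex \<Rightarrow> 'v::ab_group_add \<Rightarrow> 'v" and D :: "'v \<Rightarrow> 'v" +
  assumes locally_nilpotent: "locally_nilpotent D"
begin

lemma exp_add: "lexp s D (v + w) = lexp s D v + lexp s D w"
proof -
  obtain n m where nm: "(D ^^ n) v = 0" "(D ^^ m) w = 0"
    using locally_nilpotent unfolding locally_nilpotent_def by metis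
  have *: "(D ^^ max n m) v = 0" "(D ^^ max n m) w = 0"
    using nm by (auto intro: power_eq_0_mono)
  then have "(D ^^ max n m) (v + w) = 0" by (simp add: power_add)
  then show ?thesis
    using * by (simp add: lexp_eq[of "max n m"] divpow_add sum.distrib)
qed

lemma exp_scale: "lexp s D (s c v) = s c (lexp s D v)"
proof -
  obtain n where n: "(D ^^ n) v = 0"
    using locally_nilpotent unfolding locally_nilpotent_def by metis
  then have "(D ^^ n) (s c v) = 0" by (simp add: power_scale)
  then show ?thesis
    using n by (simp add: lexp_eq[of n] divpow_scale vs1.scale_sum_right)
qed

lemma exp_linear: "Vector_Spaces.linear s s (lexp s D)"
  by unfold_locales (auto simp: exp_add exp_scale)

lemma nilpotent_uminus: "nilpotent_operator s (\<lambda>v. - D v)"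
proof -
  interpret m: linear_operator s "\<lambda>v. - D v"
    by unfold_locales (auto simp: add scale)
  have "((\<lambda>v. - D v) ^^ n) v = s ((- 1) ^ n) ((D ^^ n) v)" for n v
    by (induction n) (auto simp: scale)
  then have "locally_nilpotent (\<lambda>v. - D v)"
    using locally_nilpotent unfolding locally_nilpotent_def by (metis vs1.scale_zero_right)
  then show ?thesis by unfold_locales
qed

text \<open>In the product of the two series the coefficient of \<open>D ^^ k\<close> is an
  alternating sum of binomial coefficients divided by k!, which vanishes unless k = 0.\<close>

lemma exp_uminus_exp: "lexp s (\<lambda>v. - D v) (lexp s D v) = v"
proof -
  interpret m: nilpotent_operator s "\<lambda>v. - D v" by (rule nilpotent_uminus)
  have mpow: "((\<lambda>v. - D v) ^^ n) v = s ((- 1) ^ n) ((D ^^ n) v)" for n v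
    by (induction n) (auto simp: scale)
  obtain N0 where N0: "(D ^^ N0) v = 0"
    using locally_nilpotent unfolding locally_nilpotent_def by metis
  \<comment> \<open>The successor makes N positive, so that the term k = 0, the only surviving one,
    is in the range.\<close>
  define N where "N = Suc N0"
  have N: "(D ^^ N) v = 0" unfolding N_def using N0 by (rule power_eq_0_mono) simp
  define a where "a i j = s ((- 1) ^ i / (fact i * fact j)) ((D ^^ (i + j)) v)" for i j
  have a0: "a i j = 0" if "i + j \<ge> N" for i j
    using power_eq_0_mono[OF N that] by (simp add: a_def)
  have "(D ^^ N) (lexp s D v) = 0"
  proof -
    have "(D ^^ N) ((D ^^ n) v) = 0" for n
      using power_eq_0_mono[OF N, of "N + n"] by (simp add: funpow_add)
    then show ?thesis by (simp add: lexp_eq[OF N] power_sum divpow_def power_scale)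
  qed
  then have "((\<lambda>v. - D v) ^^ N) (lexp s D v) = 0" by (simp add: mpow)
  then have "lexp s (\<lambda>v. - D v) (lexp s D v) = (\<Sum>i<N. \<Sum>j<N. a i j)"
    by (subst m.lexp_eq[where N = N], assumption, subst lexp_eq[OF N]) (intro sum.cong refl,
        simp add: divpow_def mpow power_sum power_scale vs1.scale_sum_right a_def funpow_add mult.commute)
  also have "\<dots> = (\<Sum>(i,j)\<in>{..<N} \<times> {..<N}. a i j)"
    by (simp add: sum.cartesian_product)
  also have "\<dots> = (\<Sum>(i,j)\<in>{(i,j). i + j < N}. a i j)"
    by (rule sum.mono_neutral_right) (auto, metis a0 not_le_imp_less)
  also have "\<dots> = (\<Sum>k<N. \<Sum>i\<le>k. a i (k - i))"
    by (rule sum.triangle_reindex)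
  also have "\<dots> = (\<Sum>k<N. s ((\<Sum>i\<le>k. (- 1) ^ i * of_nat (k choose i)) / fact k) ((D ^^ k) v))"
    by (intro sum.cong)
      (auto simp: a_def vs1.scale_sum_left sum_divide_distrib binomial_fact intro!: sum.cong)
  also have "\<dots> = (\<Sum>k<N. if k = 0 then v else 0)"
    by (intro sum.cong) (auto simp: choose_alternating_sum)
  also have "\<dots> = v" by (simp add: N_def)
  finally show ?thesis .
qed

lemma exp_exp_uminus: "lexp s D (lexp s (\<lambda>v. - D v) v) = v"
proof -
  interpret m: nilpotent_operator s "\<lambda>v. - D v" by (rule nilpotent_uminus)
  show ?thesis using m.exp_uminus_exp[of v] by simp
qed

end

text \<open>A bilinear map satisfying the Leibniz rule. It serves for the action of G on a module
  and for the bracket itself, the latter through the adjoint module.\<close>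

locale paired_derivation =
  D1: linear_operator s1 D1 + D2: linear_operator s2 D2 + D3: linear_operator s3 D3
  for s1 :: "complex \<Rightarrow> 'a::ab_group_add \<Rightarrow> 'a" and D1
    and s2 :: "complex \<Rightarrow> 'b::ab_group_add \<Rightarrow> 'b" and D2
    and s3 :: "complex \<Rightarrow> 'c::ab_group_add \<Rightarrow> 'c" and D3 +
  fixes pair :: "'a \<Rightarrow> 'b \<Rightarrow> 'c"
  assumes linear_left: "\<And>b. Vector_Spaces.linear s1 s3 (\<lambda>a. pair a b)"
    and linear_right: "\<And>a. Vector_Spaces.linear s2 s3 (\<lambda>b. pair a b)"
    and derivation: "\<And>a b. D3 (pair a b) = pair (D1 a) b + pair a (D2 b)"
begin

lemma pair_left: "pair (a + a') b = pair a b + pair a' b" "pair (s1 c a) b = s3 c (pair a b)"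
  "pair 0 b = 0" "pair (sum f I) b = (\<Sum>i\<in>I. pair (f i) b)"
proof -
  interpret L: Vector_Spaces.linear s1 s3 "\<lambda>a. pair a b" by (rule linear_left)
  show "pair (a + a') b = pair a b + pair a' b" "pair (s1 c a) b = s3 c (pair a b)"
    "pair 0 b = 0" "pair (sum f I) b = (\<Sum>i\<in>I. pair (f i) b)"
    by (rule L.add L.scale L.zero L.sum)+
qed

lemma pair_right: "pair a (b + b') = pair a b + pair a b'" "pair a (s2 c b) = s3 c (pair a b)"
  "pair a 0 = 0" "pair a (sum g I) = (\<Sum>i\<in>I. pair a (g i))"
proof -
  interpret R: Vector_Spaces.linear s2 s3 "\<lambda>b. pair a b" by (rule linear_right)
  show "pair a (b + b') = pair a b + pair a b'" "pair a (s2 c b) = s3 c (pair a b)"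
    "pair a 0 = 0" "pair a (sum g I) = (\<Sum>i\<in>I. pair a (g i))"
    by (rule R.add R.scale R.zero R.sum)+
qed

text \<open>With divided powers no binomial coefficients occur. In the step to n + 1 both sides are
  multiplied by n + 1, split on the right as i + (n + 1 - i).\<close>

lemma leibniz:
  "divpow s3 D3 n (pair a b) = (\<Sum>i\<le>n. pair (divpow s1 D1 i a) (divpow s2 D2 (n - i) b))"
proof (induction n)
  case 0
  then show ?case by (simp add: divpow_def)
next
  case (Suc n)
  let ?t = "\<lambda>i j. pair (divpow s1 D1 i a) (divpow s2 D2 j b)"
  have "s3 (of_nat (Suc n)) (divpow s3 D3 (Suc n) (pair a b)) = D3 (\<Sum>i\<le>n. ?t i (n - i))"
    using D3.divpow_Suc[of n "pair a b"] Suc.IH by simp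
  also have "\<dots> = (\<Sum>i\<le>n. s3 (of_nat (Suc i)) (?t (Suc i) (n - i)))
      + (\<Sum>i\<le>n. s3 (of_nat (Suc (n - i))) (?t i (Suc (n - i))))"
    by (simp only: D3.sum derivation sum.distrib D1.divpow_Suc D2.divpow_Suc pair_left pair_right)
  also have "(\<Sum>i\<le>n. s3 (of_nat (Suc i)) (?t (Suc i) (n - i)))
      = (\<Sum>i\<le>Suc n. s3 (of_nat i) (?t i (Suc n - i)))"
    by (subst sum.atMost_Suc_shift) simp
  also have "(\<Sum>i\<le>n. s3 (of_nat (Suc (n - i))) (?t i (Suc (n - i))))
      = (\<Sum>i\<le>Suc n. s3 (of_nat (Suc n - i)) (?t i (Suc n - i)))"
    by (simp add: Suc_diff_le del: of_nat_Suc of_nat_diff)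
  also have "(\<Sum>i\<le>Suc n. s3 (of_nat i) (?t i (Suc n - i)))
        + (\<Sum>i\<le>Suc n. s3 (of_nat (Suc n - i)) (?t i (Suc n - i)))
      = (\<Sum>i\<le>Suc n. s3 (of_nat (Suc n)) (?t i (Suc n - i)))"
    unfolding sum.distrib[symmetric] D3.vs1.scale_left_distrib[symmetric] of_nat_add[symmetric]
    by (intro sum.cong) auto
  also have "\<dots> = s3 (of_nat (Suc n)) (\<Sum>i\<le>Suc n. ?t i (Suc n - i))"
    by (simp only: D3.vs1.scale_sum_right)
  finally show ?case
    by (metis D3.vs1.scale_left_imp_eq of_nat_eq_0_iff nat.distinct(1))
qed

lemma divpow_pair_eq_0:
  assumes "(D1 ^^ n) a = 0" "(D2 ^^ m) b = 0" "n + m \<le> k"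
  shows "divpow s3 D3 k (pair a b) = 0"
proof -
  have "pair (divpow s1 D1 i a) (divpow s2 D2 (k - i) b) = 0" if "i \<le> k" for i
  proof (cases "n \<le> i")
    case True
    then show ?thesis
      by (simp add: divpow_def D1.power_eq_0_mono[OF assms(1)] pair_left)
  next
    case False
    then have "m \<le> k - i" using assms by simp
    then show ?thesis
      by (simp add: divpow_def D2.power_eq_0_mono[OF assms(2)] pair_right)
  qed
  then show ?thesis by (simp add: leibniz)
qed

lemma power_pair_eq_0:
  assumes "(D1 ^^ n) a = 0" "(D2 ^^ m) b = 0"
  shows "(D3 ^^ (n + m)) (pair a b) = 0"
  using divpow_pair_eq_0[OF assms order_refl] by (simp add: divpow_def)

text \<open>The exponential of a derivation respects the pairing. The left side sums over the
  triangle i + j < n + m, the right side over the rectangle i < n, j < m; the terms outside the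
  rectangle vanish.\<close>

lemma exp_pair:
  assumes "locally_nilpotent D1" "locally_nilpotent D2"
  shows "lexp s3 D3 (pair a b) = pair (lexp s1 D1 a) (lexp s2 D2 b)"
proof -
  obtain n m where nm: "(D1 ^^ n) a = 0" "(D2 ^^ m) b = 0"
    using assms unfolding locally_nilpotent_def by metis
  let ?t = "\<lambda>i j. pair (divpow s1 D1 i a) (divpow s2 D2 j b)"
  have t0: "?t i j = 0" if "n \<le> i \<or> m \<le> j" for i j
    using that by (auto simp: divpow_def D1.power_eq_0_mono[OF nm(1)]
        D2.power_eq_0_mono[OF nm(2)] pair_left pair_right)
  have "lexp s3 D3 (pair a b) = (\<Sum>k<n+m. \<Sum>i\<le>k. ?t i (k - i))"
    by (simp add: D3.lexp_eq[OF power_pair_eq_0[OF nm]] leibniz)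
  also have "\<dots> = (\<Sum>(i,j)\<in>{(i,j). i + j < n + m}. ?t i j)"
    by (rule sum.triangle_reindex[symmetric])
  also have "\<dots> = (\<Sum>(i,j)\<in>{..<n} \<times> {..<m}. ?t i j)"
  proof (rule sum.mono_neutral_right)
    show "finite {(i,j). i + j < n + m}"
      by (rule finite_subset[of _ "{..<n+m} \<times> {..<n+m}"]) auto
    show "{..<n} \<times> {..<m} \<subseteq> {(i,j). i + j < n + m}" by auto
    show "\<forall>x\<in>{(i,j). i + j < n + m} - {..<n} \<times> {..<m}. (case x of (i, j) \<Rightarrow> ?t i j) = 0"
    proof (intro ballI)
      fix x assume "x \<in> {(i,j). i + j < n + m} - {..<n} \<times> {..<m}"
      then have "n \<le> fst x \<or> m \<le> snd x" by (cases x) auto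
      then show "(case x of (i, j) \<Rightarrow> ?t i j) = 0"
        using t0[of "fst x" "snd x"] by (simp add: split_beta)
    qed
  qed
  also have "\<dots> = pair (lexp s1 D1 a) (lexp s2 D2 b)"
    by (subst D1.lexp_eq[OF nm(1)], subst D2.lexp_eq[OF nm(2)], subst pair_left(4),
        subst pair_right(4)) (simp only: sum.cartesian_product)
  finally show ?thesis .
qed

end

text \<open>The relation e f^k v = k (c - k + 1) f^(k-1) v of sl_2, with P, Q, T for e, f, h.
  Abstract operators allow e and f to exchange roles. For k = 0 the truncated \<open>k - 1\<close>
  is harmless because the coefficient vanishes.\<close>

lemma sl2_power:
  fixes s :: "complex \<Rightarrow> 'v::ab_group_add \<Rightarrow> 'v"
  assumes "vector_space s"
    and P: "Vector_Spaces.linear s s P" and Q: "Vector_Spaces.linear s s Q"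
    and PQ: "\<And>x. P (Q x) = Q (P x) + T x" and TQ: "\<And>x. T (Q x) = Q (T x) - s 2 (Q x)"
    and v: "P v = 0" "T v = s c v"
  shows "P ((Q ^^ k) v) = s (of_nat k * (c - of_nat k + 1)) ((Q ^^ (k - 1)) v)"
proof -
  interpret vector_space s by fact
  interpret P: Vector_Spaces.linear s s P by (rule P)
  interpret Q: Vector_Spaces.linear s s Q by (rule Q)
  have T: "T ((Q ^^ k) v) = s (c - 2 * of_nat k) ((Q ^^ k) v)" for k
  proof (induction k)
    case (Suc k)
    have "T ((Q ^^ Suc k) v) = s (c - 2 * of_nat k) ((Q ^^ Suc k) v) - s 2 ((Q ^^ Suc k) v)"
      by (simp add: TQ Suc.IH Q.scale)
    moreover have "c - 2 * of_nat (Suc k) = c - 2 * of_nat k - 2" by simp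
    ultimately show ?case by (simp only: scale_left_diff_distrib)
  qed (simp add: v)
  show ?thesis
  proof (induction k)
    case 0
    then show ?case by (simp add: v)
  next
    case (Suc k)
    have "P ((Q ^^ Suc k) v) = Q (s (of_nat k * (c - of_nat k + 1)) ((Q ^^ (k - 1)) v))
        + s (c - 2 * of_nat k) ((Q ^^ k) v)"
      by (simp add: PQ T Suc.IH)
    also have "\<dots> = s (of_nat k * (c - of_nat k + 1)) ((Q ^^ k) v)
        + s (c - 2 * of_nat k) ((Q ^^ k) v)"
      by (cases k) (auto simp: Q.scale)
    also have "\<dots> = s (of_nat k * (c - of_nat k + 1) + (c - 2 * of_nat k)) ((Q ^^ k) v)"
      by (simp only: scale_left_distrib)
    also have "of_nat k * (c - of_nat k + 1) + (c - 2 * of_nat k)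
        = of_nat (Suc k) * (c - of_nat (Suc k) + 1)"
      by (simp add: algebra_simps)
    finally show ?case by simp
  qed
qed

text \<open>For the least k with \<open>(Q ^^ k) v = 0\<close> the coefficient k (c - k + 1) must
  vanish while k > 0, so c = k - 1.\<close>

lemma sl2_highest_weight_nat:
  fixes s :: "complex \<Rightarrow> 'v::ab_group_add \<Rightarrow> 'v"
  assumes "vector_space s"
    and P: "Vector_Spaces.linear s s P" and Q: "Vector_Spaces.linear s s Q"
    and PQ: "\<And>x. P (Q x) = Q (P x) + T x" and TQ: "\<And>x. T (Q x) = Q (T x) - s 2 (Q x)"
    and v: "P v = 0" "T v = s c v" "v \<noteq> 0" and nil: "(Q ^^ n) v = 0"
  shows "c \<in> \<nat>"
proof -
  interpret vector_space s by fact
  interpret P: Vector_Spaces.linear s s P by (rule P)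
  define k where "k = (LEAST n. (Q ^^ n) v = 0)"
  have k: "(Q ^^ k) v = 0" unfolding k_def using nil by (rule LeastI)
  have "k \<noteq> 0" using k v(3) by (intro notI) simp
  then have "(Q ^^ (k - 1)) v \<noteq> 0"
    using not_less_Least[of "k - 1" "\<lambda>n. (Q ^^ n) v = 0"] by (simp add: k_def)
  moreover have "s (of_nat k * (c - of_nat k + 1)) ((Q ^^ (k - 1)) v) = 0"
    using sl2_power[OF assms(1-7), of k] k by simp
  ultimately have "of_nat k * (c - of_nat k + 1) = 0" by simp
  then have "c - of_nat k + 1 = 0" using \<open>k \<noteq> 0\<close> by simp
  then have "c = of_nat (k - 1)" using \<open>k \<noteq> 0\<close> by (simp add: of_nat_diff algebra_simps)
  then show ?thesis by simp
qed

section \<open>Contragredient Lie superalgebras\<close>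

lemma pres_eq_Plus_swap:
  "pres_eq p R (Plus (Plus s t) (Plus u v)) (Plus (Plus s u) (Plus t v))"
proof -
  have "pres_eq p R (Plus t (Plus u v)) (Plus u (Plus t v))"
    by (meson Plus_assoc Plus_comm Plus_cong eq_refl eq_sym eq_trans)
  then have "pres_eq p R (Plus s (Plus t (Plus u v))) (Plus s (Plus u (Plus t v)))"
    by (rule Plus_cong[OF eq_refl])
  then show ?thesis
    by (meson Plus_assoc eq_sym eq_trans)
qed

text \<open>Needed to verify the grading clause of \<open>pres_ideal\<close>, which asks for
  homogeneous terms and not merely for homogeneous values.\<close>

lemma pres_eq_homogeneous_decomposition:
  "\<exists>s0 s1. homog p 0 s0 \<and> homog p 1 s1 \<and> pres_eq p R s (Plus s0 s1)"
proof (induction s)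
  have hom: "\<exists>s0 s1. homog p 0 s0 \<and> homog p 1 s1 \<and> pres_eq p R s (Plus s0 s1)"
    if "homog p d s" for d s
  proof (cases "d = 0")
    case True
    then show ?thesis
      using that by (intro exI[of _ s] exI[of _ Zero]) (auto intro: homog.intros eq_sym Plus_Zero)
  next
    case False
    then show ?thesis
      using that by (rule_tac exI[of _ Zero], rule_tac exI[of _ s])
        (auto intro: homog.intros eq_trans[OF eq_sym[OF Plus_Zero] Plus_comm])
  qed
  {
    case (GenH h)
    show ?case by (rule hom) (rule homog.intros)
  next
    case (GenX i)
    show ?case by (rule hom) (rule homog.intros)
  next
    case (GenY i)
    show ?case by (rule hom) (rule homog.intros)
  next
    case Zero
    show ?case by (rule hom[of 0]) (rule homog.intros)
  next
    case (Plus s t)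
    then show ?case
      by (meson Plus_cong eq_trans homog.intros(5) pres_eq_Plus_swap)
  next
    case (Smult k s)
    then show ?case
      by (meson Smult_cong Smult_Plus eq_trans homog.intros(6))
  next
    case (Brak s t)
    then obtain s0 s1 t0 t1 where st: "homog p 0 s0" "homog p 1 s1" "pres_eq p R s (Plus s0 s1)"
      "homog p 0 t0" "homog p 1 t1" "pres_eq p R t (Plus t0 t1)"
      by blast
    let ?u0 = "Plus (Brak s0 t0) (Brak s1 t1)" and ?u1 = "Plus (Brak s0 t1) (Brak s1 t0)"
    have "pres_eq p R (Brak s t) (Brak (Plus s0 s1) (Plus t0 t1))"
      using st by (intro Brak_cong)
    moreover have "pres_eq p R (Brak (Plus s0 s1) (Plus t0 t1))
        (Plus (Brak s0 (Plus t0 t1)) (Brak s1 (Plus t0 t1)))"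
      by (rule Brak_Plus_left)
    moreover have "pres_eq p R (Plus (Brak s0 (Plus t0 t1)) (Brak s1 (Plus t0 t1)))
        (Plus (Plus (Brak s0 t0) (Brak s0 t1)) (Plus (Brak s1 t1) (Brak s1 t0)))"
      by (meson Plus_cong Brak_Plus_right Plus_comm eq_trans)
    moreover have "pres_eq p R
        (Plus (Plus (Brak s0 t0) (Brak s0 t1)) (Plus (Brak s1 t1) (Brak s1 t0))) (Plus ?u0 ?u1)"
      by (rule pres_eq_Plus_swap)
    ultimately have "pres_eq p R (Brak s t) (Plus ?u0 ?u1)"
      by (meson eq_trans)
    moreover have "homog p 0 ?u0"
      using homog.intros(7)[OF st(1,4)] homog.intros(7)[OF st(2,5)] by (intro homog.intros) simp_all
    moreover have "homog p 1 ?u1"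
      using homog.intros(7)[OF st(1,5)] homog.intros(7)[OF st(2,4)] by (intro homog.intros) simp_all
    ultimately show ?case by blast
  }
qed

section \<open>The contragredient superalgebra as a quotient of the presented one\<close>

locale contragredient_superalgebra =
  fixes A :: "complex^'i^'i" and p :: "'i::finite \<Rightarrow> bit"
    and G :: "('h::ab_group_add, 'i, 'g::ab_group_add) contragredient"
  assumes contragredient: "is_contragredient A p G"
begin

abbreviation bracket (\<open>\<langle>_,/ _\<rangle>\<close>) where "\<langle>x, y\<rangle> \<equiv> brk G x y"

lemma lie_superalgebra: "is_lie_superalgebra G"
  using contragredient by (simp add: is_contragredient_def)

lemma realization: "is_realization A (cartan G)"
  using contragredient by (simp add: is_contragredient_def)

sublocale g: vector_space "scal G"
  using lie_superalgebra by (simp add: is_lie_superalgebra_def is_superspace_def)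

sublocale hh: vector_space "hscal (cartan G)"
  using realization by (simp add: is_realization_def)

lemma br_linear_right: "Vector_Spaces.linear (scal G) (scal G) (\<lambda>y. \<langle>x, y\<rangle>)"
  and br_linear_left: "Vector_Spaces.linear (scal G) (scal G) (\<lambda>x. \<langle>x, y\<rangle>)"
  using lie_superalgebra by (simp_all add: is_lie_superalgebra_def)

lemma br_right: "\<langle>x, y + z\<rangle> = \<langle>x, y\<rangle> + \<langle>x, z\<rangle>" "\<langle>x, scal G c y\<rangle> = scal G c \<langle>x, y\<rangle>"
  "\<langle>x, 0\<rangle> = 0" "\<langle>x, - y\<rangle> = - \<langle>x, y\<rangle>" "\<langle>x, y - z\<rangle> = \<langle>x, y\<rangle> - \<langle>x, z\<rangle>"
proof -
  interpret Vector_Spaces.linear "scal G" "scal G" "\<lambda>y. \<langle>x, y\<rangle>" by (rule br_linear_right)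
  show "\<langle>x, y + z\<rangle> = \<langle>x, y\<rangle> + \<langle>x, z\<rangle>" "\<langle>x, scal G c y\<rangle> = scal G c \<langle>x, y\<rangle>" "\<langle>x, 0\<rangle> = 0"
    "\<langle>x, - y\<rangle> = - \<langle>x, y\<rangle>" "\<langle>x, y - z\<rangle> = \<langle>x, y\<rangle> - \<langle>x, z\<rangle>"
    by (rule add scale zero neg diff)+
qed

lemma br_left: "\<langle>x + z, y\<rangle> = \<langle>x, y\<rangle> + \<langle>z, y\<rangle>" "\<langle>scal G c x, y\<rangle> = scal G c \<langle>x, y\<rangle>"
  "\<langle>0, y\<rangle> = 0" "\<langle>- x, y\<rangle> = - \<langle>x, y\<rangle>" "\<langle>x - z, y\<rangle> = \<langle>x, y\<rangle> - \<langle>z, y\<rangle>"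
proof -
  interpret Vector_Spaces.linear "scal G" "scal G" "\<lambda>x. \<langle>x, y\<rangle>" by (rule br_linear_left)
  show "\<langle>x + z, y\<rangle> = \<langle>x, y\<rangle> + \<langle>z, y\<rangle>" "\<langle>scal G c x, y\<rangle> = scal G c \<langle>x, y\<rangle>" "\<langle>0, y\<rangle> = 0"
    "\<langle>- x, y\<rangle> = - \<langle>x, y\<rangle>" "\<langle>x - z, y\<rangle> = \<langle>x, y\<rangle> - \<langle>z, y\<rangle>"
    by (rule add scale zero neg diff)+
qed

lemmas br_simps = br_left br_right

lemma part_subspace: "g.subspace (part G d)"
  using lie_superalgebra by (simp add: is_lie_superalgebra_def is_superspace_def)

lemma part_disjoint: "x \<in> part G 0 \<Longrightarrow> x \<in> part G 1 \<Longrightarrow> x = 0"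
  using lie_superalgebra by (auto simp add: is_lie_superalgebra_def is_superspace_def)

lemma part_decomposition: obtains x0 x1 where "x0 \<in> part G 0" "x1 \<in> part G 1" "x = x0 + x1"
  using lie_superalgebra unfolding is_lie_superalgebra_def is_superspace_def by meson

lemma br_part: "x \<in> part G i \<Longrightarrow> y \<in> part G j \<Longrightarrow> \<langle>x, y\<rangle> \<in> part G (i + j)"
  using lie_superalgebra unfolding is_lie_superalgebra_def by blast

lemma br_skew:
  "x \<in> part G i \<Longrightarrow> y \<in> part G j \<Longrightarrow> \<langle>x, y\<rangle> = scal G (- koszul_sign i j) \<langle>y, x\<rangle>"
  using lie_superalgebra unfolding is_lie_superalgebra_def by blast

lemma br_jacobi:
  "x \<in> part G i \<Longrightarrow> y \<in> part G j \<Longrightarrow>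
    \<langle>x, \<langle>y, z\<rangle>\<rangle> = \<langle>\<langle>x, y\<rangle>, z\<rangle> + scal G (koszul_sign i j) \<langle>y, \<langle>x, z\<rangle>\<rangle>"
  using lie_superalgebra unfolding is_lie_superalgebra_def by blast

lemma br_skew_even: "x \<in> part G 0 \<Longrightarrow> \<langle>y, x\<rangle> = - \<langle>x, y\<rangle>"
proof -
  assume x: "x \<in> part G 0"
  obtain y0 y1 where y: "y0 \<in> part G 0" "y1 \<in> part G 1" "y = y0 + y1"
    by (rule part_decomposition)
  show ?thesis
    using br_skew[OF y(1) x] br_skew[OF y(2) x] by (simp add: y(3) br_simps koszul_sign_def)
qed

lemma br_skew_odd: "x \<in> part G 1 \<Longrightarrow> y \<in> part G 1 \<Longrightarrow> \<langle>y, x\<rangle> = \<langle>x, y\<rangle>"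
  using br_skew[of y 1 x 1] by (simp add: koszul_sign_def)

lemma br_jacobi_even: "x \<in> part G 0 \<Longrightarrow> \<langle>x, \<langle>y, z\<rangle>\<rangle> = \<langle>\<langle>x, y\<rangle>, z\<rangle> + \<langle>y, \<langle>x, z\<rangle>\<rangle>"
proof -
  assume x: "x \<in> part G 0"
  obtain y0 y1 where y: "y0 \<in> part G 0" "y1 \<in> part G 1" "y = y0 + y1"
    by (rule part_decomposition)
  show ?thesis
    using br_jacobi[OF x y(1), of z] br_jacobi[OF x y(2), of z]
    by (simp add: y(3) br_simps koszul_sign_def algebra_simps)
qed

lemma br_jacobi_odd:
  "x \<in> part G 1 \<Longrightarrow> y \<in> part G 1 \<Longrightarrow> \<langle>x, \<langle>y, z\<rangle>\<rangle> = \<langle>\<langle>x, y\<rangle>, z\<rangle> - \<langle>y, \<langle>x, z\<rangle>\<rangle>"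
  using br_jacobi[of x 1 y 1 z] by (simp add: koszul_sign_def)

lemma pres_ideal_kernel: "pres_ideal p (cartan G) {s. term_value G s = 0}"
  using contragredient by (simp add: is_contragredient_def is_maximal_ideal_def)

text \<open>The kernel of evaluation is saturated under \<open>pres_eq\<close> and contains
  \<open>Zero\<close>, hence also the formal difference of s and t. Through this lemma every
  defining relation becomes an identity in G.\<close>

lemma term_value_pres_eq:
  assumes "pres_eq p (cartan G) s t"
  shows "term_value G s = term_value G t"
proof -
  have "pres_eq p (cartan G) Zero (Plus s (Smult (- 1) t))"
    by (meson assms Plus_minus Plus_cong Smult_cong eq_refl eq_sym eq_trans)
  moreover have "Zero \<in> {s. term_value G s = 0}" by simp
  ultimately have "Plus s (Smult (- 1) t) \<in> {s. term_value G s = 0}"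
    using pres_ideal_kernel unfolding pres_ideal_def by blast
  then show ?thesis by simp
qed

lemma incl_add: "incl G (h + h') = incl G h + incl G h'"
  using term_value_pres_eq[OF GenH_add] by simp

lemma incl_scale: "incl G (hscal (cartan G) k h) = scal G k (incl G h)"
  using term_value_pres_eq[OF GenH_scale] by simp

sublocale incl: Vector_Spaces.linear "hscal (cartan G)" "scal G" "incl G"
  by unfold_locales (auto simp: incl_add incl_scale)

lemma incl_eq_0_iff [simp]: "incl G h = 0 \<longleftrightarrow> h = 0"
  using contragredient
  by (auto simp: is_contragredient_def is_maximal_ideal_def meets_cartan_trivially_def)

lemma incl_eq_iff [simp]: "incl G h = incl G h' \<longleftrightarrow> h = h'"
  by (metis incl.diff incl_eq_0_iff eq_iff_diff_eq_0)

lemma term_value_part: "homog p d s \<Longrightarrow> term_value G s \<in> part G d"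
  using contragredient by (simp add: is_contragredient_def)

lemma incl_part: "incl G h \<in> part G 0"
  using term_value_part[OF homog.intros(1)] by simp

lemma genX_part: "genX G i \<in> part G (p i)" and genY_part: "genY G i \<in> part G (p i)"
  using term_value_part[OF homog.intros(2)] term_value_part[OF homog.intros(3)] by simp_all

lemma br_incl_incl [simp]: "\<langle>incl G h, incl G h'\<rangle> = 0"
  using term_value_pres_eq[OF rel_HH] by simp

lemma br_incl_genX: "\<langle>incl G h, genX G i\<rangle> = scal G (sroot (cartan G) i h) (genX G i)"
  using term_value_pres_eq[OF rel_HX] by simp

lemma br_incl_genY: "\<langle>incl G h, genY G i\<rangle> = scal G (- sroot (cartan G) i h) (genY G i)"
  using term_value_pres_eq[OF rel_HY, of h i] by simp

lemma br_genX_genY: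
  "\<langle>genX G i, genY G j\<rangle> = (if i = j then incl G (scoroot (cartan G) i) else 0)"
  using term_value_pres_eq[OF rel_XY, of i j] by (simp split: if_splits)

lemma generators_generate:
  assumes S: "g.subspace S" "\<And>x y. x \<in> S \<Longrightarrow> y \<in> S \<Longrightarrow> \<langle>x, y\<rangle> \<in> S"
    and gens: "range (incl G) \<subseteq> S" "range (genX G) \<subseteq> S" "range (genY G) \<subseteq> S"
  shows "S = UNIV"
proof -
  have "term_value G s \<in> S" for s
    using assms by (induction s) (auto intro: g.subspace_0 g.subspace_add g.subspace_scale)
  moreover have "surj (term_value G)"
    using contragredient by (simp add: is_contragredient_def)
  ultimately show ?thesis by (metis UNIV_eq_I surjD)
qed

text \<open>Maximality of the kernel, transported to G: the terms with value in J form an ideal of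
  the presented superalgebra that meets the Cartan subalgebra trivially, hence they have value 0.
  The Serre relations and \<open>\<langle>X i, X i\<rangle> = 0\<close> are derived from
  this.\<close>

lemma graded_ideal_zero:
  assumes J: "graded_subspace G J" and ideal: "\<And>x y. y \<in> J \<Longrightarrow> \<langle>x, y\<rangle> \<in> J"
    and cartan: "\<And>h. incl G h \<in> J \<Longrightarrow> h = 0"
  shows "J \<subseteq> {0}"
proof -
  have sub: "g.subspace J" using J by (simp add: graded_subspace_def)
  have graded: "\<exists>w0\<in>J \<inter> part G 0. \<exists>w1\<in>J \<inter> part G 1. w = w0 + w1" if "w \<in> J" for w
    using J that by (simp add: graded_subspace_def)
  \<comment> \<open>Super skew-symmetry holds for homogeneous elements only, so both arguments are
    split; the components of y stay in J because J is graded.\<close>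
  have ideal': "\<langle>y, x\<rangle> \<in> J" if yJ: "y \<in> J" for x y
  proof -
    obtain y0 y1 where y: "y0 \<in> J \<inter> part G 0" "y1 \<in> J \<inter> part G 1" "y = y0 + y1"
      using graded[OF yJ] by blast
    obtain x0 x1 where x: "x0 \<in> part G 0" "x1 \<in> part G 1" "x = x0 + x1"
      by (rule part_decomposition)
    have "\<langle>y0, x0\<rangle> \<in> J" "\<langle>y0, x1\<rangle> \<in> J"
      using y br_skew_even[of y0] ideal[of y0] g.subspace_neg[OF sub] by (metis IntD1 IntD2 minus_minus)+
    moreover have "\<langle>y1, x0\<rangle> \<in> J" "\<langle>y1, x1\<rangle> \<in> J"
      using y x br_skew_even[of x0 y1] br_skew_odd[of x1 y1] ideal[of y1] g.subspace_neg[OF sub] by auto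
    ultimately show ?thesis
      unfolding y(3) br_left unfolding x(3) br_right by (intro g.subspace_add[OF sub])
  qed
  let ?K = "{s. term_value G s \<in> J}"
  have "pres_ideal p (cartan G) ?K"
    unfolding pres_ideal_def
  proof (intro conjI allI impI ballI)
    fix s assume s: "s \<in> ?K"
    obtain s0 s1 where s01: "homog p 0 s0" "homog p 1 s1" "pres_eq p (cartan G) s (Plus s0 s1)"
      using pres_eq_homogeneous_decomposition by blast
    obtain w0 w1 where w: "w0 \<in> J \<inter> part G 0" "w1 \<in> J \<inter> part G 1" "term_value G s = w0 + w1"
      using graded s by blast
    have eq: "term_value G s0 + term_value G s1 = w0 + w1"
      using term_value_pres_eq[OF s01(3)] w by simp
    have "term_value G s0 - w0 \<in> part G 0" "w1 - term_value G s1 \<in> part G 1"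
      using s01 w by (auto intro!: g.subspace_diff[OF part_subspace] term_value_part)
    moreover have "term_value G s0 - w0 = w1 - term_value G s1"
      using eq by (simp add: algebra_simps)
    ultimately have "term_value G s0 - w0 = 0"
      using part_disjoint by metis
    then have "term_value G s0 = w0" "term_value G s1 = w1"
      using eq by auto
    then show "\<exists>s0\<in>?K. \<exists>s1\<in>?K. homog p 0 s0 \<and> homog p 1 s1 \<and> pres_eq p (cartan G) s (Plus s0 s1)"
      using s01 w by auto
  next
    fix s t assume "s \<in> ?K" "pres_eq p (cartan G) s t"
    then show "t \<in> ?K" using term_value_pres_eq[of s t] by simp
  qed (simp_all add: ideal ideal' g.subspace_0[OF sub] g.subspace_add[OF sub] g.subspace_scale[OF sub])
  moreover have "meets_cartan_trivially ?K"
    using cartan by (auto simp: meets_cartan_trivially_def)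
  ultimately have K: "?K \<subseteq> {s. term_value G s = 0}"
    using contragredient by (auto simp: is_contragredient_def is_maximal_ideal_def)
  have surj: "surj (term_value G)"
    using contragredient by (simp add: is_contragredient_def)
  show ?thesis
  proof
    fix y assume "y \<in> J"
    moreover obtain s where "y = term_value G s" using surj by (rule surjE)
    ultimately show "y \<in> {0}" using K by auto
  qed
qed

end

section \<open>Modules over the superalgebra\<close>

locale representation = contragredient_superalgebra A p G
  for A :: "complex^'i^'i" and p :: "'i::finite \<Rightarrow> bit"
    and G :: "('h::ab_group_add, 'i, 'g::ab_group_add) contragredient" +
  fixes V :: "('g, 'v::ab_group_add) supermodule"
  assumes supermodule: "is_supermodule G V"
begin

sublocale v: vector_space "scal V"
  using supermodule by (simp add: is_supermodule_def is_superspace_def)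

lemma act_linear_right: "Vector_Spaces.linear (scal V) (scal V) (\<lambda>v. act V x v)"
  and act_linear_left: "Vector_Spaces.linear (scal G) (scal V) (\<lambda>x. act V x v)"
  using supermodule by (simp_all add: is_supermodule_def)

lemma act_right: "act V x (v + w) = act V x v + act V x w"
  "act V x (scal V c v) = scal V c (act V x v)"
  "act V x 0 = 0" "act V x (- v) = - act V x v" "act V x (v - w) = act V x v - act V x w"
proof -
  interpret Vector_Spaces.linear "scal V" "scal V" "\<lambda>v. act V x v" by (rule act_linear_right)
  show "act V x (v + w) = act V x v + act V x w"
    "act V x (scal V c v) = scal V c (act V x v)"
    "act V x 0 = 0" "act V x (- v) = - act V x v" "act V x (v - w) = act V x v - act V x w"
    by (rule add scale zero neg diff)+
qed

lemma act_left: "act V (x + y) v = act V x v + act V y v"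
  "act V (scal G c x) v = scal V c (act V x v)"
  "act V 0 v = 0" "act V (- x) v = - act V x v" "act V (x - y) v = act V x v - act V y v"
proof -
  interpret Vector_Spaces.linear "scal G" "scal V" "\<lambda>x. act V x v" by (rule act_linear_left)
  show "act V (x + y) v = act V x v + act V y v"
    "act V (scal G c x) v = scal V c (act V x v)"
    "act V 0 v = 0" "act V (- x) v = - act V x v" "act V (x - y) v = act V x v - act V y v"
    by (rule add scale zero neg diff)+
qed

lemmas act_simps = act_left act_right

lemma vpart_subspace: "v.subspace (part V d)"
  using supermodule by (simp add: is_supermodule_def is_superspace_def)

lemma act_part: "x \<in> part G i \<Longrightarrow> v \<in> part V j \<Longrightarrow> act V x v \<in> part V (i + j)"
  using supermodule unfolding is_supermodule_def by blast

lemma act_br: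
  "x \<in> part G i \<Longrightarrow> y \<in> part G j \<Longrightarrow>
    act V x (act V y v) = act V \<langle>x, y\<rangle> v + scal V (koszul_sign i j) (act V y (act V x v))"
proof -
  assume "x \<in> part G i" "y \<in> part G j"
  then have "act V \<langle>x, y\<rangle> v =
      act V x (act V y v) - scal V (koszul_sign i j) (act V y (act V x v))"
    using supermodule unfolding is_supermodule_def by blast
  then show ?thesis by simp
qed

lemma act_br_odd:
  "x \<in> part G 1 \<Longrightarrow> y \<in> part G 1 \<Longrightarrow>
    act V x (act V y v) = act V \<langle>x, y\<rangle> v - act V y (act V x v)"
  using act_br[of x 1 y 1 v] by (simp add: koszul_sign_def)

lemma act_br_even:
  assumes x: "x \<in> part G 0"
  shows "act V x (act V y v) = act V \<langle>x, y\<rangle> v + act V y (act V x v)"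
proof -
  obtain y0 y1 where y: "y0 \<in> part G 0" "y1 \<in> part G 1" "y = y0 + y1"
    by (rule part_decomposition)
  show ?thesis
    using act_br[OF x y(1), of v] act_br[OF x y(2), of v]
    by (simp add: y(3) br_simps act_simps koszul_sign_def)
qed

end

text \<open>Viewing G as a module over itself makes every result on modules available for the
  bracket.\<close>

definition adjoint ::
  "('h, 'i, 'g::ab_group_add) contragredient \<Rightarrow> ('g, 'g) supermodule" where
  "adjoint G = \<lparr>scal = scal G, part = part G, act = brk G\<rparr>"

lemma adjoint_simps [simp]:
  "scal (adjoint G) = scal G" "part (adjoint G) = part G" "act (adjoint G) = brk G"
  by (simp_all add: adjoint_def)

lemma (in contragredient_superalgebra) representation_adjoint:
  "representation A p G (adjoint G)"
proof unfold_locales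
  have "is_superspace (adjoint G)"
    using lie_superalgebra by (simp add: is_lie_superalgebra_def is_superspace_def)
  moreover have "\<langle>\<langle>x, y\<rangle>, z\<rangle> = \<langle>x, \<langle>y, z\<rangle>\<rangle> - scal G (koszul_sign i j) \<langle>y, \<langle>x, z\<rangle>\<rangle>"
    if "x \<in> part G i" "y \<in> part G j" for x y z i j
    using br_jacobi[OF that] by simp
  ultimately show "is_supermodule G (adjoint G)"
    unfolding is_supermodule_def adjoint_simps
    using br_linear_left br_linear_right br_part by blast
qed

section \<open>Root decomposition with respect to a Chevalley system\<close>

definition root_comb :: "('i::finite \<Rightarrow> 'h \<Rightarrow> complex) \<Rightarrow> ('i \<Rightarrow> int) \<Rightarrow> 'h \<Rightarrow> complex" where
  "root_comb \<alpha> n h = (\<Sum>i\<in>UNIV. of_int (n i) * \<alpha> i h)"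

text \<open>The weight of an iterated bracket along the word l; counting letters makes it comparable
  with \<open>root_comb\<close>.\<close>

definition list_weight :: "('i::finite \<Rightarrow> 'h \<Rightarrow> complex) \<Rightarrow> 'i list \<Rightarrow> 'h \<Rightarrow> complex" where
  "list_weight \<alpha> l = root_comb \<alpha> (\<lambda>i. int (count_list l i))"

lemma list_weight_Nil [simp]: "list_weight \<alpha> [] h = 0"
  by (simp add: list_weight_def root_comb_def)

lemma list_weight_Cons [simp]: "list_weight \<alpha> (i # l) h = \<alpha> i h + list_weight \<alpha> l h"
proof -
  have "(of_int (int (count_list (i # l) j)) :: complex) * \<alpha> j h =
      (if j = i then \<alpha> j h else 0) + of_int (int (count_list l j)) * \<alpha> j h" for j
    by (simp add: algebra_simps)
  then show ?thesis
    by (simp only: list_weight_def root_comb_def sum.distrib) simp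
qed

lemma list_weight_append [simp]:
  "list_weight \<alpha> (l @ l') h = list_weight \<alpha> l h + list_weight \<alpha> l' h"
  by (induction l) auto

lemma list_weight_uminus: "list_weight (\<lambda>i h. - \<alpha> i h) l h = - list_weight \<alpha> l h"
  by (induction l) auto

lemma list_weight_replicate [simp]: "list_weight \<alpha> (replicate n i) h = of_nat n * \<alpha> i h"
  by (induction n) (auto simp: algebra_simps)

text \<open>Generators of G adapted to some base, not necessarily the defining one. The parities r
  are arbitrary, so that the locale covers the original base, its three odd reflections, which
  contain even roots, and the opposites of all these. Maximality of the ideal is inherited from
  G.\<close>

locale chevalley_system = contragredient_superalgebra A p G
  for A :: "complex^'i^'i" and p :: "'i::finite \<Rightarrow> bit"
    and G :: "('h::ab_group_add, 'i, 'g::ab_group_add) contragredient" +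
  fixes r :: "'i \<Rightarrow> bit" and X Y :: "'i \<Rightarrow> 'g" and \<alpha> :: "'i \<Rightarrow> 'h \<Rightarrow> complex" and hc :: "'i \<Rightarrow> 'h"
  assumes X_part: "X i \<in> part G (r i)" and Y_part: "Y i \<in> part G (r i)"
    and X_root: "\<langle>incl G h, X i\<rangle> = scal G (\<alpha> i h) (X i)"
    and Y_root: "\<langle>incl G h, Y i\<rangle> = scal G (- \<alpha> i h) (Y i)"
    and XY: "\<langle>X i, Y j\<rangle> = (if i = j then incl G (hc i) else 0)"
    and hc_nonzero: "hc i \<noteq> 0"
    and \<alpha>_independent: "(\<And>h. (\<Sum>i\<in>UNIV. u i * \<alpha> i h) = 0) \<Longrightarrow> u i = 0"
    and generate: "g.subspace S \<Longrightarrow> (\<And>x y. x \<in> S \<Longrightarrow> y \<in> S \<Longrightarrow> \<langle>x, y\<rangle> \<in> S) \<Longrightarrow>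
      range X \<subseteq> S \<Longrightarrow> range Y \<subseteq> S \<Longrightarrow> range (incl G) \<subseteq> S \<Longrightarrow> S = UNIV"
begin

lemma root_comb_inject: "root_comb \<alpha> n = root_comb \<alpha> n' \<longleftrightarrow> n = n'"
proof
  assume "root_comb \<alpha> n = root_comb \<alpha> n'"
  then have "(\<Sum>i\<in>UNIV. of_int (n i - n' i) * \<alpha> i h) = 0" for h
    by (simp add: fun_eq_iff root_comb_def algebra_simps sum_subtractf)
  then have "of_int (n i - n' i) = (0::complex)" for i
    by (rule \<alpha>_independent)
  then show "n = n'" by (simp add: fun_eq_iff)
qed simp

lemma root_comb_zero [simp]: "root_comb \<alpha> (\<lambda>_. 0) = (\<lambda>_. 0)"
  by (simp add: root_comb_def fun_eq_iff)

lemma root_comb_uminus: "(\<lambda>h. - root_comb \<alpha> n h) = root_comb \<alpha> (\<lambda>i. - n i)"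
  by (simp add: root_comb_def fun_eq_iff sum_negf)

lemma list_weight_eq_0: "list_weight \<alpha> l = (\<lambda>_. 0) \<longleftrightarrow> l = []"
proof
  assume "list_weight \<alpha> l = (\<lambda>_. 0)"
  then have "root_comb \<alpha> (\<lambda>i. int (count_list l i)) = root_comb \<alpha> (\<lambda>_. 0)"
    by (simp add: list_weight_def)
  then have "(\<lambda>i. int (count_list l i)) = (\<lambda>_. 0)"
    by (simp only: root_comb_inject)
  then have "count_list l i = 0" for i by (simp add: fun_eq_iff)
  then have "i \<notin> set l" for i by (simp add: count_list_0_iff)
  then show "l = []" by (metis list.set_sel(1))
qed auto

lemma YX: "\<langle>Y j, X i\<rangle> = (if i = j then incl G (hscal (cartan G) (- koszul_sign (r i) (r i)) (hc i)) else 0)"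
  using br_skew[OF Y_part X_part, of j i] by (auto simp: XY incl_scale incl.neg)

text \<open>Exchanging the positive and negative generators. For odd i the bracket of X i and Y i is
  symmetric and the coroot stays; for even i it changes sign.\<close>

lemma swapped: "chevalley_system A p G r Y X (\<lambda>i h. - \<alpha> i h)
    (\<lambda>i. hscal (cartan G) (- koszul_sign (r i) (r i)) (hc i))"
proof unfold_locales
  fix u :: "'i \<Rightarrow> complex" and i
  assume "\<And>h. (\<Sum>i\<in>UNIV. u i * - \<alpha> i h) = 0"
  then show "u i = 0" by (intro \<alpha>_independent[of u]) (simp add: sum_negf)
next
  fix S assume "g.subspace S" "\<And>x y. x \<in> S \<Longrightarrow> y \<in> S \<Longrightarrow> \<langle>x, y\<rangle> \<in> S"
      "range Y \<subseteq> S" "range X \<subseteq> S" "range (incl G) \<subseteq> S"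
  then show "S = UNIV" by (intro generate) auto
qed (auto simp: X_part Y_part X_root Y_root YX hc_nonzero koszul_sign_def incl_scale incl.neg)

end

locale chevalley_representation =
  chevalley_system A p G r X Y \<alpha> hc + representation A p G V
  for A :: "complex^'i^'i" and p :: "'i::finite \<Rightarrow> bit"
    and G :: "('h::ab_group_add, 'i, 'g::ab_group_add) contragredient"
    and r X Y \<alpha> hc and V :: "('g, 'v::ab_group_add) supermodule"
begin

text \<open>The stabilizer of W is closed under brackets, so it suffices to test generators.\<close>

lemma act_closed:
  assumes W: "v.subspace W"
    and X: "\<And>i w. w \<in> W \<Longrightarrow> act V (X i) w \<in> W" and Y: "\<And>i w. w \<in> W \<Longrightarrow> act V (Y i) w \<in> W"
    and H: "\<And>h w. w \<in> W \<Longrightarrow> act V (incl G h) w \<in> W" and w: "w \<in> W"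
  shows "act V x w \<in> W"
proof -
  define S where "S x \<longleftrightarrow> (\<forall>w\<in>W. act V x w \<in> W)" for x
  have S_add: "S (x + y)" if "S x" "S y" for x y
    using that by (auto simp: S_def act_simps v.subspace_add[OF W])
  have S_scale: "S (scal G c x)" if "S x" for x c
    using that by (auto simp: S_def act_simps v.subspace_scale[OF W])
  have S_0: "S 0" by (auto simp: S_def act_simps v.subspace_0[OF W])
  have S_br: "S \<langle>x, y\<rangle>" if "S x" "S y" "x \<in> part G i" "y \<in> part G j" for x y i j
  proof -
    have "act V \<langle>x, y\<rangle> w = act V x (act V y w) - scal V (koszul_sign i j) (act V y (act V x w))" for w
      using act_br[OF that(3,4), of w] by simp
    then show ?thesis using that(1,2)
      by (auto simp: S_def intro!: v.subspace_diff[OF W] v.subspace_scale[OF W])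
  qed
  \<comment> \<open>A bracket acts as a supercommutator only for homogeneous arguments, so the
    stabilizer is replaced by the elements both of whose homogeneous components stabilize W.\<close>
  define D where "D = {x. \<exists>x0\<in>part G 0. \<exists>x1\<in>part G 1. x = x0 + x1 \<and> S x0 \<and> S x1}"
  have D: "x \<in> D" if "x \<in> part G d" "S x" for x d
  proof (cases "d = 0")
    case True
    then show ?thesis using that S_0 g.subspace_0[OF part_subspace]
      unfolding D_def by (intro CollectI bexI[of _ x "part G 0"] bexI[of _ 0 "part G 1"]) auto
  next
    case False
    then show ?thesis using that S_0 g.subspace_0[OF part_subspace]
      unfolding D_def by (intro CollectI bexI[of _ 0 "part G 0"] bexI[of _ x "part G 1"]) auto
  qed
  have D_add: "x + y \<in> D" if xy: "x \<in> D" "y \<in> D" for x y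
  proof -
    obtain x0 x1 y0 y1 where "x0 \<in> part G 0" "x1 \<in> part G 1" "x = x0 + x1" "S x0" "S x1"
        "y0 \<in> part G 0" "y1 \<in> part G 1" "y = y0 + y1" "S y0" "S y1"
      using xy unfolding D_def by blast
    then show ?thesis
      unfolding D_def
      by (intro CollectI bexI[of _ "x0 + y0"] bexI[of _ "x1 + y1"])
        (auto simp: S_add g.subspace_add[OF part_subspace])
  qed
  have "D = UNIV"
  proof (rule generate)
    show "g.subspace D"
    proof (rule g.subspaceI)
      show "0 \<in> D" by (rule D[of _ 0]) (auto simp: S_0 g.subspace_0[OF part_subspace])
      show "scal G c x \<in> D" if "x \<in> D" for c x
      proof -
        obtain x0 x1 where "x0 \<in> part G 0" "x1 \<in> part G 1" "x = x0 + x1" "S x0" "S x1"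
          using \<open>x \<in> D\<close> unfolding D_def by blast
        then show ?thesis
          unfolding D_def
          by (intro CollectI bexI[of _ "scal G c x0"] bexI[of _ "scal G c x1"])
            (auto simp: S_scale g.subspace_scale[OF part_subspace] g.scale_right_distrib)
      qed
    qed (rule D_add)
    show "\<langle>x, y\<rangle> \<in> D" if xy: "x \<in> D" "y \<in> D" for x y
    proof -
      obtain x0 x1 y0 y1 where d: "x0 \<in> part G 0" "x1 \<in> part G 1" "x = x0 + x1" "S x0" "S x1"
          "y0 \<in> part G 0" "y1 \<in> part G 1" "y = y0 + y1" "S y0" "S y1"
        using xy unfolding D_def by blast
      have "\<langle>x0, y0\<rangle> \<in> D" "\<langle>x0, y1\<rangle> \<in> D" "\<langle>x1, y0\<rangle> \<in> D" "\<langle>x1, y1\<rangle> \<in> D"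
        using d by (auto intro: D S_br br_part)
      then show ?thesis
        unfolding d(3) d(8) br_left br_right by (intro D_add)
    qed
  qed (use D S_def X Y H X_part Y_part incl_part in blast)+
  then obtain x0 x1 where "x = x0 + x1" "S x0" "S x1"
    unfolding D_def by blast
  then show ?thesis using S_add w unfolding S_def by blast
qed

end

context chevalley_system
begin

lemma chevalley_representation_adjoint: "chevalley_representation A p G r X Y \<alpha> hc (adjoint G)"
  by (intro chevalley_representation.intro chevalley_system_axioms representation_adjoint)

text \<open>Right-nested brackets. The empty word has the value 0, as there is no empty bracket;
  hence the case distinction in \<open>br_monomial\<close>.\<close>

primrec monomial :: "('i \<Rightarrow> 'g) \<Rightarrow> 'i list \<Rightarrow> 'g" where
  "monomial Z [] = 0"
| "monomial Z (i # l) = (if l = [] then Z i else \<langle>Z i, monomial Z l\<rangle>)"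

lemma br_monomial: "\<langle>Z i, monomial Z l\<rangle> = (if l = [] then 0 else monomial Z (i # l))"
  by (auto simp: br_simps)

lemma monomial_X_root:
  "\<langle>incl G h, monomial X l\<rangle> = scal G (list_weight \<alpha> l h) (monomial X l)"
  by (induction l)
    (auto simp: br_simps X_root br_jacobi_even[OF incl_part] g.scale_left_distrib)

text \<open>Moving Y j to the right past X i leaves an element of the Cartan subalgebra, for which
  the rest of the monomial is an eigenvector.\<close>

lemma br_Y_monomial_X: "\<langle>Y j, monomial X l\<rangle> \<in> g.span (range (incl G) \<union> range (monomial X))"
    (is "_ \<in> g.span ?S")
proof (induction l)
  case Nil
  then show ?case by (simp add: br_simps g.span_zero)
next
  case (Cons i l)
  have incl_S: "incl G h \<in> g.span ?S" for h by (simp add: g.span_base)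
  show ?case
  proof (cases "l = []")
    case True
    then show ?thesis by (simp add: YX g.span_zero incl_S del: incl_scale)
  next
    case False
    have "\<langle>X i, x\<rangle> \<in> g.span ?S" if "x \<in> g.span ?S" for x
      using that
    proof (induction rule: g.span_induct)
      case base
      then show ?case
        by (auto simp: g.subspace_def br_simps g.span_zero g.span_add g.span_scale)
    next
      case (step x)
      then consider h where "x = incl G h" | l where "x = monomial X l" by auto
      then show ?case
      proof cases
        case 1
        have "monomial X [i] \<in> g.span ?S" by (intro g.span_base) blast
        then show ?thesis
          using 1 br_skew_even[OF incl_part, of "X i" h] by (simp add: X_root g.span_neg g.span_scale)
      next
        case 2
        have "monomial X (i # l) \<in> g.span ?S" for l by (intro g.span_base) blast
        then show ?thesis using 2 by (simp add: br_monomial g.span_zero del: monomial.simps)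
      qed
    qed
    then have *: "\<langle>X i, \<langle>Y j, monomial X l\<rangle>\<rangle> \<in> g.span ?S" using Cons.IH .
    have "\<langle>\<langle>Y j, X i\<rangle>, monomial X l\<rangle> \<in> g.span ?S"
    proof -
      have "monomial X l \<in> g.span ?S" by (intro g.span_base) auto
      then show ?thesis
        by (auto simp: YX br_simps monomial_X_root g.span_zero g.span_scale simp del: incl_scale)
    qed
    then show ?thesis
      using False * by (simp add: br_jacobi[OF Y_part X_part] g.span_add g.span_scale)
  qed
qed

lemma monomial_Y_root:
  "\<langle>incl G h, monomial Y l\<rangle> = scal G (- list_weight \<alpha> l h) (monomial Y l)"
proof -
  interpret sw: chevalley_system A p G r Y X "\<lambda>i h. - \<alpha> i h"
    "\<lambda>i. hscal (cartan G) (- koszul_sign (r i) (r i)) (hc i)" by (rule swapped)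
  show ?thesis using sw.monomial_X_root[of h l] by (simp add: list_weight_uminus)
qed

text \<open>The span is stable under all generators acting by the bracket, hence by
  \<open>act_closed\<close> under all of G. In particular it is a subalgebra, and it contains the
  generators.\<close>

lemma triangular_decomposition:
  "g.span (range (incl G) \<union> (range (monomial X) \<union> range (monomial Y))) = UNIV"
    (is "g.span ?S = _")
proof -
  interpret sw: chevalley_system A p G r Y X "\<lambda>i h. - \<alpha> i h"
    "\<lambda>i. hscal (cartan G) (- koszul_sign (r i) (r i)) (hc i)" by (rule swapped)
  interpret ad: chevalley_representation A p G r X Y \<alpha> hc "adjoint G"
    by (rule chevalley_representation_adjoint)
  have mono: "g.span (range (incl G) \<union> range (monomial X)) \<subseteq> g.span ?S"
    "g.span (range (incl G) \<union> range (monomial Y)) \<subseteq> g.span ?S"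
    by (auto intro!: g.span_mono)
  have XS: "monomial X l \<in> g.span ?S" and YS: "monomial Y l \<in> g.span ?S" for l
    by (auto intro: g.span_base)
  have X: "\<langle>X i, x\<rangle> \<in> g.span ?S" if "x \<in> g.span ?S" for i x
    using that
  proof (induction rule: g.span_induct)
    case base
    then show ?case
      by (auto simp: g.subspace_def br_simps g.span_zero g.span_add g.span_scale)
  next
    case (step x)
    then consider h where "x = incl G h" | l where "x = monomial X l" | l where "x = monomial Y l"
      by auto
    then show ?case
    proof cases
      case 1
      then show ?thesis
        using XS[of "[i]"] br_skew_even[OF incl_part, of "X i" h]
        by (simp add: X_root g.span_neg g.span_scale)
    next
      case 2
      then show ?thesis using XS by (simp add: br_monomial g.span_zero del: monomial.simps)
    next
      case 3
      then show ?thesis using sw.br_Y_monomial_X[of i l] mono by auto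
    qed
  qed
  have Y: "\<langle>Y i, x\<rangle> \<in> g.span ?S" if "x \<in> g.span ?S" for i x
    using that
  proof (induction rule: g.span_induct)
    case base
    then show ?case
      by (auto simp: g.subspace_def br_simps g.span_zero g.span_add g.span_scale)
  next
    case (step x)
    then consider h where "x = incl G h" | l where "x = monomial X l" | l where "x = monomial Y l"
      by auto
    then show ?case
    proof cases
      case 1
      then show ?thesis
        using YS[of "[i]"] br_skew_even[OF incl_part, of "Y i" h]
        by (simp add: Y_root g.span_neg g.span_scale)
    next
      case 3
      then show ?thesis using YS by (simp add: br_monomial g.span_zero del: monomial.simps)
    next
      case 2
      then show ?thesis using br_Y_monomial_X[of i l] mono by auto
    qed
  qed
  have H: "\<langle>incl G h, x\<rangle> \<in> g.span ?S" if "x \<in> g.span ?S" for h x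
    using that
  proof (induction rule: g.span_induct)
    case base
    then show ?case
      by (auto simp: g.subspace_def br_simps g.span_zero g.span_add g.span_scale)
  next
    case (step x)
    then show ?case
      using XS YS by (auto simp: g.span_zero monomial_X_root monomial_Y_root g.span_scale g.span_neg)
  qed
  show ?thesis
  proof (rule generate)
    show "\<langle>x, y\<rangle> \<in> g.span ?S" if "y \<in> g.span ?S" for x y
      using ad.act_closed[of "g.span ?S" y x] X Y H that by simp
    show "range X \<subseteq> g.span ?S" "range Y \<subseteq> g.span ?S"
      using XS[of "[_]"] YS[of "[_]"] by auto
    show "range (incl G) \<subseteq> g.span ?S" by (auto intro: g.span_base)
  qed auto
qed

text \<open>Of the spanning weight vectors only those of weight n can contribute; n being nonzero
  rules out the Cartan part.\<close>

lemma root_space_root_comb: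
  assumes x: "x \<in> root_space G (root_comb \<alpha> n)" and n: "n \<noteq> (\<lambda>_. 0)"
  shows "x \<in> g.span ({monomial X l |l. (\<lambda>i. int (count_list l i)) = n} \<union>
    {monomial Y l |l. (\<lambda>i. - int (count_list l i)) = n})"
proof -
  \<comment> \<open>A sum type indexes the three families at once, as
    \<open>weight_vector_span\<close> expects a single family.\<close>
  define f where "f = case_sum (incl G) (case_sum (monomial X) (monomial Y))"
  define \<mu> where "\<mu> = case_sum (\<lambda>_::'h. \<lambda>_. 0) (case_sum (list_weight \<alpha>) (\<lambda>l h. - list_weight \<alpha> l h))"
  have "range f = range (incl G) \<union> (range (monomial X) \<union> range (monomial Y))"
    by (simp add: f_def UNIV_sum image_Un image_image)
  then have "x \<in> g.span (range f)"
    using triangular_decomposition by simp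
  moreover have "\<langle>incl G h, f i\<rangle> = scal G (\<mu> i h) (f i)" for h i
    by (auto simp: f_def \<mu>_def monomial_X_root monomial_Y_root split: sum.splits)
  ultimately have "x \<in> g.span (f ` {i \<in> UNIV. \<mu> i = root_comb \<alpha> n})"
    using x by (intro g.weight_vector_span[OF br_linear_right]) (auto simp: root_space_def)
  moreover have "f ` {i \<in> UNIV. \<mu> i = root_comb \<alpha> n} \<subseteq>
      {monomial X l |l. (\<lambda>i. int (count_list l i)) = n} \<union>
      {monomial Y l |l. (\<lambda>i. - int (count_list l i)) = n}"
  proof clarify
    fix i assume i: "\<mu> i = root_comb \<alpha> n"
      "\<nexists>l. f i = monomial Y l \<and> (\<lambda>i. - int (count_list l i)) = n"
    show "\<exists>l. f i = monomial X l \<and> (\<lambda>i. int (count_list l i)) = n"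
    proof (cases i)
      case (Inl h)
      then have "root_comb \<alpha> n = root_comb \<alpha> (\<lambda>_. 0)" using i by (simp add: \<mu>_def)
      then show ?thesis using n by (simp only: root_comb_inject)
    next
      case (Inr j)
      then show ?thesis
        using i by (cases j) (auto simp: \<mu>_def f_def list_weight_def root_comb_uminus root_comb_inject)
    qed
  qed
  ultimately show ?thesis using g.span_mono by blast
qed

text \<open>A monomial in the X i has nonnegative coordinates, one in the Y i nonpositive ones; with
  mixed signs nothing is left to span x.\<close>

lemma root_sign:
  assumes "x \<in> root_space G (root_comb \<alpha> n)" "x \<noteq> 0"
  shows "(\<forall>i. n i \<ge> 0) \<or> (\<forall>i. n i \<le> 0)"
proof (rule ccontr)
  assume "\<not> ?thesis"
  then obtain i j where ij: "n i < 0" "n j > 0" by (auto simp: not_le)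
  then have "{monomial X l |l. (\<lambda>i. int (count_list l i)) = n} \<union>
    {monomial Y l |l. (\<lambda>i. - int (count_list l i)) = n} = {}"
    by (auto simp: fun_eq_iff intro: exI[of _ i] exI[of _ j])
  moreover have "n \<noteq> (\<lambda>_. 0)" using ij by auto
  ultimately show False
    using root_space_root_comb[OF assms(1)] assms(2) by simp
qed

text \<open>The only word with n letters k and no others is k repeated n times.\<close>

lemma root_space_multiple:
  assumes x: "x \<in> root_space G (\<lambda>h. of_nat n * \<alpha> k h)" and n: "n > 0"
  shows "x \<in> g.span {monomial X (replicate n k)}"
proof -
  have "(\<lambda>h. of_nat n * \<alpha> k h) = root_comb \<alpha> (\<lambda>i. if i = k then int n else 0)"
    by (simp add: root_comb_def fun_eq_iff if_distrib[of of_int] if_distrib[of "\<lambda>x. x * _"] cong: if_cong)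
  moreover have "(\<lambda>i. if i = k then int n else 0) \<noteq> (\<lambda>_. 0)"
    using n by (metis of_nat_0_eq_iff less_irrefl)
  ultimately have x': "x \<in> g.span ({monomial X l |l. (\<lambda>i. int (count_list l i)) = (\<lambda>i. if i = k then int n else 0)} \<union>
    {monomial Y l |l. (\<lambda>i. - int (count_list l i)) = (\<lambda>i. if i = k then int n else 0)})"
    using x by (intro root_space_root_comb) auto
  have "l = replicate n k"
    if "(\<lambda>i. int (count_list l i)) = (\<lambda>i. if i = k then int n else 0)" for l
  proof -
    have c: "count_list l i = (if i = k then n else 0)" for i
      using fun_cong[OF that, of i] by (simp split: if_splits)
    have "i = k" if "i \<in> set l" for i
      using c[of i] that by (metis count_list_0_iff)
    then have l: "l = replicate (length l) k"
      by (simp add: replicate_length_same)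
    have "count_list (replicate m k) k = m" for m by (induction m) auto
    then have "length l = n" using c[of k] l by metis
    then show ?thesis using l by simp
  qed
  moreover have "\<not> (\<lambda>i. - int (count_list l i)) = (\<lambda>i. if i = k then int n else 0)" for l
    using n by (auto simp: fun_eq_iff intro!: exI[of _ k])
  ultimately have "{monomial X l |l. (\<lambda>i. int (count_list l i)) = (\<lambda>i. if i = k then int n else 0)} \<union>
      {monomial Y l |l. (\<lambda>i. - int (count_list l i)) = (\<lambda>i. if i = k then int n else 0)}
      \<subseteq> {monomial X (replicate n k)}"
    by blast
  then show ?thesis using g.span_mono x' by blast
qed

lemma root_space_simple:
  assumes "x \<in> root_space G (\<alpha> k)"
  obtains c where "x = scal G c (X k)"
  using root_space_multiple[of x 1 k] assms by (auto simp: g.span_singleton)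

text \<open>A nested bracket of at least two copies of X k contains the innermost bracket
  \<open>\<langle>X k, X k\<rangle>\<close>.\<close>

lemma root_space_multiple_zero:
  assumes "x \<in> root_space G (\<lambda>h. of_nat n * \<alpha> k h)" and "\<langle>X k, X k\<rangle> = 0" and "n \<ge> 2"
  shows "x = 0"
proof -
  obtain m where n: "n = Suc (Suc m)" using assms(3) by (metis Suc_le_D numeral_2_eq_2 Suc_le_mono)
  have "monomial X (replicate (Suc (Suc m)) k) = 0" for m
    by (induction m) (auto simp: assms(2) br_simps)
  then show ?thesis
    using root_space_multiple[OF assms(1)] by (simp add: n del: monomial.simps replicate.simps)
qed

end

section \<open>Singular vectors\<close>

lemma (in representation) graded_span:
  assumes "\<And>s. s \<in> S \<Longrightarrow> \<exists>d. s \<in> part V d"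
  shows "graded_subspace V (v.span S)"
proof -
  have "\<exists>w0\<in>v.span S \<inter> part V 0. \<exists>w1\<in>v.span S \<inter> part V 1. w = w0 + w1" if "w \<in> v.span S" for w
    using that
  proof (induction rule: v.span_induct_alt)
    case base
    show ?case
      by (intro bexI[of _ 0]) (auto simp: v.span_zero v.subspace_0[OF vpart_subspace])
  next
    case (step c s w)
    then obtain w0 w1 where w: "w0 \<in> v.span S \<inter> part V 0" "w1 \<in> v.span S \<inter> part V 1" "w = w0 + w1"
      by blast
    obtain d where d: "s \<in> part V d" using assms step by blast
    have s: "scal V c s \<in> v.span S" using step by (intro v.span_scale v.span_base)
    have *: "scal V c s \<in> part V d" using d by (intro v.subspace_scale[OF vpart_subspace])
    show ?case
    proof (cases "d = 0")
      case True
      then show ?thesis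
        using w s * by (intro bexI[of _ "scal V c s + w0"] bexI[of _ w1])
          (auto intro: v.span_add v.subspace_add[OF vpart_subspace])
    next
      case False
      then show ?thesis
        using w s * by (intro bexI[of _ w0] bexI[of _ "scal V c s + w1"])
          (auto intro: v.span_add v.subspace_add[OF vpart_subspace])
    qed
  qed
  then show ?thesis by (simp add: graded_subspace_def)
qed

lemma (in representation) weight_space_act:
  assumes v: "v \<in> weight_space G V \<mu>" and x: "x \<in> root_space G \<beta>"
  shows "act V x v \<in> weight_space G V (\<lambda>h. \<mu> h + \<beta> h)"
  using assms
  by (simp add: weight_space_def root_space_def act_br_even[OF incl_part] act_simps
      v.scale_left_distrib add.commute)

context chevalley_representation
begin

definition word_act :: "'i list \<Rightarrow> 'v \<Rightarrow> 'v" where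
  "word_act l u = foldr (\<lambda>i. act V (X i)) l u"

lemma word_act_simps [simp]:
  "word_act [] u = u" "word_act (i # l) u = act V (X i) (word_act l u)"
  by (simp_all add: word_act_def)

lemma word_act_weight:
  assumes "u \<in> weight_space G V \<mu>"
  shows "word_act l u \<in> weight_space G V (\<lambda>h. \<mu> h + list_weight \<alpha> l h)"
proof (induction l)
  case Nil
  then show ?case using assms by simp
next
  case (Cons i l)
  have "X i \<in> root_space G (\<alpha> i)" by (simp add: root_space_def X_root)
  then show ?case using weight_space_act[OF Cons.IH, of "X i" "\<alpha> i"] by (simp add: add_ac)
qed

text \<open>Y i is moved to the right through a word in the X j; each crossing leaves a Cartan
  element, which acts on the remaining word by a scalar, and at the end Y i kills u.\<close>

lemma singular_submodule:
  assumes u: "u \<in> part V d" "u \<in> weight_space G V \<mu>" "\<And>i. act V (Y i) u = 0"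
  shows "submodule V (v.span (range (\<lambda>l. word_act l u)))" (is "submodule V (v.span ?S)")
proof -
  have S: "word_act l u \<in> v.span ?S" for l by (intro v.span_base) blast
  have "\<exists>d. word_act l u \<in> part V d" for l
    using u(1) act_part[OF X_part] by (induction l) auto
  then have "graded_subspace V (v.span ?S)" by (intro graded_span) auto
  moreover have "act V x w \<in> v.span ?S" if w: "w \<in> v.span ?S" for x w
  proof -
    have X: "act V (X i) w \<in> v.span ?S" if "w \<in> v.span ?S" for i w
      using that
    proof (induction rule: v.span_induct)
      case base
      then show ?case
        by (auto simp: v.subspace_def act_simps v.span_zero v.span_add v.span_scale)
    next
      case (step x)
      then show ?case using S[of "i # _"] by auto
    qed
    have H: "act V (incl G h) w \<in> v.span ?S" if "w \<in> v.span ?S" for h w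
      using that
    proof (induction rule: v.span_induct)
      case base
      then show ?case
        by (auto simp: v.subspace_def act_simps v.span_zero v.span_add v.span_scale)
    next
      case (step x)
      then show ?case
        using word_act_weight[OF u(2)] by (auto simp: weight_space_def S v.span_scale)
    qed
    have Y: "act V (Y i) w \<in> v.span ?S" if "w \<in> v.span ?S" for i w
      using that
    proof (induction rule: v.span_induct)
      case base
      then show ?case
        by (auto simp: v.subspace_def act_simps v.span_zero v.span_add v.span_scale)
    next
      case (step x)
      then obtain l where x: "x = word_act l u" by blast
      have "act V (Y i) (word_act l u) \<in> v.span ?S"
      proof (induction l)
        case Nil
        then show ?case by (simp add: u v.span_zero)
      next
        case (Cons j l)
        have "act V \<langle>Y i, X j\<rangle> (word_act l u) \<in> v.span ?S"
          using H[OF S] by (auto simp: YX act_simps v.span_zero simp del: incl_scale)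
        moreover have "act V (X j) (act V (Y i) (word_act l u)) \<in> v.span ?S"
          by (rule X[OF Cons.IH])
        ultimately show ?case
          by (simp add: act_br[OF Y_part X_part] v.span_add v.span_scale)
      qed
      then show ?case by (simp add: x)
    qed
    show ?thesis by (rule act_closed[OF _ X Y H w]) auto
  qed
  ultimately show ?thesis by (simp add: submodule_def)
qed

lemma irreducible_span:
  assumes "irreducible_module V"
    and u: "u \<in> part V d" "u \<in> weight_space G V \<mu>" "\<And>i. act V (Y i) u = 0" "u \<noteq> 0"
  shows "v.span (range (\<lambda>l. word_act l u)) = UNIV"
proof -
  have "word_act [] u \<in> v.span (range (\<lambda>l. word_act l u))" by (intro v.span_base) blast
  then have "v.span (range (\<lambda>l. word_act l u)) \<noteq> {0}" using u(4) by auto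
  then show ?thesis
    using assms(1) singular_submodule[OF u(1-3)] unfolding irreducible_module_def by blast
qed

lemma weight_above:
  assumes "irreducible_module V"
    and u: "u \<in> part V d" "u \<in> weight_space G V \<mu>" "\<And>i. act V (Y i) u = 0" "u \<noteq> 0"
    and v: "v \<in> weight_space G V \<nu>" "v \<noteq> 0"
  obtains l where "\<nu> = (\<lambda>h. \<mu> h + list_weight \<alpha> l h)"
proof -
  have "v \<in> v.span ((\<lambda>l. word_act l u) ` {l \<in> UNIV. (\<lambda>h. \<mu> h + list_weight \<alpha> l h) = \<nu>})"
  proof (rule v.weight_vector_span)
    show "Vector_Spaces.linear (scal V) (scal V) (act V (incl G h))" for h
      by (rule act_linear_right)
    show "v \<in> v.span (range (\<lambda>l. word_act l u))"
      using irreducible_span[OF assms(1-5)] by simp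
    show "act V (incl G h) (word_act l u) = scal V (\<mu> h + list_weight \<alpha> l h) (word_act l u)" for h l
      using word_act_weight[OF u(2)] by (simp add: weight_space_def)
    show "act V (incl G h) v = scal V (\<nu> h) v" for h
      using v(1) by (simp add: weight_space_def)
  qed
  then have "{l. (\<lambda>h. \<mu> h + list_weight \<alpha> l h) = \<nu>} \<noteq> {}" using v(2) by (intro notI) simp
  then show ?thesis using that by blast
qed

text \<open>If u were nonzero it would generate V, and every weight of V would lie above that of u;
  but the weight \<mu> of v lies strictly below.\<close>

lemma singular_vector_zero:
  assumes "irreducible_module V" and v: "v \<in> weight_space G V \<mu>" "v \<noteq> 0"
    and u: "u \<in> part V d" "u \<in> weight_space G V (\<lambda>h. \<mu> h + list_weight \<alpha> l h)"
      "\<And>i. act V (Y i) u = 0" and l: "l \<noteq> []"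
  shows "u = 0"
proof (rule ccontr)
  assume "u \<noteq> 0"
  then obtain l' where "\<mu> = (\<lambda>h. \<mu> h + list_weight \<alpha> l h + list_weight \<alpha> l' h)"
    using weight_above[OF assms(1) u _ v] by metis
  then have "list_weight \<alpha> (l @ l') h = 0" for h
    by (simp add: fun_eq_iff add.assoc)
  then have "l @ l' = []" using list_weight_eq_0 by blast
  then show False using l by simp
qed

end

text \<open>The analogue of \<open>singular_vector_zero\<close> inside G, where irreducibility is
  replaced by \<open>graded_ideal_zero\<close>: the ideal generated by u has only nonzero weights,
  so it avoids the Cartan subalgebra.\<close>

lemma (in chevalley_system) singular_root_vector_zero:
  assumes u: "u \<in> part G d" "u \<in> root_space G (list_weight \<alpha> l)" "\<And>i. \<langle>Y i, u\<rangle> = 0" and l: "l \<noteq> []"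
  shows "u = 0"
proof -
  interpret ad: chevalley_representation A p G r X Y \<alpha> hc "adjoint G"
    by (rule chevalley_representation_adjoint)
  have w: "u \<in> weight_space G (adjoint G) (list_weight \<alpha> l)"
    using u(2) by (simp add: weight_space_def root_space_def)
  let ?W = "g.span (range (\<lambda>l. ad.word_act l u))"
  have "submodule (adjoint G) ?W"
    using ad.singular_submodule[OF _ w] u by simp
  then have W: "graded_subspace G ?W" "\<And>x y. y \<in> ?W \<Longrightarrow> \<langle>x, y\<rangle> \<in> ?W"
    by (auto simp: submodule_def graded_subspace_def)
  moreover have "h = 0" if h: "incl G h \<in> ?W" for h
  proof -
    have "incl G h = 0"
    proof (rule g.weight_vector_zero[OF br_linear_right h, where lam = "\<lambda>_. 0"])
      fix s assume "s \<in> range (\<lambda>l. ad.word_act l u)"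
      then obtain l' where s: "s = ad.word_act l' u" by blast
      have "list_weight \<alpha> (l @ l') \<noteq> (\<lambda>_. 0)" using l by (subst list_weight_eq_0) simp
      then show "\<exists>\<mu>. \<mu> \<noteq> (\<lambda>_. 0) \<and> (\<forall>h. \<langle>incl G h, s\<rangle> = scal G (\<mu> h) s)"
        using ad.word_act_weight[OF w, of l'] s
        by (intro exI[of _ "list_weight \<alpha> (l @ l')"]) (simp add: weight_space_def)
    qed simp
    then show ?thesis by simp
  qed
  ultimately have "?W \<subseteq> {0}" by (intro graded_ideal_zero)
  moreover have "ad.word_act [] u \<in> ?W" by (intro g.span_base) blast
  ultimately show ?thesis by auto
qed

section \<open>The superalgebras of type Q\<close>

lemma index_simps [simp]:
  fixes i :: 3
  shows "3 + i = i" "2 + i = i + 2" "4 + i = i + 1" "i + 1 + 1 = i + 2" "i + 1 + 2 = i"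
    "i + 3 = i" "i + 2 + 1 = i" "i + 2 + 2 = i + 1"
  by (simp_all add: add.commute)

lemma index_cases: "k = i \<or> k = i + 1 \<or> k = i + (2::3)"
  using exhaust_3[of i] exhaust_3[of k] by auto

lemma sum_index: "(\<Sum>k\<in>UNIV. f k) = f i + f (i + 1) + f (i + (2::3))"
proof -
  have "UNIV = {i, i + 1, i + 2}" using index_cases by auto
  then have "(\<Sum>k\<in>UNIV. f k) = (\<Sum>k\<in>{i, i + 1, i + 2}. f k)" by simp
  also have "\<dots> = f i + f (i + 1) + f (i + 2)" by (simp add: add.assoc)
  finally show ?thesis .
qed

lemma all_index: "(\<forall>k::3. P k) \<longleftrightarrow> P i \<and> P (i + 1) \<and> P (i + 2)"
  using index_cases by metis

context chevalley_system
begin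

lemma X_nonzero: "X i \<noteq> 0" and Y_nonzero: "Y i \<noteq> 0"
  using XY[of i i] hc_nonzero[of i] by (auto simp: br_simps)

text \<open>Linearity of \<alpha> i is not part of the locale; it follows from that of the bracket
  because X i is nonzero.\<close>

lemma \<alpha>_add: "\<alpha> i (h + h') = \<alpha> i h + \<alpha> i h'" and \<alpha>_scale: "\<alpha> i (hscal (cartan G) c h) = c * \<alpha> i h"
proof -
  have "scal G (\<alpha> i (h + h')) (X i) = scal G (\<alpha> i h + \<alpha> i h') (X i)"
    using X_root[of "h + h'" i] by (simp add: incl_add br_simps X_root g.scale_left_distrib)
  then show "\<alpha> i (h + h') = \<alpha> i h + \<alpha> i h'" using X_nonzero by simp
  have "scal G (\<alpha> i (hscal (cartan G) c h)) (X i) = scal G (c * \<alpha> i h) (X i)"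
    using X_root[of "hscal (cartan G) c h" i] unfolding incl_scale br_left X_root by auto
  then show "\<alpha> i (hscal (cartan G) c h) = c * \<alpha> i h" using X_nonzero by auto
qed

lemma \<alpha>_uminus: "\<alpha> i (- h) = - \<alpha> i h"
  using \<alpha>_scale[of i "-1" h] by simp

lemma br_X_incl: "\<langle>X i, incl G h\<rangle> = scal G (- \<alpha> i h) (X i)"
  and br_Y_incl: "\<langle>Y i, incl G h\<rangle> = scal G (\<alpha> i h) (Y i)"
  using br_skew_even[OF incl_part, of "X i" h] br_skew_even[OF incl_part, of "Y i" h]
  by (simp_all add: X_root Y_root)

end

text \<open>The type \<open>3\<close> is the ring of integers modulo \<open>3\<close>, so the Cartan matrix is described cyclically:
  row \<open>i\<close> has the entries \<open>0\<close>, \<open>1\<close>, \<open>q i\<close> in the columns \<open>i\<close>, \<open>i + 1\<close>, \<open>i + 2\<close>.\<close>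

locale Q_system = chevalley_system A p G "\<lambda>_. 1" X Y \<alpha> hc
  for A :: "complex^3^3" and p :: "3 \<Rightarrow> bit"
    and G :: "('h::ab_group_add, 3, 'g::ab_group_add) contragredient"
    and X Y \<alpha> hc +
  fixes q :: "3 \<Rightarrow> real" and M :: "3 \<Rightarrow> int"
  assumes \<alpha>_self: "\<alpha> i (hc i) = 0" and \<alpha>_next: "\<alpha> (i + 1) (hc i) = 1"
    and \<alpha>_prev: "\<alpha> (i + 2) (hc i) = of_real (q i)"
    and q_neg: "q i < 0" and M_def: "of_int (M i) = 1 + q i + 1 / q (i + 1)" and M_neg: "M i \<le> - 1"
begin

lemma q_nonzero [simp]: "q i \<noteq> 0"
  using q_neg[of i] by simp

lemma M_complex: "complex_of_int (M i) = 1 + of_real (q i) + 1 / of_real (q (i + 1))"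
proof -
  have "complex_of_int (M i) = of_real (of_int (M i))" by simp
  also have "\<dots> = 1 + of_real (q i) + 1 / of_real (q (i + 1))" unfolding M_def by simp
  finally show ?thesis .
qed

lemma \<alpha>_hc: "\<alpha> i (hc (i + 1)) = of_real (q (i + 1))" "\<alpha> i (hc (i + 2)) = 1"
  using \<alpha>_prev[of "i + 1"] \<alpha>_next[of "i + 2"] by simp_all

lemma br_YX [simp]: "\<langle>Y j, X i\<rangle> = (if i = j then incl G (hc i) else 0)"
  by (simp add: YX koszul_sign_def)

lemma br_XX_commute: "\<langle>X i, X j\<rangle> = \<langle>X j, X i\<rangle>" and br_YY_commute: "\<langle>Y i, Y j\<rangle> = \<langle>Y j, Y i\<rangle>"
  using br_skew_odd X_part Y_part by metis+

text \<open>With the sign in front of \<open>X\<close> the Cartan matrix does not change.\<close>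

lemma chevalley_swapped: "Q_system A p G Y (\<lambda>i. - X i) (\<lambda>i h. - \<alpha> i h) (\<lambda>i. - hc i) q M"
proof unfold_locales
  show "- X i \<in> part G 1" for i using X_part g.subspace_neg[OF part_subspace] by blast
  fix u :: "3 \<Rightarrow> complex" and i
  assume "\<And>h. (\<Sum>i\<in>UNIV. u i * - \<alpha> i h) = 0"
  then show "u i = 0" by (intro \<alpha>_independent[of u]) (simp add: sum_negf)
next
  fix S assume S: "g.subspace S" "\<And>x y. x \<in> S \<Longrightarrow> y \<in> S \<Longrightarrow> \<langle>x, y\<rangle> \<in> S"
      "range Y \<subseteq> S" "range (\<lambda>i. - X i) \<subseteq> S" "range (incl G) \<subseteq> S"
  have "X i \<in> S" for i using S(4) g.subspace_neg[OF S(1), of "- X i"] by auto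
  then have "range X \<subseteq> S" by auto
  then show "S = UNIV" using S by (intro generate) auto
qed (auto simp: Y_part X_root Y_root br_simps incl.neg hc_nonzero \<alpha>_uminus \<alpha>_self \<alpha>_next \<alpha>_prev
    q_neg M_def M_neg)

text \<open>The vector is killed by every Y j: the only possible contribution, from j = i, is a
  multiple of \<open>\<alpha> i (hc i) = 0\<close>.\<close>

lemma br_XX [simp]: "\<langle>X i, X i\<rangle> = 0"
proof (rule singular_root_vector_zero)
  show "\<langle>X i, X i\<rangle> \<in> part G (1 + 1)" by (intro br_part X_part)
  show "\<langle>X i, X i\<rangle> \<in> root_space G (list_weight \<alpha> [i, i])"
    by (simp add: root_space_def br_jacobi_even[OF incl_part] X_root br_simps
        flip: g.scale_left_distrib)
  show "\<langle>Y j, \<langle>X i, X i\<rangle>\<rangle> = 0" for j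
    by (simp add: br_jacobi_odd[OF Y_part X_part] br_simps X_root br_X_incl \<alpha>_self)
qed simp

lemma br_YY [simp]: "\<langle>Y i, Y i\<rangle> = 0"
proof -
  interpret sw: Q_system A p G Y "\<lambda>i. - X i" "\<lambda>i h. - \<alpha> i h" "\<lambda>i. - hc i" q M
    by (rule chevalley_swapped)
  show ?thesis by (rule sw.br_XX)
qed

section \<open>The sl_2-triples of the even roots\<close>

definition E :: "3 \<Rightarrow> 'g" where "E i = \<langle>X i, X (i + 1)\<rangle>"
text \<open>The bracket of E i with \<open>\<langle>Y i, Y (i + 1)\<rangle>\<close> is
  -\<open>q (i + 1)\<close> times H i; the scalar cancels this factor, and H i is normalized by
  \<open>\<beta> i (H i) = 2\<close>.\<close>

definition F :: "3 \<Rightarrow> 'g" where "F i = scal G (- 1 / of_real (q (i + 1))) \<langle>Y i, Y (i + 1)\<rangle>"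
definition H :: "3 \<Rightarrow> 'h" where
  "H i = hc i + hscal (cartan G) (1 / of_real (q (i + 1))) (hc (i + 1))"
definition \<beta> :: "3 \<Rightarrow> 'h \<Rightarrow> complex" where "\<beta> i h = \<alpha> i h + \<alpha> (i + 1) h"

lemma \<alpha>_H: "\<alpha> i (H i) = 1" "\<alpha> (i + 1) (H i) = 1" "\<alpha> (i + 2) (H i) = of_int (M i) - 1"
  using \<alpha>_prev[of "i + 1"] \<alpha>_next[of "i + 1"]
  by (simp_all add: H_def \<alpha>_add \<alpha>_scale \<alpha>_self \<alpha>_next \<alpha>_prev M_complex)

text \<open>This is the Cartan matrix of the even roots. Its off-diagonal entries are the integers
  m, n, t, the same one twice in each row.\<close>

lemma \<beta>_H: "\<beta> i (H i) = 2" "\<beta> (i + 1) (H i) = of_int (M i)" "\<beta> (i + 2) (H i) = of_int (M i)"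
  using \<alpha>_H[of i] by (simp_all add: \<beta>_def)

lemma E_part: "E i \<in> part G 0" and F_part: "F i \<in> part G 0"
  using br_part[OF X_part X_part, of i "i + 1"] br_part[OF Y_part Y_part, of i "i + 1"]
  by (simp_all add: E_def F_def g.subspace_neg[OF part_subspace] g.subspace_scale[OF part_subspace])

lemma E_root: "\<langle>incl G h, E i\<rangle> = scal G (\<beta> i h) (E i)"
  and F_root: "\<langle>incl G h, F i\<rangle> = scal G (- \<beta> i h) (F i)"
  by (simp_all add: E_def F_def \<beta>_def br_jacobi_even[OF incl_part] X_root Y_root br_simps
      add_divide_distrib diff_divide_distrib g.scale_left_distrib g.scale_left_diff_distrib
      g.scale_right_distrib g.scale_right_diff_distrib mult.commute)

lemma E_incl: "\<langle>E i, incl G h\<rangle> = scal G (- \<beta> i h) (E i)"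
  and F_incl: "\<langle>F i, incl G h\<rangle> = scal G (\<beta> i h) (F i)"
  using br_skew_even[OF incl_part, of "E i" h] br_skew_even[OF incl_part, of "F i" h]
  by (simp_all add: E_root F_root)

lemma eq_uminus_zero: "y = 0" if "y = - y" for y :: 'g
proof -
  have "scal G 2 y = y + y" by (metis g.scale_left_distrib g.scale_one one_add_one)
  also have "\<dots> = 0" using that by (metis add.right_inverse)
  finally show ?thesis by simp
qed

lemma br_E_E [simp]: "\<langle>E i, E i\<rangle> = 0" and br_F_F [simp]: "\<langle>F i, F i\<rangle> = 0"
  using br_skew_even[OF E_part, of "E i" i] br_skew_even[OF F_part, of "F i" i]
  by (auto dest: eq_uminus_zero)

lemma br_X_X_zero: "\<langle>X i, \<langle>X i, x\<rangle>\<rangle> = 0" and br_Y_Y_zero: "\<langle>Y i, \<langle>Y i, x\<rangle>\<rangle> = 0"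
proof -
  show "\<langle>X i, \<langle>X i, x\<rangle>\<rangle> = 0"
    by (rule eq_uminus_zero) (use br_jacobi_odd[OF X_part X_part, of i i x] in \<open>simp add: br_simps\<close>)
  show "\<langle>Y i, \<langle>Y i, x\<rangle>\<rangle> = 0"
    by (rule eq_uminus_zero) (use br_jacobi_odd[OF Y_part Y_part, of i i x] in \<open>simp add: br_simps\<close>)
qed

lemma br_X_E: "\<langle>X i, E i\<rangle> = 0" "\<langle>X (i + 1), E i\<rangle> = 0"
  using br_X_X_zero[of "i + 1" "X i"] by (simp_all add: E_def br_X_X_zero br_XX_commute)

lemma br_Y_F: "\<langle>Y i, F i\<rangle> = 0" "\<langle>Y (i + 1), F i\<rangle> = 0"
  using br_Y_Y_zero[of "i + 1" "Y i"]
  by (simp_all add: F_def br_Y_Y_zero br_YY_commute[of "i + 1" i] br_simps)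

lemma br_Y_E: "\<langle>Y i, E i\<rangle> = X (i + 1)" "\<langle>Y (i + 1), E i\<rangle> = scal G (of_real (q (i + 1))) (X i)"
    "\<langle>Y (i + 2), E i\<rangle> = 0"
  by (simp_all add: E_def br_jacobi_odd[OF Y_part X_part] br_simps X_root br_X_incl \<alpha>_next \<alpha>_hc)

lemma br_E_Y: "\<langle>E i, Y i\<rangle> = - X (i + 1)" "\<langle>E i, Y (i + 1)\<rangle> = scal G (- of_real (q (i + 1))) (X i)"
    "\<langle>E i, Y (i + 2)\<rangle> = 0"
  using br_skew_even[OF E_part, of "Y i" i] br_skew_even[OF E_part, of "Y (i + 1)" i]
    br_skew_even[OF E_part, of "Y (i + 2)" i] br_Y_E[of i]
  by (simp_all add: minus_equation_iff eq_commute[of "- _"])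

lemma br_E_F: "\<langle>E i, F i\<rangle> = incl G (H i)"
  by (simp add: F_def H_def br_simps br_jacobi_even[OF E_part] br_E_Y XY incl_add incl_scale
      g.scale_right_distrib g.scale_right_diff_distrib)

lemma E_nonzero: "E i \<noteq> 0" and F_nonzero: "F i \<noteq> 0" and H_nonzero: "H i \<noteq> 0"
proof -
  show "H i \<noteq> 0"
  proof
    assume "H i = 0"
    then show False using \<beta>_H(1)[of i] \<alpha>_scale[of i 0 0] \<alpha>_scale[of "i + 1" 0 0] by (simp add: \<beta>_def)
  qed
  then show "E i \<noteq> 0" "F i \<noteq> 0" using br_E_F[of i] by (auto simp: br_simps)
qed

text \<open>The weight \<beta> i - \<beta> j is a difference of two distinct simple roots, hence has
  mixed signs and is not a root.\<close>

lemma br_E_F_other: "i \<noteq> j \<Longrightarrow> \<langle>E i, F j\<rangle> = 0"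
proof (rule ccontr)
  assume ij: "i \<noteq> j" and nz: "\<langle>E i, F j\<rangle> \<noteq> 0"
  have "\<langle>E i, F j\<rangle> \<in> root_space G (\<lambda>h. \<beta> i h - \<beta> j h)"
    by (simp add: root_space_def br_jacobi_even[OF incl_part] E_root F_root br_simps
        g.scale_left_diff_distrib)
  moreover define n :: "3 \<Rightarrow> int" where
    "n k = (if k = i then 1 else 0) + (if k = i + 1 then 1 else 0)
        - (if k = j then 1 else 0) - (if k = j + 1 then 1 else 0)" for k
  have "(\<lambda>h. \<beta> i h - \<beta> j h) = root_comb \<alpha> n"
    by (rule ext) (use index_cases[of j i] in \<open>auto simp: root_comb_def n_def \<beta>_def sum_index[of _ i]\<close>)
  ultimately have "(\<forall>i. n i \<ge> 0) \<or> (\<forall>i. n i \<le> 0)"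
    using root_sign nz by metis
  then show False
    using index_cases[of j i] ij by (auto simp: n_def all_index[of _ i])
qed

text \<open>The Chevalley generators of the base obtained by the odd reflection at \<open>\<alpha> k\<close>. Its simple roots
  are \<open>- \<alpha> k\<close> and the even roots \<open>\<beta> k\<close>, \<open>\<beta> (k + 2)\<close>.\<close>

definition RX where "RX k j = (if j = k then Y k else if j = k + 1 then E k else E (k + 2))"
definition RY where "RY k j = (if j = k then X k else if j = k + 1 then F k else F (k + 2))"
definition R\<alpha> where
  "R\<alpha> k j h = (if j = k then - \<alpha> k h else if j = k + 1 then \<beta> k h else \<beta> (k + 2) h)"
definition Rh where "Rh k j = (if j = k then hc k else if j = k + 1 then H k else H (k + 2))"

text \<open>Linear independence and generation are the points to check, both because the change of
  generators can be undone.\<close>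

lemma reflected: "chevalley_system A p G (\<lambda>j. if j = k then 1 else 0) (RX k) (RY k) (R\<alpha> k) (Rh k)"
proof unfold_locales
  show "RX k i \<in> part G (if i = k then 1 else 0)" "RY k i \<in> part G (if i = k then 1 else 0)" for i
    using X_part Y_part E_part F_part by (auto simp: RX_def RY_def)
  show "\<langle>incl G h, RX k i\<rangle> = scal G (R\<alpha> k i h) (RX k i)"
    "\<langle>incl G h, RY k i\<rangle> = scal G (- R\<alpha> k i h) (RY k i)" for h i
    by (auto simp: RX_def RY_def R\<alpha>_def X_root Y_root E_root F_root)
  show "\<langle>RX k i, RY k j\<rangle> = (if i = j then incl G (Rh k i) else 0)" for i j
  proof -
    have 1: "\<langle>E k, X k\<rangle> = 0" "\<langle>E (k + 2), X k\<rangle> = 0"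
      using br_skew_even[OF E_part, of "X k" k] br_skew_even[OF E_part, of "X k" "k + 2"]
        br_X_E[of k] br_X_E[of "k + 2"] by (simp_all add: neg_equal_0_iff_equal)
    have 2: "\<langle>Y k, F k\<rangle> = 0" "\<langle>Y k, F (k + 2)\<rangle> = 0"
      using br_Y_F[of k] br_Y_F[of "k + 2"] by simp_all
    show ?thesis
      using index_cases[of i k] index_cases[of j k]
      by (auto simp: RX_def RY_def Rh_def 1 2 br_E_F br_E_F_other)
  qed
  show "Rh k i \<noteq> 0" for i by (simp add: Rh_def hc_nonzero H_nonzero)
  show "u i = 0" if u: "\<And>h. (\<Sum>i\<in>UNIV. u i * R\<alpha> k i h) = 0" for u i
  proof -
    \<comment> \<open>The coefficients of the given combination when it is rewritten in the basis
      \<alpha>.\<close>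
    define u' where "u' j = (if j = k then u (k + 1) + u (k + 2) - u k
        else if j = k + 1 then u (k + 1) else u (k + 2))" for j
    have "(\<Sum>i\<in>UNIV. u' i * \<alpha> i h) = 0" for h
      using u[of h] by (simp add: sum_index[of _ k] R\<alpha>_def \<beta>_def u'_def algebra_simps)
    then have u': "u' j = 0" for j by (rule \<alpha>_independent)
    have "u (k + 1) = 0" "u (k + 2) = 0" using u'[of "k + 1"] u'[of "k + 2"] by (simp_all add: u'_def)
    moreover have "u k = 0" using u'[of k] calculation by (simp add: u'_def)
    ultimately show ?thesis using index_cases[of i k] by auto
  qed
  show "S = UNIV" if S: "g.subspace S" "\<And>x y. x \<in> S \<Longrightarrow> y \<in> S \<Longrightarrow> \<langle>x, y\<rangle> \<in> S"
    "range (RX k) \<subseteq> S" "range (RY k) \<subseteq> S" "range (incl G) \<subseteq> S" for S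
  proof -
    have RXS: "RX k j \<in> S" and RYS: "RY k j \<in> S" for j using S by auto
    \<comment> \<open>The missing generators with indices k + 1 and k + 2 are recovered up to
      nonzero scalars as brackets of Y k with E k, E (k + 2) and of X k with F k, F (k + 2).\<close>
    have "\<langle>RX k k, RX k (k + 1)\<rangle> \<in> S" "\<langle>RX k k, RX k (k + 2)\<rangle> \<in> S"
      "\<langle>RY k k, RY k (k + 1)\<rangle> \<in> S" "\<langle>RY k k, RY k (k + 2)\<rangle> \<in> S"
      by (intro S(2) RXS RYS)+
    then have *: "\<langle>Y k, E k\<rangle> \<in> S" "\<langle>Y k, E (k + 2)\<rangle> \<in> S" "\<langle>X k, F k\<rangle> \<in> S" "\<langle>X k, F (k + 2)\<rangle> \<in> S"
      by (simp_all add: RX_def RY_def)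
    have "scal G (of_real (q k)) (X (k + 2)) \<in> S" "X (k + 1) \<in> S"
      using *(1,2) br_Y_E[of k] br_Y_E[of "k + 2"] by simp_all
    then have XS: "X (k + 1) \<in> S" "X (k + 2) \<in> S"
      using g.subspace_scale[OF S(1), of "scal G (of_real (q k)) (X (k + 2))" "1 / of_real (q k)"] by simp_all
    have **: "\<langle>X k, F k\<rangle> = scal G (1 / of_real (q (k + 1))) (Y (k + 1))"
        "\<langle>X k, F (k + 2)\<rangle> = Y (k + 2)"
      by (simp_all add: F_def br_simps br_jacobi_odd[OF X_part Y_part] XY Y_root br_Y_incl
          \<alpha>_next \<alpha>_prev)
    have YS: "Y (k + 1) \<in> S" "Y (k + 2) \<in> S"
      using *(3,4) g.subspace_scale[OF S(1), of "\<langle>X k, F k\<rangle>" "of_real (q (k + 1))"] by (simp_all add: **)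
    have "X k \<in> S" "Y k \<in> S" using RXS[of k] RYS[of k] by (simp_all add: RX_def RY_def)
    then have "range X \<subseteq> S" "range Y \<subseteq> S"
      using XS YS index_cases[of _ k] by (metis image_subsetI)+
    then show ?thesis using S by (intro generate) auto
  qed
qed

end

section \<open>Reflections\<close>

context contragredient_superalgebra
begin

definition gexp :: "'g \<Rightarrow> 'g \<Rightarrow> 'g" where
  "gexp x = lexp (scal G) (brk G x)"

end

context representation
begin

definition vexp :: "'g \<Rightarrow> 'v \<Rightarrow> 'v" where
  "vexp x = lexp (scal V) (act V x)"

lemma linear_operator_act: "linear_operator (scal V) (act V x)"
  by (intro linear_operator.intro act_linear_right)

lemma linear_operator_br: "linear_operator (scal G) (brk G x)"
  by (intro linear_operator.intro br_linear_right)

lemma paired_derivation_act: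
  assumes "x \<in> part G 0"
  shows "paired_derivation (scal G) (brk G x) (scal V) (act V x) (scal V) (act V x) (act V)"
proof -
  interpret l1: linear_operator "scal G" "brk G x" by (rule linear_operator_br)
  interpret l2: linear_operator "scal V" "act V x" by (rule linear_operator_act)
  show ?thesis
    by unfold_locales (auto simp: act_simps act_br_even[OF assms])
qed

lemma nilpotent_operator_act:
  "locally_nilpotent (act V x) \<Longrightarrow> nilpotent_operator (scal V) (act V x)"
  by (intro nilpotent_operator.intro nilpotent_operator_axioms.intro linear_operator_act)

text \<open>The case of \<open>exp_pair\<close> in which the pairing is the action: exp(x) on V
  covers exp(ad x) on G.\<close>

lemma vexp_act:
  assumes "x \<in> part G 0" "locally_nilpotent (brk G x)" "locally_nilpotent (act V x)"
  shows "vexp x (act V y v) = act V (gexp x y) (vexp x v)"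
  unfolding vexp_def gexp_def
  by (rule paired_derivation.exp_pair[OF paired_derivation_act]) fact+

lemma vexp_bij:
  assumes "locally_nilpotent (act V x)"
  shows "bij (vexp x)"
proof -
  interpret nilpotent_operator "scal V" "act V x" by (rule nilpotent_operator_act) fact
  have "lexp (scal V) (\<lambda>v. - act V x v) (vexp x v) = v" "vexp x (lexp (scal V) (\<lambda>v. - act V x v) v) = v" for v
    unfolding vexp_def by (rule exp_uminus_exp exp_exp_uminus)+
  then show ?thesis by (metis bijI')
qed

lemma vexp_linear:
  assumes "locally_nilpotent (act V x)"
  shows "Vector_Spaces.linear (scal V) (scal V) (vexp x)"
proof -
  interpret nilpotent_operator "scal V" "act V x" by (rule nilpotent_operator_act) fact
  show ?thesis unfolding vexp_def by (rule exp_linear)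
qed

lemma power_act_scale: "(act V (scal G c x) ^^ n) v = scal V (c ^ n) ((act V x ^^ n) v)"
  by (induction n) (auto simp: act_simps)

lemma locally_nilpotent_scale:
  "locally_nilpotent (act V x) \<Longrightarrow> locally_nilpotent (act V (scal G c x))"
  unfolding locally_nilpotent_def power_act_scale by (metis v.scale_zero_right)

end

context Q_system
begin

lemma power_br_E_root:
  "\<langle>incl G h, (brk G (E i) ^^ n) (E (i + 2))\<rangle> =
    scal G (of_nat n * \<beta> i h + \<beta> (i + 2) h) ((brk G (E i) ^^ n) (E (i + 2)))"
  by (induction n)
    (auto simp: E_root br_jacobi_even[OF incl_part] br_simps algebra_simps)

lemma br_E_X: "\<langle>E i, X i\<rangle> = 0" "\<langle>E i, X (i + 1)\<rangle> = 0"
  using br_skew_even[OF E_part, of "X i" i] br_skew_even[OF E_part, of "X (i + 1)" i] br_X_E[of i]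
  by simp_all

lemma br_F_E: "\<langle>F i, E j\<rangle> = (if i = j then - incl G (H i) else 0)"
  using br_skew_even[OF F_part, of "E j" i] br_E_F[of i] br_E_F_other[of j i]
  by (auto simp: minus_equation_iff)

text \<open>The vector is shown to be singular for the base reflected at i, where \<beta> i and
  \<beta> (i + 2) are simple. X i commutes with all factors; F (i + 2) gives ad(E i)^N of a Cartan
  element, which is 0 since N \<ge> 2, that is, \<open>M i \<le> - 1\<close>; for F i the exponent
  is chosen to annihilate the sl_2 coefficient.\<close>

lemma serre: "(brk G (E i) ^^ nat (1 - M i)) (E (i + 2)) = 0"
proof -
  interpret R: chevalley_system A p G "\<lambda>j. if j = i then 1 else 0" "RX i" "RY i" "R\<alpha> i" "Rh i"
    by (rule reflected)
  define N where "N = nat (1 - M i)"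
  let ?u = "\<lambda>n. (brk G (E i) ^^ n) (E (i + 2))"
  have N: "N \<ge> 2" "of_int (M i) = (1 :: complex) - of_nat N" using M_neg[of i] by (simp_all add: N_def)
  have Xu: "\<langle>X i, ?u n\<rangle> = 0" for n
  proof (induction n)
    case 0
    then show ?case using br_X_E(2)[of "i + 2"] by simp
  next
    case (Suc n)
    then show ?case
      using br_jacobi_even[OF E_part, of i "X i" "?u n"] by (simp add: br_E_X br_simps)
  qed
  have Fu': "\<langle>F (i + 2), ?u n\<rangle> = (brk G (E i) ^^ n) (- incl G (H (i + 2)))" for n
    by (induction n) (simp_all add: br_jacobi_even[OF F_part] br_F_E br_simps)
  have "(brk G (E i) ^^ Suc (Suc n)) (- incl G h) = 0" for n h
  proof -
    interpret linear_operator "scal G" "brk G (E i)" by unfold_locales (auto simp: br_simps)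
    have "(brk G (E i) ^^ 2) (- incl G h) = 0" by (simp add: numeral_2_eq_2 br_simps E_incl)
    then show ?thesis by (rule power_eq_0_mono) simp
  qed
  then have Fu'0: "\<langle>F (i + 2), ?u N\<rangle> = 0"
    using N(1) unfolding Fu' by (metis Suc_le_D numeral_2_eq_2 Suc_le_mono)
  have Fu: "\<langle>F i, ?u N\<rangle> = 0"
  proof -
    \<comment> \<open>The roles of the sl_2-triple are exchanged: F i raises, E i lowers, - H i is
      the semisimple element, and E (i + 2) has eigenvalue - \<open>M i\<close>.\<close>
    have "\<langle>F i, ?u N\<rangle> =
        scal G (of_nat N * (- of_int (M i) - of_nat N + 1)) ((brk G (E i) ^^ (N - 1)) (E (i + 2)))"
    proof (rule sl2_power[where T = "\<lambda>x. - \<langle>incl G (H i), x\<rangle>"])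
      show "vector_space (scal G)" by (rule g.vector_space_axioms)
      show "\<langle>F i, \<langle>E i, x\<rangle>\<rangle> = \<langle>E i, \<langle>F i, x\<rangle>\<rangle> + - \<langle>incl G (H i), x\<rangle>" for x
        by (simp add: br_jacobi_even[OF F_part] br_F_E br_simps)
      show "- \<langle>incl G (H i), \<langle>E i, x\<rangle>\<rangle> = \<langle>E i, - \<langle>incl G (H i), x\<rangle>\<rangle> - scal G 2 \<langle>E i, x\<rangle>" for x
        by (simp add: br_jacobi_even[OF incl_part] E_root br_simps \<beta>_H)
    qed (auto simp: br_linear_right br_F_E E_root \<beta>_H)
    also have "- of_int (M i) - of_nat N + 1 = (0 :: complex)" using N(2) by simp
    finally show ?thesis by simp
  qed
  have "?u N = 0"
  proof (rule R.singular_root_vector_zero)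
    show "?u N \<in> part G 0"
    proof (induction N)
      case (Suc n)
      then show ?case using br_part[OF E_part Suc.IH, of i] by simp
    qed (simp add: E_part)
    show "?u N \<in> root_space G (list_weight (R\<alpha> i) (replicate N (i + 1) @ [i + 2]))"
      by (simp add: root_space_def power_br_E_root R\<alpha>_def)
    show "\<langle>RY i j, ?u N\<rangle> = 0" for j
      using index_cases[of j i] by (auto simp: RY_def Xu Fu Fu'0)
  qed simp
  then show ?thesis by (simp add: N_def)
qed

text \<open>By the Leibniz rule the vectors killed by some power of ad(E i) form a subalgebra, so
  generators suffice. In the base reflected at i the only one that needs a Serre relation is E (i +
  2).\<close>

lemma ad_E_nilpotent: "locally_nilpotent (brk G (E i))"
proof -
  interpret R: chevalley_system A p G "\<lambda>j. if j = i then 1 else 0" "RX i" "RY i" "R\<alpha> i" "Rh i"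
    by (rule reflected)
  interpret ad: representation A p G "adjoint G" by (rule representation_adjoint)
  interpret paired_derivation "scal G" "brk G (E i)" "scal G" "brk G (E i)" "scal G" "brk G (E i)" "brk G"
    using ad.paired_derivation_act[OF E_part, of i] by simp
  let ?S = "{x. \<exists>n. (brk G (E i) ^^ n) x = 0}"
  have "?S = UNIV"
  proof (rule R.generate)
    show "g.subspace ?S"
    proof (rule g.subspaceI)
      show "0 \<in> ?S" by auto
      show "x + y \<in> ?S" if "x \<in> ?S" "y \<in> ?S" for x y
      proof -
        obtain n m where "(brk G (E i) ^^ n) x = 0" "(brk G (E i) ^^ m) y = 0" using \<open>x \<in> ?S\<close> \<open>y \<in> ?S\<close> by blast
        then have "(brk G (E i) ^^ max n m) x = 0" "(brk G (E i) ^^ max n m) y = 0"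
          by (auto intro: D1.power_eq_0_mono)
        then have "(brk G (E i) ^^ max n m) (x + y) = 0" by (simp add: D1.power_add)
        then show ?thesis by blast
      qed
      show "scal G c x \<in> ?S" if "x \<in> ?S" for c x
        using that by (auto simp: D1.power_scale)
    qed
    show "\<langle>x, y\<rangle> \<in> ?S" if "x \<in> ?S" "y \<in> ?S" for x y
      using that power_pair_eq_0 by blast
    show "range (incl G) \<subseteq> ?S"
      by (auto intro!: exI[of _ 2] simp: numeral_2_eq_2 E_incl br_simps)
    have "E (i + 2) \<in> ?S" using serre by blast
    moreover have "Y i \<in> ?S"
      by (auto intro!: exI[of _ 2] simp: numeral_2_eq_2 br_E_Y br_E_X br_simps)
    moreover have "E i \<in> ?S" by (auto intro!: exI[of _ 1])
    ultimately show "range (RX i) \<subseteq> ?S" by (auto simp: RX_def)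
    have "X i \<in> ?S" by (auto intro!: exI[of _ 1] simp: br_E_X)
    moreover have "F i \<in> ?S"
      by (auto intro!: exI[of _ 3] simp: numeral_3_eq_3 br_E_F E_incl br_simps)
    moreover have "F (i + 2) \<in> ?S" by (auto intro!: exI[of _ 1] simp: br_E_F_other)
    ultimately show "range (RY i) \<subseteq> ?S" by (auto simp: RY_def)
  qed
  then show ?thesis unfolding locally_nilpotent_def by blast
qed

text \<open>In the swapped system the vector - F i is a multiple of the corresponding E i.\<close>

lemma ad_F_nilpotent: "locally_nilpotent (brk G (- F i))"
proof -
  interpret sw: Q_system A p G Y "\<lambda>i. - X i" "\<lambda>i h. - \<alpha> i h" "\<lambda>i. - hc i" q M
    by (rule chevalley_swapped)
  interpret ad: representation A p G "adjoint G" by (rule representation_adjoint)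
  have "- F i = scal G (1 / of_real (q (i + 1))) (sw.E i)"
    by (simp add: F_def sw.E_def)
  then show ?thesis
    using ad.locally_nilpotent_scale[of "sw.E i"] sw.ad_E_nilpotent[of i] by simp
qed

text \<open>The usual lift of a simple reflection from the Weyl group to automorphisms, exp(e)
  exp(-f) exp(e).\<close>

definition reflG :: "3 \<Rightarrow> 'g \<Rightarrow> 'g" where
  "reflG i x = gexp (E i) (gexp (- F i) (gexp (E i) x))"

definition refl :: "3 \<Rightarrow> 'h \<Rightarrow> 'h" where
  "refl i h = h - hscal (cartan G) (\<beta> i h) (H i)"

lemma F_minus_part: "- F i \<in> part G 0"
  using F_part g.subspace_neg[OF part_subspace] by blast

lemma reflG_bij: "bij (reflG i)"
proof -
  interpret ad: representation A p G "adjoint G" by (rule representation_adjoint)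
  have "bij (gexp (E i))" "bij (gexp (- F i))"
    using ad.vexp_bij[of "E i"] ad.vexp_bij[of "- F i"] ad_E_nilpotent ad_F_nilpotent
    by (simp_all add: ad.vexp_def gexp_def)
  then have "bij (gexp (E i) \<circ> (gexp (- F i) \<circ> gexp (E i)))" by (intro bij_comp)
  also have "gexp (E i) \<circ> (gexp (- F i) \<circ> gexp (E i)) = reflG i" by (auto simp: reflG_def)
  finally show ?thesis .
qed

lemma reflG_linear: "Vector_Spaces.linear (scal G) (scal G) (reflG i)"
proof -
  interpret ad: representation A p G "adjoint G" by (rule representation_adjoint)
  interpret e: Vector_Spaces.linear "scal G" "scal G" "gexp (E i)"
    using ad.vexp_linear[of "E i"] ad_E_nilpotent by (simp add: ad.vexp_def gexp_def)
  interpret f: Vector_Spaces.linear "scal G" "scal G" "gexp (- F i)"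
    using ad.vexp_linear[of "- F i"] ad_F_nilpotent by (simp add: ad.vexp_def gexp_def)
  show ?thesis
    by unfold_locales (auto simp: reflG_def e.add f.add e.scale f.scale)
qed

lemma reflG_br: "reflG i \<langle>x, y\<rangle> = \<langle>reflG i x, reflG i y\<rangle>"
proof -
  interpret ad: representation A p G "adjoint G" by (rule representation_adjoint)
  have "gexp (E i) \<langle>x, y\<rangle> = \<langle>gexp (E i) x, gexp (E i) y\<rangle>"
    "gexp (- F i) \<langle>x, y\<rangle> = \<langle>gexp (- F i) x, gexp (- F i) y\<rangle>" for x y
    using ad.vexp_act[OF E_part, of i x y] ad.vexp_act[OF F_minus_part, of i x y]
      ad_E_nilpotent ad_F_nilpotent
    by (simp_all add: ad.vexp_def gexp_def)
  then show ?thesis by (simp add: reflG_def)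
qed

lemma reflG_incl: "reflG i (incl G h) = incl G (refl i h)"
proof -
  interpret e: linear_operator "scal G" "brk G (E i)" by unfold_locales (auto simp: br_simps)
  interpret f: linear_operator "scal G" "brk G (- F i)" by unfold_locales (auto simp: br_simps)
  let ?b = "\<beta> i h"
  have two: "scal G (2 * c) x = scal G c x + scal G c x" for c x
    by (simp only: mult_2 g.scale_left_distrib)
  have "gexp (E i) (incl G h) = incl G h - scal G ?b (E i)"
    unfolding gexp_def
    by (subst e.lexp_eq[of 2]) (simp_all add: numeral_2_eq_2 divpow_def E_incl br_simps)
  moreover have "gexp (- F i) (incl G h - scal G ?b (E i)) =
      incl G h - scal G ?b (E i) - scal G ?b (incl G (H i))"
    unfolding gexp_def
    by (subst f.lexp_eq[of 3])
      (simp_all add: numeral_3_eq_3 divpow_def F_incl br_F_E \<beta>_H br_simps g.scale_right_distrib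
        g.scale_right_diff_distrib)
  moreover have "gexp (E i) (incl G h - scal G ?b (E i) - scal G ?b (incl G (H i))) =
      incl G h - scal G ?b (incl G (H i))"
    unfolding gexp_def
    by (subst e.lexp_eq[of 2])
      (simp_all add: numeral_2_eq_2 divpow_def E_incl \<beta>_H br_simps g.scale_right_distrib
        g.scale_right_diff_distrib mult.commute[of ?b] two)
  ultimately show ?thesis
    by (simp add: reflG_def refl_def incl.diff incl_scale)
qed

end

section \<open>Bases and real roots\<close>

context chevalley_system
begin

lemma X_in_root_space: "X k \<in> root_space G (\<alpha> k)"
  and Y_in_root_space: "Y k \<in> root_space G (\<lambda>h. - \<alpha> k h)"
  by (simp_all add: root_space_def X_root Y_root)

lemma is_coroot_simple: "is_coroot G (\<alpha> k) (hc k)"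
proof -
  have "\<langle>X k, Y k\<rangle> \<in> g.span {brk G x y |x y. x \<in> root_space G (\<alpha> k) \<and> y \<in> root_space G (\<lambda>h. - \<alpha> k h)}"
    using X_in_root_space Y_in_root_space by (intro g.span_base) blast
  then show ?thesis using hc_nonzero by (simp add: is_coroot_def XY)
qed

text \<open>The root spaces of \<alpha> k and - \<alpha> k are the lines through X k and Y k, so
  their brackets span a line.\<close>

lemma coroot_simple_unique:
  assumes "is_coroot G (\<alpha> k) h"
  obtains c where "c \<noteq> 0" "h = hscal (cartan G) c (hc k)"
proof -
  interpret sw: chevalley_system A p G r Y X "\<lambda>i h. - \<alpha> i h"
    "\<lambda>i. hscal (cartan G) (- koszul_sign (r i) (r i)) (hc i)" by (rule swapped)
  have "{brk G x y |x y. x \<in> root_space G (\<alpha> k) \<and> y \<in> root_space G (\<lambda>h. - \<alpha> k h)}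
      \<subseteq> g.span {incl G (hc k)}"
  proof clarify
    fix x y assume xy: "x \<in> root_space G (\<alpha> k)" "y \<in> root_space G (\<lambda>h. - \<alpha> k h)"
    obtain c where c: "x = scal G c (X k)" using xy(1) by (rule root_space_simple)
    obtain d where d: "y = scal G d (Y k)" using xy(2) by (rule sw.root_space_simple)
    have "\<langle>x, y\<rangle> = scal G (c * d) (incl G (hc k))" by (simp add: c d br_simps XY mult.commute)
    then show "\<langle>x, y\<rangle> \<in> g.span {incl G (hc k)}" by (simp add: g.span_scale g.span_base)
  qed
  then have "incl G h \<in> g.span {incl G (hc k)}"
    using assms g.span_minimal[OF _ g.subspace_span] unfolding is_coroot_def by blast
  then obtain c where c: "incl G h = incl G (hscal (cartan G) c (hc k))"
    by (auto simp: g.span_singleton incl_scale)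
  moreover have "c \<noteq> 0" using assms c by (auto simp: is_coroot_def)
  ultimately show ?thesis using that by simp
qed

lemma simple_in_dual: "\<alpha> k \<in> dual_space (cartan G)"
  unfolding dual_space_def
  by (auto simp: Vector_Spaces.linear_iff_module_hom[symmetric] hh.vector_space_axioms \<alpha>_add \<alpha>_scale
      intro!: Vector_Spaces.linear.intro module_hom.intro module_hom_axioms.intro
        vector_space_over_itself.vector_space_axioms vector_space_over_itself.module_axioms hh.module_axioms)

lemma is_root_simple: "is_root G (\<alpha> k)"
proof -
  have "\<alpha> k \<noteq> (\<lambda>h. 0)"
  proof
    assume "\<alpha> k = (\<lambda>h. 0)"
    then have "(\<Sum>i\<in>UNIV. (if i = k then 1 else 0) * \<alpha> i h) = 0" for h
      by (simp add: if_distrib[of "\<lambda>x. x * _"] cong: if_cong)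
    then have "(if k = k then 1 else 0) = (0 :: complex)" by (rule \<alpha>_independent)
    then show False by simp
  qed
  then show ?thesis
    using X_in_root_space[of k] X_nonzero[of k] simple_in_dual by (auto simp: is_root_def)
qed

end

context Q_system
begin

lemma \<beta>_add: "\<beta> i (h + h') = \<beta> i h + \<beta> i h'"
  and \<beta>_scale: "\<beta> i (hscal (cartan G) c h) = c * \<beta> i h"
  by (simp_all add: \<beta>_def \<alpha>_add \<alpha>_scale algebra_simps)

lemma \<beta>_diff: "\<beta> i (h - h') = \<beta> i h - \<beta> i h'"
  using \<beta>_add[of i "h - h'" h'] by simp

lemma refl_add: "refl i (h + h') = refl i h + refl i h'"
  and refl_scale: "refl i (hscal (cartan G) c h) = hscal (cartan G) c (refl i h)"
  by (simp_all add: refl_def \<beta>_add \<beta>_scale hh.scale_left_distrib hh.scale_right_diff_distrib)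

lemma refl_zero: "refl i 0 = 0"
  using refl_scale[of i 0 0] by simp

lemma refl_refl [simp]: "refl i (refl i h) = h"
  by (simp add: refl_def \<beta>_diff \<beta>_scale \<beta>_H mult_2_right hh.scale_left_diff_distrib hh.scale_left_distrib)

text \<open>Words stand for elements of the group generated by the reflections; it acts on functions
  by precomposition, which is why roots and coroots are moved by mutually reversed words.\<close>

definition refl_word :: "3 list \<Rightarrow> 'h \<Rightarrow> 'h" where
  "refl_word ws = foldr refl ws"

lemma refl_word_simps [simp]:
  "refl_word [] h = h" "refl_word (i # ws) h = refl i (refl_word ws h)"
  "refl_word (ws @ ws') h = refl_word ws (refl_word ws' h)"
  by (simp_all add: refl_word_def)

lemma refl_word_add: "refl_word ws (h + h') = refl_word ws h + refl_word ws h'"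
  and refl_word_scale: "refl_word ws (hscal (cartan G) c h) = hscal (cartan G) c (refl_word ws h)"
  by (induction ws) (simp_all add: refl_add refl_scale)

lemma refl_word_rev [simp]: "refl_word ws (refl_word (rev ws) h) = h"
  "refl_word (rev ws) (refl_word ws h) = h"
  by (induction ws arbitrary: h) simp_all

lemma root_space_reflG:
  "x \<in> root_space G \<gamma> \<Longrightarrow> reflG i x \<in> root_space G (\<lambda>h. \<gamma> (refl i h))"
proof -
  assume x: "x \<in> root_space G \<gamma>"
  interpret r: Vector_Spaces.linear "scal G" "scal G" "reflG i" by (rule reflG_linear)
  have "\<langle>incl G h, reflG i x\<rangle> = reflG i \<langle>incl G (refl i h), x\<rangle>" for h
    by (simp add: reflG_br reflG_incl)
  then show ?thesis using x by (simp add: root_space_def r.scale)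
qed

lemma root_space_refl:
  "root_space G (\<lambda>h. \<gamma> (refl i h)) = reflG i ` root_space G \<gamma>"
proof
  interpret r: Vector_Spaces.linear "scal G" "scal G" "reflG i" by (rule reflG_linear)
  show "root_space G (\<lambda>h. \<gamma> (refl i h)) \<subseteq> reflG i ` root_space G \<gamma>"
  proof
    fix y assume y: "y \<in> root_space G (\<lambda>h. \<gamma> (refl i h))"
    obtain x where x: "y = reflG i x" using reflG_bij by (metis bij_pointE)
    have "reflG i \<langle>incl G h, x\<rangle> = reflG i (scal G (\<gamma> h) x)" for h
      using y by (simp add: root_space_def x reflG_br reflG_incl r.scale)
    then have "x \<in> root_space G \<gamma>"
      using reflG_bij by (simp add: root_space_def bij_def inj_eq)
    then show "y \<in> reflG i ` root_space G \<gamma>" using x by blast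
  qed
qed (auto intro: root_space_reflG)

lemma is_coroot_refl:
  assumes "is_coroot G \<gamma> h"
  shows "is_coroot G (\<lambda>h. \<gamma> (refl i h)) (refl i h)"
proof -
  interpret r: Vector_Spaces.linear "scal G" "scal G" "reflG i" by (rule reflG_linear)
  let ?S = "\<lambda>\<gamma>. {brk G x y |x y. x \<in> root_space G \<gamma> \<and> y \<in> root_space G (\<lambda>h. - \<gamma> h)}"
  have "refl i h \<noteq> 0"
  proof
    assume "refl i h = 0"
    then have "refl i (refl i h) = refl i 0" by simp
    then have "h = 0" by (simp only: refl_refl refl_zero)
    then show False using assms by (simp add: is_coroot_def)
  qed
  moreover have "incl G (refl i h) \<in> g.span (?S (\<lambda>h. \<gamma> (refl i h)))"
  proof -
    have "incl G (refl i h) \<in> reflG i ` g.span (?S \<gamma>)"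
      using assms by (auto simp: is_coroot_def reflG_incl[symmetric])
    also have "\<dots> = g.span (reflG i ` ?S \<gamma>)" by (rule r.span_image[symmetric])
    also have "\<dots> \<subseteq> g.span (?S (\<lambda>h. \<gamma> (refl i h)))"
    proof (intro g.span_mono subsetI)
      fix z assume "z \<in> reflG i ` ?S \<gamma>"
      then obtain x y where xy: "x \<in> root_space G \<gamma>" "y \<in> root_space G (\<lambda>h. - \<gamma> h)" "z = \<langle>reflG i x, reflG i y\<rangle>"
        by (auto simp: reflG_br)
      then show "z \<in> ?S (\<lambda>h. \<gamma> (refl i h))"
        using root_space_reflG[OF xy(1), of i] root_space_reflG[OF xy(2), of i] by blast
    qed
    finally show ?thesis .
  qed
  ultimately show ?thesis by (simp add: is_coroot_def)
qed

lemma is_coroot_word: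
  "is_coroot G \<gamma> h \<Longrightarrow> is_coroot G (\<lambda>h. \<gamma> (refl_word ws h)) (refl_word (rev ws) h)"
proof (induction ws arbitrary: \<gamma> h)
  case (Cons i ws)
  show ?case using Cons.IH[OF is_coroot_refl[OF Cons.prems, of i]] by simp
qed simp

lemma is_coroot_wordD:
  "is_coroot G (\<lambda>h. \<gamma> (refl_word ws h)) h \<Longrightarrow> is_coroot G \<gamma> (refl_word ws h)"
  using is_coroot_word[of "\<lambda>h. \<gamma> (refl_word ws h)" h "rev ws"] by simp

lemma is_root_refl:
  assumes "is_root G \<gamma>"
  shows "is_root G (\<lambda>h. \<gamma> (refl i h))"
proof -
  interpret r: Vector_Spaces.linear "scal G" "scal G" "reflG i" by (rule reflG_linear)
  interpret \<gamma>: Vector_Spaces.linear "hscal (cartan G)" "(*)" \<gamma>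
    using assms by (simp add: is_root_def dual_space_def)
  have "(\<lambda>h. \<gamma> (refl i h)) \<in> dual_space (cartan G)"
    unfolding dual_space_def by (rule CollectI) (unfold_locales, auto simp: refl_add refl_scale \<gamma>.add \<gamma>.scale)
  moreover have "(\<lambda>h. \<gamma> (refl i h)) \<noteq> (\<lambda>h. 0)"
  proof
    assume "(\<lambda>h. \<gamma> (refl i h)) = (\<lambda>h. 0)"
    then have "\<gamma> (refl i (refl i h)) = 0" for h by meson
    then show False using assms by (simp add: is_root_def fun_eq_iff)
  qed
  moreover have "root_space G (\<lambda>h. \<gamma> (refl i h)) \<noteq> {0}"
  proof
    assume "root_space G (\<lambda>h. \<gamma> (refl i h)) = {0}"
    then have "reflG i ` root_space G \<gamma> = reflG i ` {0}" by (simp add: root_space_refl)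
    then have "root_space G \<gamma> = {0}"
      using reflG_bij by (metis bij_def inj_image_eq_iff)
    then show False using assms by (simp add: is_root_def)
  qed
  ultimately show ?thesis by (simp add: is_root_def)
qed

lemma is_root_word: "is_root G \<gamma> \<Longrightarrow> is_root G (\<lambda>h. \<gamma> (refl_word ws h))"
proof (induction ws arbitrary: \<gamma>)
  case (Cons i ws)
  show ?case using Cons.IH[OF is_root_refl[OF Cons.prems, of i]] by simp
qed simp

lemma R\<alpha>_simps: "R\<alpha> k k = (\<lambda>h. - \<alpha> k h)" "R\<alpha> k (k + 1) = \<beta> k" "R\<alpha> k (k + 2) = \<beta> (k + 2)"
  by (simp_all add: R\<alpha>_def fun_eq_iff)

lemma Rh_simps: "Rh k k = hc k" "Rh k (k + 1) = H k" "Rh k (k + 2) = H (k + 2)"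
  by (simp_all add: Rh_def)

lemma R\<alpha>_diff: "R\<alpha> k j (h - h') = R\<alpha> k j h - R\<alpha> k j h'"
  and R\<alpha>_scale: "R\<alpha> k j (hscal (cartan G) c h) = c * R\<alpha> k j h"
proof -
  interpret R: chevalley_system A p G "\<lambda>j. if j = k then 1 else 0" "RX k" "RY k" "R\<alpha> k" "Rh k"
    by (rule reflected)
  show "R\<alpha> k j (h - h') = R\<alpha> k j h - R\<alpha> k j h'" using R.\<alpha>_add[of j "h - h'" h'] by simp
  show "R\<alpha> k j (hscal (cartan G) c h) = c * R\<alpha> k j h" by (rule R.\<alpha>_scale)
qed

lemma R\<alpha>_coroot_unique:
  assumes "is_coroot G (R\<alpha> k j) h"
  obtains c where "c \<noteq> 0" "h = hscal (cartan G) c (Rh k j)"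
proof -
  interpret R: chevalley_system A p G "\<lambda>j. if j = k then 1 else 0" "RX k" "RY k" "R\<alpha> k" "Rh k"
    by (rule reflected)
  show ?thesis using assms that by (rule R.coroot_simple_unique)
qed

end

locale Q_standard = Q_system A p G X Y \<alpha> hc q M
  for A :: "complex^3^3" and p :: "3 \<Rightarrow> bit"
    and G :: "('h::ab_group_add, 3, 'g::ab_group_add) contragredient"
    and X Y \<alpha> hc q M +
  assumes \<alpha>_sroot: "\<alpha> = sroot (cartan G)"
begin

lemma odd_root_simple: "odd_root G (\<alpha> k)"
proof -
  have "root_space G (\<alpha> k) \<subseteq> part G 1"
    using X_part by (auto elim!: root_space_simple intro: g.subspace_scale[OF part_subspace])
  then show ?thesis by (simp add: odd_root_def is_root_simple)
qed

lemma is_base_R\<alpha>: "is_base G (R\<alpha> k)"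
proof -
  have 1: "is_base G \<alpha>" using is_base.initial[of G] by (simp add: \<alpha>_sroot)
  have "is_base G (\<lambda>i h. if i = k then - \<alpha> k h
                      else if \<alpha> k (hc i) \<noteq> 0 \<or> \<alpha> i (hc k) \<noteq> 0 then \<alpha> i h + \<alpha> k h
                      else \<alpha> i h)"
    using 1 is_coroot_simple odd_root_simple \<alpha>_self by (rule is_base.odd_reflection)
  also have "(\<lambda>i h. if i = k then - \<alpha> k h
                      else if \<alpha> k (hc i) \<noteq> 0 \<or> \<alpha> i (hc k) \<noteq> 0 then \<alpha> i h + \<alpha> k h
                      else \<alpha> i h) = R\<alpha> k"
  proof (intro ext)
    fix i h
    show "(if i = k then - \<alpha> k h
                      else if \<alpha> k (hc i) \<noteq> 0 \<or> \<alpha> i (hc k) \<noteq> 0 then \<alpha> i h + \<alpha> k h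
                      else \<alpha> i h) = R\<alpha> k i h"
      using index_cases[of i k] by (auto simp: R\<alpha>_def \<beta>_def \<alpha>_next \<alpha>_prev)
  qed
  finally show ?thesis .
qed

text \<open>The negative root appears after the even reflection in \<beta> k of the base reflected
  at k; it gives the nilpotency of F k on integrable modules.\<close>

lemma real_root_\<beta>: "real_root G (\<beta> k)" and real_root_minus_\<beta>: "real_root G (\<lambda>h. - \<beta> k h)"
proof -
  interpret R: chevalley_system A p G "\<lambda>j. if j = k then 1 else 0" "RX k" "RY k" "R\<alpha> k" "Rh k"
    by (rule reflected)
  have root: "is_root G (\<beta> k)" using R.is_root_simple[of "k + 1"] by (simp add: R\<alpha>_simps)
  then show "real_root G (\<beta> k)"
    unfolding real_root_def using is_base_R\<alpha>[of k] R\<alpha>_simps(2)[of k] by metis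
  have "is_coroot G (R\<alpha> k (k + 1)) (H k)" using R.is_coroot_simple[of "k + 1"] by (simp add: Rh_simps)
  moreover have "R\<alpha> k (k + 1) (H k) = 2" by (simp add: R\<alpha>_simps \<beta>_H)
  ultimately have "is_base G (\<lambda>i h. R\<alpha> k i h - R\<alpha> k i (H k) * R\<alpha> k (k + 1) h)"
    by (rule is_base.even_reflection[OF is_base_R\<alpha>])
  moreover have "(\<lambda>h. - \<beta> k h) = (\<lambda>i h. R\<alpha> k i h - R\<alpha> k i (H k) * R\<alpha> k (k + 1) h) (k + 1)"
    by (simp add: R\<alpha>_simps \<beta>_H)
  moreover have "is_root G (\<lambda>h. - \<beta> k h)"
  proof -
    have "\<beta> k (refl k h) = - \<beta> k h" for h
      by (simp add: refl_def \<beta>_diff \<beta>_scale \<beta>_H)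
    then show ?thesis using is_root_refl[OF root, of k] by simp
  qed
  ultimately show "real_root G (\<lambda>h. - \<beta> k h)" unfolding real_root_def by blast
qed

text \<open>In a base of the first kind all simple roots are isotropic, so no even reflection
  applies, and an odd one leads to the second kind. In the second kind exactly one simple root is
  isotropic: reflecting in it returns to the first kind, and the even reflections only lengthen the
  word.\<close>

lemma base_classification:
  assumes "is_base G \<gamma>"
  obtains ws where "\<gamma> = (\<lambda>j h. \<alpha> j (refl_word ws h))"
  | k ws where "\<gamma> = (\<lambda>j h. R\<alpha> k j (refl_word ws h))"
  using assms
proof (induction arbitrary: thesis)
  case initial
  show ?case by (rule initial(1)[of "[]"]) (simp flip: \<alpha>_sroot)
next
  case (even_reflection \<gamma> k hk)
  from even_reflection.IH show ?case
  proof cases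
    case (1 ws)
    have "is_coroot G (\<alpha> k) (refl_word ws hk)"
      using even_reflection.hyps(2) by (intro is_coroot_wordD) (simp add: 1)
    then obtain c where "refl_word ws hk = hscal (cartan G) c (hc k)" by (rule coroot_simple_unique)
    then have "\<gamma> k hk = 0" by (simp add: 1 \<alpha>_scale \<alpha>_self)
    then show ?thesis using even_reflection.hyps(3) by simp
  next
    case (2 j ws)
    have "is_coroot G (R\<alpha> j k) (refl_word ws hk)"
      using even_reflection.hyps(2) by (intro is_coroot_wordD) (simp add: 2)
    then obtain c where c: "refl_word ws hk = hscal (cartan G) c (Rh j k)" by (rule R\<alpha>_coroot_unique)
    have "k \<noteq> j"
      using even_reflection.hyps(3) by (auto simp: 2 c R\<alpha>_scale R\<alpha>_simps Rh_simps \<alpha>_self)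
    then obtain l where l: "R\<alpha> j k = \<beta> l" "Rh j k = H l"
      using index_cases[of k j] R\<alpha>_simps Rh_simps by metis
    \<comment> \<open>The normalization of the coroot to the value 2 singles out H l among its
      multiples.\<close>
    have "c = 1"
      using even_reflection.hyps(3) by (simp add: 2 c l \<beta>_scale \<beta>_H)
    then have "refl_word ws hk = H l" using c l by simp
    then have "(\<lambda>i h. \<gamma> i h - \<gamma> i hk * \<gamma> k h) = (\<lambda>i h. R\<alpha> j i (refl_word (l # ws) h))"
      by (simp add: 2 refl_def R\<alpha>_diff R\<alpha>_scale l mult.commute)
    then show ?thesis by (rule even_reflection.prems(2))
  qed
next
  case (odd_reflection \<gamma> hd k)
  from odd_reflection.IH show ?case
  proof cases
    case (1 ws)
    have "is_coroot G (\<alpha> i) (refl_word ws (hd i))" for i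
      using odd_reflection.hyps(2) by (intro is_coroot_wordD) (simp add: 1)
    then have "\<exists>c. c \<noteq> 0 \<and> refl_word ws (hd i) = hscal (cartan G) c (hc i)" for i
      using coroot_simple_unique by metis
    then obtain c where c: "\<And>i. c i \<noteq> 0" "\<And>i. refl_word ws (hd i) = hscal (cartan G) (c i) (hc i)"
      by metis
    have "(\<lambda>i h. if i = k then - \<gamma> k h
        else if \<gamma> k (hd i) \<noteq> 0 \<or> \<gamma> i (hd k) \<noteq> 0 then \<gamma> i h + \<gamma> k h else \<gamma> i h) =
        (\<lambda>j h. R\<alpha> k j (refl_word ws h))" (is "?l = ?r")
    proof (intro ext)
      fix i h
      show "?l i h = ?r i h"
        using index_cases[of i k]
        by (auto simp: 1 c \<alpha>_scale R\<alpha>_def \<beta>_def \<alpha>_next \<alpha>_prev)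
    qed
    then show ?thesis by (rule odd_reflection.prems(2))
  next
    case (2 j ws)
    have "is_coroot G (R\<alpha> j i) (refl_word ws (hd i))" for i
      using odd_reflection.hyps(2) by (intro is_coroot_wordD) (simp add: 2)
    then have "\<exists>c. c \<noteq> 0 \<and> refl_word ws (hd i) = hscal (cartan G) c (Rh j i)" for i
      using R\<alpha>_coroot_unique by metis
    then obtain c where c: "\<And>i. c i \<noteq> 0" "\<And>i. refl_word ws (hd i) = hscal (cartan G) (c i) (Rh j i)"
      by metis
    have k: "k = j"
    proof (rule ccontr)
      assume "k \<noteq> j"
      then obtain l where l: "R\<alpha> j k = \<beta> l" "Rh j k = H l"
        using index_cases[of k j] R\<alpha>_simps Rh_simps by metis
      then show False using odd_reflection.hyps(4) c(1)[of k] by (simp add: 2 c(2) \<beta>_scale \<beta>_H)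
    qed
    have "(\<lambda>i h. if i = k then - \<gamma> k h
        else if \<gamma> k (hd i) \<noteq> 0 \<or> \<gamma> i (hd k) \<noteq> 0 then \<gamma> i h + \<gamma> k h else \<gamma> i h) =
        (\<lambda>j h. \<alpha> j (refl_word ws h))" (is "?l = ?r")
    proof (intro ext)
      fix i h
      show "?l i h = ?r i h"
        using index_cases[of i j]
        by (auto simp: 2 k c R\<alpha>_scale R\<alpha>_simps Rh_simps \<beta>_def \<alpha>_next \<alpha>_prev \<alpha>_self)
    qed
    then show ?thesis by (rule odd_reflection.prems(1))
  qed
qed

end

section \<open>Integrable highest weight modules\<close>

text \<open>Since ad x is locally nilpotent, the Leibniz rule carries nilpotency of x from u to
  every word applied to u, and these words span V.\<close>

lemma (in chevalley_representation) nilpotent_of_cyclic: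
  assumes "irreducible_module V"
    and u: "u \<in> part V d" "u \<in> weight_space G V \<mu>" "\<And>i. act V (Y i) u = 0" "u \<noteq> 0"
    and x: "x \<in> part G 0" "locally_nilpotent (brk G x)" "(act V x ^^ n) u = 0"
  shows "locally_nilpotent (act V x)"
  unfolding locally_nilpotent_def
proof
  fix v
  interpret paired_derivation "scal G" "brk G x" "scal V" "act V x" "scal V" "act V x" "act V"
    by (rule paired_derivation_act) fact
  have word: "\<exists>n. (act V x ^^ n) (word_act l u) = 0" for l
  proof (induction l)
    case Nil
    then show ?case using x(3) by auto
  next
    case (Cons i l)
    then show ?case
      using x(2) power_pair_eq_0 unfolding locally_nilpotent_def by (metis word_act_simps(2))
  qed
  have "v \<in> v.span (range (\<lambda>l. word_act l u))"
    using irreducible_span[OF assms(1) u] by simp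
  then show "\<exists>n. (act V x ^^ n) v = 0"
  proof (induction rule: v.span_induct_alt)
    case base
    show ?case by (rule exI[of _ 0]) simp
  next
    case (step c s w)
    obtain n m where "(act V x ^^ n) s = 0" "(act V x ^^ m) w = 0" using step word by blast
    then have "(act V x ^^ max n m) s = 0" "(act V x ^^ max n m) w = 0"
      by (auto intro: D2.power_eq_0_mono)
    then have "(act V x ^^ max n m) (scal V c s + w) = 0"
      by (simp add: D2.power_add D2.power_scale)
    then show ?case by blast
  qed
qed

locale Q_module = Q_standard A p G X Y \<alpha> hc q M + representation A p G V
  for A :: "complex^3^3" and p :: "3 \<Rightarrow> bit"
    and G :: "('h::ab_group_add, 3, 'g::ab_group_add) contragredient"
    and X Y \<alpha> hc q M and V :: "('g, 'v::ab_group_add) supermodule"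
begin

lemma act_E_F: "act V (E i) (act V (F i) v) = act V (F i) (act V (E i) v) + act V (incl G (H i)) v"
  by (simp add: act_br_even[OF E_part] br_E_F add.commute)

lemma act_H_F:
  "act V (incl G (H i)) (act V (F i) v) = act V (F i) (act V (incl G (H i)) v) - scal V 2 (act V (F i) v)"
  by (simp add: act_br_even[OF incl_part] F_root \<beta>_H act_simps)

lemma act_X_X: "act V (X i) (act V (X i) v) = 0" and act_Y_Y: "act V (Y i) (act V (Y i) v) = 0"
proof -
  have *: "w = 0" if "w = - w" for w :: 'v
  proof -
    have "scal V 2 w = w + w" by (metis v.scale_left_distrib v.scale_one one_add_one)
    also have "\<dots> = 0" using that by (metis add.right_inverse)
    finally show ?thesis by simp
  qed
  show "act V (X i) (act V (X i) v) = 0" "act V (Y i) (act V (Y i) v) = 0"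
    using act_br_odd[OF X_part X_part, of i i v] act_br_odd[OF Y_part Y_part, of i i v]
    by (auto intro!: * simp: act_simps)
qed

lemma chevalley_representation_swapped:
  "chevalley_representation A p G (\<lambda>_. 1) Y X (\<lambda>i h. - \<alpha> i h)
     (\<lambda>i. hscal (cartan G) (- koszul_sign 1 1) (hc i)) V"
  by (intro chevalley_representation.intro swapped representation_axioms)

lemma chevalley_representation_reflected:
  "chevalley_representation A p G (\<lambda>j. if j = k then 1 else 0) (RY k) (RX k) (\<lambda>i h. - R\<alpha> k i h)
     (\<lambda>i. hscal (cartan G) (- koszul_sign (if i = k then 1 else 0) (if i = k then 1 else 0)) (Rh k i)) V"
  by (intro chevalley_representation.intro chevalley_system.swapped[OF reflected] representation_axioms)

subsection \<open>Integrability along all real roots\<close>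

definition root_nilpotent :: "('h \<Rightarrow> complex) \<Rightarrow> bool" where
  "root_nilpotent \<gamma> \<longleftrightarrow> (\<forall>x\<in>root_space G \<gamma>. locally_nilpotent (act V x))"

context
  assumes nilp: "\<And>i. locally_nilpotent (act V (E i))" "\<And>i. locally_nilpotent (act V (- F i))"
begin

definition reflV :: "3 \<Rightarrow> 'v \<Rightarrow> 'v" where
  "reflV i v = vexp (E i) (vexp (- F i) (vexp (E i) v))"

lemma reflV_act: "reflV i (act V x v) = act V (reflG i x) (reflV i v)"
  using vexp_act[OF E_part ad_E_nilpotent nilp(1), of i]
    vexp_act[OF F_minus_part ad_F_nilpotent nilp(2), of i]
  by (simp add: reflV_def reflG_def)

lemma reflV_surj: obtains w where "v = reflV i w"
  using vexp_bij[OF nilp(1), of i] vexp_bij[OF nilp(2), of i] unfolding reflV_def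
  by (metis bij_pointE)

lemma reflV_zero: "reflV i 0 = 0"
proof -
  interpret e: Vector_Spaces.linear "scal V" "scal V" "vexp (E i)" by (rule vexp_linear[OF nilp(1)])
  interpret f: Vector_Spaces.linear "scal V" "scal V" "vexp (- F i)" by (rule vexp_linear[OF nilp(2)])
  show ?thesis by (simp add: reflV_def)
qed

lemma root_nilpotent_refl:
  assumes "root_nilpotent \<gamma>"
  shows "root_nilpotent (\<lambda>h. \<gamma> (refl i h))"
  unfolding root_nilpotent_def root_space_refl locally_nilpotent_def
proof clarify
  fix x v assume x: "x \<in> root_space G \<gamma>"
  obtain w where w: "v = reflV i w" by (rule reflV_surj)
  have "(act V (reflG i x) ^^ n) (reflV i w) = reflV i ((act V x ^^ n) w)" for n
    by (induction n) (simp_all add: reflV_act)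
  moreover obtain n where "(act V x ^^ n) w = 0"
    using assms x unfolding root_nilpotent_def locally_nilpotent_def by blast
  ultimately have "(act V (reflG i x) ^^ n) v = 0" by (simp add: w reflV_zero)
  then show "\<exists>n. (act V (reflG i x) ^^ n) v = 0" by blast
qed

lemma root_nilpotent_word: "root_nilpotent \<gamma> \<Longrightarrow> root_nilpotent (\<lambda>h. \<gamma> (refl_word ws h))"
proof (induction ws arbitrary: \<gamma>)
  case (Cons i ws)
  show ?case using Cons.IH[OF root_nilpotent_refl[OF Cons.prems, of i]] by simp
qed simp

text \<open>The doubled root answers the clause that half of a real root may be simple; its root
  space is zero here.\<close>

lemma root_nilpotent_simple: "root_nilpotent (\<alpha> k)" "root_nilpotent (\<lambda>h. 2 * \<alpha> k h)"
proof -
  have "locally_nilpotent (act V (X k))"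
    unfolding locally_nilpotent_def by (auto intro!: exI[of _ 2] simp: numeral_2_eq_2 act_X_X)
  then show "root_nilpotent (\<alpha> k)"
    unfolding root_nilpotent_def by (auto elim!: root_space_simple intro: locally_nilpotent_scale)
  have "locally_nilpotent (act V 0)"
    unfolding locally_nilpotent_def by (auto intro!: exI[of _ 1] simp: act_simps)
  then show "root_nilpotent (\<lambda>h. 2 * \<alpha> k h)"
    unfolding root_nilpotent_def using root_space_multiple_zero[of _ 2 k] by auto
qed

lemma root_nilpotent_R\<alpha>: "root_nilpotent (R\<alpha> k j)" "root_nilpotent (\<lambda>h. 2 * R\<alpha> k j h)"
proof -
  interpret R: chevalley_system A p G "\<lambda>j. if j = k then 1 else 0" "RX k" "RY k" "R\<alpha> k" "Rh k"
    by (rule reflected)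
  have "locally_nilpotent (act V (Y k))"
    unfolding locally_nilpotent_def by (auto intro!: exI[of _ 2] simp: numeral_2_eq_2 act_Y_Y)
  then have "locally_nilpotent (act V (RX k j))" by (simp add: RX_def nilp)
  then show "root_nilpotent (R\<alpha> k j)"
    unfolding root_nilpotent_def by (auto elim!: R.root_space_simple intro: locally_nilpotent_scale)
  have "locally_nilpotent (act V 0)"
    unfolding locally_nilpotent_def by (auto intro!: exI[of _ 1] simp: act_simps)
  moreover have "\<langle>RX k j, RX k j\<rangle> = 0" by (simp add: RX_def)
  ultimately show "root_nilpotent (\<lambda>h. 2 * R\<alpha> k j h)"
    unfolding root_nilpotent_def using R.root_space_multiple_zero[of _ 2 j] by auto
qed

lemma root_nilpotent_real:
  assumes "real_root G \<beta>'"
  shows "root_nilpotent \<beta>'"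
proof -
  obtain \<gamma> k where \<gamma>: "is_base G \<gamma>" "\<beta>' = \<gamma> k \<or> (\<lambda>h. \<beta>' h / 2) = \<gamma> k"
    using assms unfolding real_root_def by blast
  have "\<beta>' = \<gamma> k \<or> \<beta>' = (\<lambda>h. 2 * \<gamma> k h)"
    using \<gamma>(2)
  proof
    assume "(\<lambda>h. \<beta>' h / 2) = \<gamma> k"
    then have "\<beta>' = (\<lambda>h. 2 * \<gamma> k h)" by (auto simp: fun_eq_iff)
    then show ?thesis ..
  qed simp
  moreover from \<gamma>(1) have "root_nilpotent (\<gamma> k) \<and> root_nilpotent (\<lambda>h. 2 * \<gamma> k h)"
  proof (cases rule: base_classification)
    case (1 ws)
    then show ?thesis
      using root_nilpotent_simple[of k, THEN root_nilpotent_word, of ws] by simp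
  next
    case (2 j ws)
    then show ?thesis
      using root_nilpotent_R\<alpha>[of j k, THEN root_nilpotent_word, of ws] by simp
  qed
  ultimately show ?thesis by auto
qed

end

lemma dual_space_list_weight:
  assumes "lam \<in> dual_space (cartan G)"
  shows "(\<lambda>h. lam h + list_weight (\<lambda>i h. - \<alpha> i h) l h) \<in> dual_space (cartan G)"
proof -
  interpret l: Vector_Spaces.linear "hscal (cartan G)" "(*)" lam
    using assms by (simp add: dual_space_def)
  have "list_weight (\<lambda>i h. - \<alpha> i h) l (h + h') = list_weight (\<lambda>i h. - \<alpha> i h) l h + list_weight (\<lambda>i h. - \<alpha> i h) l h'"
    "list_weight (\<lambda>i h. - \<alpha> i h) l (hscal (cartan G) c h) = c * list_weight (\<lambda>i h. - \<alpha> i h) l h" for h h' c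
    by (induction l) (auto simp: \<alpha>_add \<alpha>_scale algebra_simps)
  then show ?thesis
    unfolding dual_space_def
    by (intro CollectI) (unfold_locales, auto simp: l.add l.scale algebra_simps)
qed

lemma weight_H:
  assumes "lam \<in> dual_space (cartan G)"
  shows "lam (H i) = lam (hc i) + lam (hc (i + 1)) / of_real (q (i + 1))"
proof -
  interpret l: Vector_Spaces.linear "hscal (cartan G)" "(*)" lam
    using assms by (simp add: dual_space_def)
  show ?thesis by (simp add: H_def l.add l.scale)
qed

section \<open>Modules with a highest weight vector v\<close>

context
  fixes v lam d
  assumes irr: "irreducible_module V" and lam: "lam \<in> dual_space (cartan G)"
    and v: "v \<in> part V d" "v \<in> weight_space G V lam" "v \<noteq> 0" "\<And>i. act V (X i) v = 0"
begin

lemma act_E_hw: "act V (E i) v = 0"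
  using act_br_odd[OF X_part X_part, of i "i + 1" v] by (simp add: E_def v(4) act_simps)

lemma act_X_Y_hw: "act V (X i) (act V (Y j) v) = (if i = j then scal V (lam (hc i)) v else 0)"
  using act_br_odd[OF X_part Y_part, of i j v] v(2) by (auto simp: XY v(4) act_simps weight_space_def)

text \<open>Together with \<open>act_Y_Y\<close> this makes Y i v a highest weight vector for the
  base reflected at i: the commutators of the two E with Y i are multiples of simple root vectors,
  which kill v.\<close>

lemma act_E_Y_hw: "act V (E i) (act V (Y i) v) = 0" "act V (E (i + 2)) (act V (Y i) v) = 0"
  using act_br_even[OF E_part, of i "Y i" v] act_br_even[OF E_part, of "i + 2" "Y i" v]
    br_E_Y(2)[of "i + 2"]
  by (simp_all add: act_E_hw br_E_Y v(4) act_simps)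

lemma Y_hw_part: "act V (Y i) v \<in> part V (1 + d)"
  by (rule act_part[OF Y_part v(1)])

lemma Y_hw_weight: "act V (Y i) v \<in> weight_space G V (\<lambda>h. lam h - \<alpha> i h)"
  using weight_space_act[OF v(2) Y_in_root_space, of i] by simp

lemma hw_weight_module: "weight_module G V"
proof -
  interpret sw: chevalley_representation A p G "\<lambda>_. 1" Y X "\<lambda>i h. - \<alpha> i h"
    "\<lambda>i. hscal (cartan G) (- koszul_sign 1 1) (hc i)" V
    by (rule chevalley_representation_swapped)
  have "range (\<lambda>l. sw.word_act l v) \<subseteq> (\<Union>\<mu>\<in>dual_space (cartan G). weight_space G V \<mu>)"
    using sw.word_act_weight[OF v(2)] dual_space_list_weight[OF lam] by blast
  then have "v.span (range (\<lambda>l. sw.word_act l v)) \<subseteq> v.span (\<Union>\<mu>\<in>dual_space (cartan G). weight_space G V \<mu>)"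
    by (rule v.span_mono)
  then show ?thesis
    unfolding weight_module_def using sw.irreducible_span[OF irr v(1,2) v(4,3)] by auto
qed

lemma E_nilpotent: "locally_nilpotent (act V (E i))"
proof -
  interpret sw: chevalley_representation A p G "\<lambda>_. 1" Y X "\<lambda>i h. - \<alpha> i h"
    "\<lambda>i. hscal (cartan G) (- koszul_sign 1 1) (hc i)" V
    by (rule chevalley_representation_swapped)
  show ?thesis
    by (rule sw.nilpotent_of_cyclic[where n = 1, OF irr v(1,2) v(4,3) E_part ad_E_nilpotent])
      (simp add: act_E_hw)
qed

text \<open>Y i v is nonzero because X i returns it to lam(h_i) v, and it is a highest weight vector
  for the base reflected at i. There F i is a simple negative root vector, \<open>F i ^^ x\<close>
  maps Y i v to a singular vector, hence to 0, and Y i v generates V.\<close>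

lemma F_nilpotent:
  fixes x :: nat
  assumes x: "lam (H i) = of_nat x" "x > 0" and nz: "lam (hc i) \<noteq> 0"
  shows "locally_nilpotent (act V (- F i))"
proof -
  interpret R: chevalley_representation A p G "\<lambda>j. if j = i then 1 else 0" "RY i" "RX i"
    "\<lambda>j h. - R\<alpha> i j h"
    "\<lambda>j. hscal (cartan G) (- koszul_sign (if j = i then 1 else 0) (if j = i then 1 else 0)) (Rh i j)" V
    by (rule chevalley_representation_reflected)
  let ?w = "act V (Y i) v"
  let ?u = "\<lambda>n. (act V (F i) ^^ n) ?w"
  have w: "?w \<noteq> 0"
    using act_X_Y_hw[of i i] nz v(3) by (auto simp: act_simps)
  have wX: "act V (RX i j) ?w = 0" for j
    by (simp add: RX_def act_Y_Y act_E_Y_hw)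
  have Yu: "act V (Y i) (?u n) = 0" for n
  proof (induction n)
    case (Suc n)
    have "\<langle>F i, Y i\<rangle> = 0" using br_skew_even[OF F_part, of "Y i" i] br_Y_F[of i] by simp
    then show ?case using Suc act_br_even[OF F_part, of i "Y i" "?u n"] by (simp add: act_simps)
  qed (simp add: act_Y_Y)
  have Eu': "act V (E (i + 2)) (?u n) = 0" for n
  proof (induction n)
    case (Suc n)
    then show ?case using act_br_even[OF E_part, of "i + 2" "F i" "?u n"] by (simp add: br_E_F_other act_simps)
  qed (simp add: act_E_Y_hw)
  have Eu: "act V (E i) (?u x) = 0"
  proof -
    \<comment> \<open>The eigenvalue of H i on Y i v is lam(H i) - \<open>\<alpha> i (H i)\<close> =
      x - 1, so the coefficient vanishes at the exponent x.\<close>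
    have "act V (E i) (?u x) = scal V (of_nat x * ((lam (H i) - 1) - of_nat x + 1)) (?u (x - 1))"
      by (rule sl2_power[where T = "act V (incl G (H i))"])
        (use Y_hw_weight[of i] in \<open>auto simp: v.vector_space_axioms act_linear_right act_E_F act_H_F
          act_E_Y_hw weight_space_def \<alpha>_H\<close>)
    then show ?thesis by (simp add: x)
  qed
  have upart: "?u n \<in> part V (1 + d)" for n
  proof (induction n)
    case (Suc n)
    then show ?case using act_part[OF F_part Suc.IH, of i] by simp
  qed (simp add: Y_hw_part del: add_bit_eq_xor)
  have F_rs: "F i \<in> root_space G (\<lambda>h. - \<beta> i h)" by (simp add: root_space_def F_root)
  have lw: "list_weight (\<lambda>j h. - R\<alpha> i j h) (replicate n (i + 1)) h = - of_nat n * \<beta> i h" for n h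
    by (simp add: R\<alpha>_simps)
  have uweight: "?u n \<in> weight_space G V (\<lambda>h. lam h - \<alpha> i h + list_weight (\<lambda>j h. - R\<alpha> i j h) (replicate n (i + 1)) h)" for n
    unfolding lw
  proof (induction n)
    case (Suc n)
    then show ?case using weight_space_act[OF Suc.IH F_rs] by (simp add: algebra_simps)
  qed (simp add: Y_hw_weight)
  have "?u x = 0"
  proof (rule R.singular_vector_zero[OF irr Y_hw_weight w upart uweight])
    show "act V (RX i j) (?u x) = 0" for j
      by (simp add: RX_def Yu Eu Eu')
    show "replicate x (i + 1) \<noteq> []" using x by simp
  qed
  moreover have "- F i = scal G (- 1) (F i)" by simp
  moreover have "(act V (scal G (- 1) (F i)) ^^ x) ?w = scal V ((- 1) ^ x) (?u x)"
    by (rule power_act_scale)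
  ultimately have "(act V (- F i) ^^ x) ?w = 0" by simp
  then show ?thesis
    by (rule R.nilpotent_of_cyclic[OF irr Y_hw_part Y_hw_weight wX w F_minus_part ad_F_nilpotent])
qed

lemma hw_integrable:
  fixes x :: "3 \<Rightarrow> nat"
  assumes x: "\<And>i. lam (H i) = of_nat (x i)" "\<And>i. x i > 0" and nz: "\<And>i. lam (hc i) \<noteq> 0"
  shows "integrable_module G V"
proof -
  have "root_nilpotent \<beta>'" if "real_root G \<beta>'" for \<beta>'
    using E_nilpotent F_nilpotent[OF x nz] that by (rule root_nilpotent_real)
  then show ?thesis
    using hw_weight_module
    by (auto simp: integrable_module_def root_nilpotent_def locally_nilpotent_def)
qed

text \<open>For lam = 0 every Y i v is singular, so it vanishes and V is the line through v. A root
  vector would move v to a different weight, so it acts by 0.\<close>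

lemma hw_trivial:
  assumes "\<And>h. lam h = 0"
  shows "\<not> nontrivial_module V"
proof -
  interpret sw: chevalley_representation A p G "\<lambda>_. 1" Y X "\<lambda>i h. - \<alpha> i h"
    "\<lambda>i. hscal (cartan G) (- koszul_sign 1 1) (hc i)" V
    by (rule chevalley_representation_swapped)
  have Yv: "act V (Y i) v = 0" for i
  proof (rule sw.singular_vector_zero[OF irr v(2,3) Y_hw_part])
    show "act V (Y i) v \<in> weight_space G V (\<lambda>h. lam h + list_weight (\<lambda>i h. - \<alpha> i h) [i] h)"
      using Y_hw_weight[of i] by simp
    show "act V (X j) (act V (Y i) v) = 0" for j
      by (simp add: act_X_Y_hw assms)
  qed simp
  have "sw.word_act l v \<in> v.span {v}" for l
  proof (induction l)
    case (Cons i l)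
    then obtain c where "sw.word_act l v = scal V c v" by (auto simp: v.span_singleton)
    then show ?case by (simp add: act_simps Yv v.span_zero)
  qed (simp add: v.span_base)
  then have "v.span (range (\<lambda>l. sw.word_act l v)) \<subseteq> v.span {v}"
    by (intro v.span_minimal) auto
  then have span: "w \<in> range (\<lambda>c. scal V c v)" for w
    using sw.irreducible_span[OF irr v(1,2) v(4,3)] by (auto simp: v.span_singleton)
  have kill: "act V x v = 0" if x: "x \<in> root_space G \<gamma>" and \<gamma>: "\<gamma> \<noteq> (\<lambda>_. 0)" for x \<gamma>
  proof -
    obtain c where c: "act V x v = scal V c v" using span by blast
    obtain h where h: "\<gamma> h \<noteq> 0" using \<gamma> by auto
    have "act V (incl G h) (act V x v) = scal V (lam h + \<gamma> h) (act V x v)"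
      using weight_space_act[OF v(2) x] by (simp add: weight_space_def)
    moreover have "act V (incl G h) v = scal V (lam h) v" using v(2) by (simp add: weight_space_def)
    ultimately have "scal V (\<gamma> h * c) v = 0" by (simp add: c act_simps assms)
    then show ?thesis using h v(3) c by simp
  qed
  have "act V x v = 0" for x
  proof -
    have "x \<in> g.span (range (incl G) \<union> (range (monomial X) \<union> range (monomial Y)))"
      by (simp add: triangular_decomposition)
    then show ?thesis
    proof (induction rule: g.span_induct)
      case base
      then show ?case by (auto simp: g.subspace_def act_simps)
    next
      case (step x)
      then consider h where "x = incl G h" | l where "x = monomial X l" | l where "x = monomial Y l"
        by auto
      then show ?case
      proof cases
        case 1
        then show ?thesis using v(2) assms by (simp add: weight_space_def)
      next
        case 2
        show ?thesis
        proof (cases "l = []")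
          case False
          then show ?thesis using 2 list_weight_eq_0[of l]
            by (intro kill[of _ "list_weight \<alpha> l"]) (auto simp: root_space_def monomial_X_root)
        qed (simp add: 2 act_simps)
      next
        case 3
        show ?thesis
        proof (cases "l = []")
          case False
          then have "(\<lambda>h. - list_weight \<alpha> l h) \<noteq> (\<lambda>_. 0)"
            using list_weight_eq_0[of l] by (auto simp: fun_eq_iff)
          then show ?thesis using 3
            by (intro kill[of _ "\<lambda>h. - list_weight \<alpha> l h"]) (auto simp: root_space_def monomial_Y_root)
        qed (simp add: 3 act_simps)
      qed
    qed
  qed
  then have "act V x w = 0" for x w
    using span[of w] by (auto simp: act_simps)
  then show ?thesis by (simp add: nontrivial_module_def)
qed

lemma integrable_nat:
  assumes "integrable_module G V" and w: "act V (E i) w = 0" "w \<noteq> 0" "w \<in> weight_space G V \<mu>"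
  shows "\<mu> (H i) \<in> \<nat>"
proof -
  have "F i \<in> root_space G (\<lambda>h. - \<beta> i h)" by (simp add: root_space_def F_root)
  then obtain n where n: "(act V (F i) ^^ n) w = 0"
    using assms(1) real_root_minus_\<beta>[of i] unfolding integrable_module_def by blast
  show ?thesis
    by (rule sl2_highest_weight_nat[where s = "scal V" and P = "act V (E i)" and Q = "act V (F i)"
          and T = "act V (incl G (H i))" and v = w and n = n])
      (use w n in \<open>auto simp: v.vector_space_axioms act_linear_right act_E_F act_H_F weight_space_def\<close>)
qed

text \<open>Two highest weight vectors for the triple of \<beta> i are used: v gives lam(H i) in the
  natural numbers, and Y i v, once it is known to be nonzero, gives the same for lam(H i) -
  1.\<close>

lemma integrable_positive:
  assumes int: "integrable_module G V" and nontriv: "nontrivial_module V"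
    and span: "hh.span (range hc) = UNIV"
  shows "\<exists>x :: nat. x > 0 \<and> lam (H i) = of_nat x"
proof -
  interpret l: Vector_Spaces.linear "hscal (cartan G)" "(*)" lam
    using lam by (simp add: dual_space_def)
  have nz: "lam (hc k) \<noteq> 0" for k
  proof
    assume k: "lam (hc k) = 0"
    have "lam (H j) \<in> \<nat>" for j
      by (rule integrable_nat[OF int act_E_hw v(3,2)])
    then have "\<exists>m. lam (H j) = of_nat m" for j by (auto simp: Nats_def)
    then obtain x where x: "\<And>j. lam (H j) = of_nat (x j)" by metis
    \<comment> \<open>With lam(h_k) = 0 the equations for H k and H (k + 2) determine the other two
      values; the equation for H (k + 1) then equates a nonnegative number with a sum of two
      nonpositive ones.\<close>
    have 1: "lam (hc (k + 1)) = of_real (q (k + 1) * x k)"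
      using weight_H[OF lam, of k] by (simp add: k x field_simps)
    have 2: "lam (hc (k + 2)) = of_real (x (k + 2))"
      using weight_H[OF lam, of "k + 2"] by (simp add: k x)
    have "complex_of_real (x (k + 1)) = of_real (q (k + 1) * x k + x (k + 2) / q (k + 2))"
      using weight_H[OF lam, of "k + 1"] unfolding x by (simp add: 1 2)
    then have eq: "real (x (k + 1)) = q (k + 1) * x k + x (k + 2) / q (k + 2)"
      by (simp only: of_real_eq_iff)
    have "q (k + 1) * x k \<le> 0" "x (k + 2) / q (k + 2) \<le> 0"
      using q_neg[of "k + 1"] q_neg[of "k + 2"] by (simp_all add: mult_nonpos_nonneg divide_nonneg_neg)
    then have "q (k + 1) * x k = 0" "x (k + 2) / q (k + 2) = 0" using eq by linarith+
    then have "lam (hc j) = 0" for j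
      using index_cases[of j k] k 1 2 by auto
    then have "lam h = 0" for h
      using l.eq_0_on_span[of "range hc" h] span by auto
    then show False using hw_trivial nontriv by blast
  qed
  have "act V (Y i) v \<noteq> 0"
    using act_X_Y_hw[of i i] nz v(3) by (auto simp: act_simps)
  then have "lam (H i) - \<alpha> i (H i) \<in> \<nat>"
    using integrable_nat[OF int act_E_Y_hw(1) _ Y_hw_weight] by blast
  then obtain n where "lam (H i) - 1 = of_nat n" by (auto simp: \<alpha>_H Nats_def)
  then have "lam (H i) = of_nat (Suc n)" by (simp add: algebra_simps)
  then show ?thesis by blast
qed

end

end

section \<open>Typicality\<close>

context Q_system
begin

text \<open>The coefficient of \<alpha> j is u j + u (j + 2). Following the sign change around a
  cycle of odd length 3 gives u i = - u i.\<close>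

lemma \<beta>_independent:
  assumes "\<And>h. (\<Sum>i\<in>UNIV. u i * \<beta> i h) = 0"
  shows "u i = 0"
proof -
  have "(\<Sum>j\<in>UNIV. (u j + u (j + 2)) * \<alpha> j h) = 0" for h
    using assms[of h] by (simp add: sum_index[of _ i] \<beta>_def, simp add: algebra_simps)
  then have *: "u j + u (j + 2) = 0" for j by (rule \<alpha>_independent)
  have "u (i + 2) = - u i" "u (i + 1) = - u (i + 2)" "u (i + 1) = - u i"
    using *[of i] *[of "i + 2"] *[of "i + 1"] by (simp_all add: add_eq_0_iff add_eq_0_iff2)
  then have "u i = - u i" by simp
  then show ?thesis by simp
qed

lemma \<beta>_comb_inject:
  fixes d d' :: "3 \<Rightarrow> int"
  assumes "\<And>h. (\<Sum>i\<in>UNIV. of_int (d i) * \<beta> i h) = (\<Sum>i\<in>UNIV. of_int (d' i) * \<beta> i h)"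
  shows "d = d'"
proof
  fix i
  have "(\<Sum>i\<in>UNIV. of_int (d i - d' i) * \<beta> i h) = 0" for h
    using assms[of h] by (simp add: algebra_simps sum_subtractf)
  then have "of_int (d i - d' i) = (0 :: complex)" by (rule \<beta>_independent)
  then show "d i = d' i" by simp
qed

text \<open>The reflection in \<beta> i in coordinates: only coordinate i changes, and both others
  enter with the same factor \<open>M i\<close>.\<close>

definition refl_coords :: "3 \<Rightarrow> (3 \<Rightarrow> int) \<Rightarrow> 3 \<Rightarrow> int" where
  "refl_coords i d = d(i := - d i - M i * (d (i + 1) + d (i + 2)))"

lemma \<beta>_comb_refl:
  "(\<Sum>k\<in>UNIV. of_int (d k) * \<beta> k (refl i h)) = (\<Sum>k\<in>UNIV. of_int (refl_coords i d k) * \<beta> k h)"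
  by (simp add: sum_index[of _ i] refl_coords_def refl_def \<beta>_diff \<beta>_scale \<beta>_H,
      simp add: algebra_simps)

text \<open>The rescaling by \<open>M\<close> in \<open>coroot_comb\<close> symmetrizes the Cartan matrix of the even simple roots
  \<open>\<beta>\<close>, so that roots and coroots have coordinates of the same sign.\<close>

definition coroot_comb :: "3 \<Rightarrow> (3 \<Rightarrow> int) \<Rightarrow> 'h" where
  "coroot_comb j d = (\<Sum>k\<in>UNIV. hscal (cartan G) (of_int (d k) * of_int (M j) / of_int (M k)) (H k))"

lemma M_nonzero [simp]: "M i \<noteq> 0"
  using M_neg[of i] by linarith

lemma refl_H: "refl i (H i) = - H i" "refl i (H (i + 1)) = H (i + 1) - hscal (cartan G) (of_int (M (i + 1))) (H i)"
  "refl i (H (i + 2)) = H (i + 2) - hscal (cartan G) (of_int (M (i + 2))) (H i)"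
proof -
  have "hscal (cartan G) 2 x = x + x" for x
    by (metis hh.scale_left_distrib hh.scale_one one_add_one)
  then show "refl i (H i) = - H i" by (simp add: refl_def \<beta>_H)
  show "refl i (H (i + 1)) = H (i + 1) - hscal (cartan G) (of_int (M (i + 1))) (H i)"
    "refl i (H (i + 2)) = H (i + 2) - hscal (cartan G) (of_int (M (i + 2))) (H i)"
    using \<beta>_H(3)[of "i + 1"] \<beta>_H(2)[of "i + 2"] by (simp_all add: refl_def)
qed

text \<open>The coefficient d k / \<open>M k\<close> of H k meets the entry \<open>M k\<close> in
  \<open>refl_H\<close>; their product d k, rewritten over the denominator \<open>M i\<close>,
  produces the same \<open>refl_coords\<close> as for roots.\<close>

lemma refl_coroot_comb: "refl i (coroot_comb j d) = coroot_comb j (refl_coords i d)"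
proof -
  define c where "c k = of_int (d k) * of_int (M j) / (of_int (M k) :: complex)" for k
  have "refl i (coroot_comb j d) = hscal (cartan G) (c i) (- H i)
      + hscal (cartan G) (c (i + 1)) (H (i + 1) - hscal (cartan G) (of_int (M (i + 1))) (H i))
      + hscal (cartan G) (c (i + 2)) (H (i + 2) - hscal (cartan G) (of_int (M (i + 2))) (H i))"
    by (simp add: coroot_comb_def sum_index[of _ i] refl_add refl_scale refl_H c_def)
  also have "\<dots> = hscal (cartan G) (- c i - c (i + 1) * of_int (M (i + 1)) - c (i + 2) * of_int (M (i + 2))) (H i)
      + hscal (cartan G) (c (i + 1)) (H (i + 1)) + hscal (cartan G) (c (i + 2)) (H (i + 2))"
    by (simp add: hh.scale_right_diff_distrib hh.scale_left_diff_distrib)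
  also have "- c i - c (i + 1) * of_int (M (i + 1)) - c (i + 2) * of_int (M (i + 2)) =
      of_int (refl_coords i d i) * of_int (M j) / of_int (M i)"
    by (simp add: c_def refl_coords_def, simp add: field_simps)
  finally show ?thesis
    by (simp add: coroot_comb_def sum_index[of _ i] refl_coords_def c_def)
qed

text \<open>A single d describes a root and its coroot, so that the sign of the root, known from the
  root decomposition, passes to the coroot.\<close>

lemma word_coords:
  obtains d where "\<And>h. \<beta> j (refl_word (rev ws) h) = (\<Sum>k\<in>UNIV. of_int (d k) * \<beta> k h)"
    "refl_word ws (H j) = coroot_comb j d"
proof -
  have "\<exists>d. (\<forall>h. \<beta> j (refl_word (rev ws) h) = (\<Sum>k\<in>UNIV. of_int (d k) * \<beta> k h)) \<and>
    refl_word ws (H j) = coroot_comb j d"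
  proof (induction ws)
    case Nil
    show ?case
      by (rule exI[of _ "\<lambda>k. if k = j then 1 else 0"]) (simp add: sum_index[of _ j] coroot_comb_def)
  next
    case (Cons i ws)
    then obtain d where d: "\<And>h. \<beta> j (refl_word (rev ws) h) = (\<Sum>k\<in>UNIV. of_int (d k) * \<beta> k h)"
      "refl_word ws (H j) = coroot_comb j d" by blast
    show ?case
      by (rule exI[of _ "refl_coords i d"]) (simp add: d \<beta>_comb_refl refl_coroot_comb)
  qed
  then show ?thesis using that by blast
qed

text \<open>\<open>root_sign\<close> is applied in each of the three reflected bases. The sign
  patterns that pass all three tests but are mixed belong to even multiples of some \<alpha> k, and
  these are not roots.\<close>

lemma \<beta>_comb_root_sign:
  fixes d :: "3 \<Rightarrow> int"
  assumes root: "is_root G (\<lambda>h. \<Sum>k\<in>UNIV. of_int (d k) * \<beta> k h)"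
  shows "(\<forall>i. d i \<ge> 0) \<or> (\<forall>i. d i \<le> 0)"
proof -
  let ?\<gamma> = "\<lambda>h. \<Sum>k\<in>UNIV. of_int (d k) * \<beta> k h"
  have "0 \<in> root_space G ?\<gamma>" by (simp add: root_space_def br_simps)
  then obtain x where x: "x \<in> root_space G ?\<gamma>" "x \<noteq> 0"
    using root unfolding is_root_def by blast
  have sign: "(2 * d (k + 1) \<ge> 0 \<and> d k + d (k + 1) \<ge> 0 \<and> d (k + 2) + d (k + 1) \<ge> 0) \<or>
      (2 * d (k + 1) \<le> 0 \<and> d k + d (k + 1) \<le> 0 \<and> d (k + 2) + d (k + 1) \<le> 0)" for k
  proof -
    interpret R: chevalley_system A p G "\<lambda>j. if j = k then 1 else 0" "RX k" "RY k" "R\<alpha> k" "Rh k"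
      by (rule reflected)
    \<comment> \<open>The coordinates in the base reflected at k, obtained from \<beta> (k + 1) =
      \<beta> k + \<beta> (k + 2) + 2 (- \<alpha> k).\<close>
    define n where "n i = (if i = k then 2 * d (k + 1) else if i = k + 1 then d k + d (k + 1)
        else d (k + 2) + d (k + 1))" for i
    have "?\<gamma> = root_comb (R\<alpha> k) n"
      by (rule ext, simp add: root_comb_def sum_index[of _ k] n_def R\<alpha>_simps \<beta>_def,
          simp add: algebra_simps)
    then have "(\<forall>i. n i \<ge> 0) \<or> (\<forall>i. n i \<le> 0)"
      using R.root_sign[of x n] x by simp
    then show ?thesis by (simp add: all_index[of _ k] n_def)
  qed
  \<comment> \<open>The combination \<beta> k - \<beta> (k + 1) + \<beta> (k + 2) equals 2 \<alpha>
    k; negative s is handled by the reflected base, where - \<alpha> k is simple.\<close>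
  have excluded: "\<not> (d k = s \<and> d (k + 1) = - s \<and> d (k + 2) = s)" if s: "s \<noteq> 0" for k s
  proof
    assume d: "d k = s \<and> d (k + 1) = - s \<and> d (k + 2) = s"
    interpret R: chevalley_system A p G "\<lambda>j. if j = k then 1 else 0" "RX k" "RY k" "R\<alpha> k" "Rh k"
      by (rule reflected)
    have \<gamma>: "?\<gamma> = (\<lambda>h. of_int (2 * s) * \<alpha> k h)"
      by (rule ext, simp add: sum_index[of _ k] d \<beta>_def, simp add: algebra_simps)
    show False
    proof (cases "s > 0")
      case True
      then have "?\<gamma> = (\<lambda>h. of_nat (nat (2 * s)) * \<alpha> k h)" unfolding \<gamma> by simp
      moreover have "nat (2 * s) \<ge> 2" using True by linarith
      ultimately have "x = 0"
        using x(1) by (intro root_space_multiple_zero[of x "nat (2 * s)" k]) simp_all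
      then show False using x(2) by simp
    next
      case False
      then have "?\<gamma> = (\<lambda>h. of_nat (nat (- 2 * s)) * R\<alpha> k k h)" unfolding \<gamma> by (simp add: R\<alpha>_simps)
      moreover have "\<langle>RX k k, RX k k\<rangle> = 0" by (simp add: RX_def)
      moreover have "nat (- 2 * s) \<ge> 2" using False s by linarith
      ultimately have "x = 0"
        using x(1) by (intro R.root_space_multiple_zero[of x "nat (- 2 * s)" k]) simp_all
      then show False using x(2) by simp
    qed
  qed
  have 1: "\<not> (d i = s \<and> d (i + 1) = - s \<and> d (i + 2) = s)"
    "\<not> (d (i + 1) = s \<and> d (i + 2) = - s \<and> d i = s)"
    "\<not> (d (i + 2) = s \<and> d i = - s \<and> d (i + 1) = s)" if "s \<noteq> 0" for i s
    using excluded[OF that, of i] excluded[OF that, of "i + 1"] excluded[OF that, of "i + 2"] by simp_all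
  \<comment> \<open>A negative coordinate next to a positive one must be its exact opposite, and
    then the third equals one of the two, which forces an excluded pattern.\<close>
  have 2: "(a \<ge> 0 \<and> b \<ge> 0 \<and> c \<ge> 0) \<or> (a \<le> 0 \<and> b \<le> 0 \<and> c \<le> 0)"
    if "(b \<ge> 0 \<and> a + b \<ge> 0 \<and> c + b \<ge> 0) \<or> (b \<le> 0 \<and> a + b \<le> 0 \<and> c + b \<le> 0)"
      "(c \<ge> 0 \<and> b + c \<ge> 0 \<and> a + c \<ge> 0) \<or> (c \<le> 0 \<and> b + c \<le> 0 \<and> a + c \<le> 0)"
      "(a \<ge> 0 \<and> c + a \<ge> 0 \<and> b + a \<ge> 0) \<or> (a \<le> 0 \<and> c + a \<le> 0 \<and> b + a \<le> 0)"
      "\<And>s. s \<noteq> 0 \<Longrightarrow> \<not> (a = s \<and> b = - s \<and> c = s)" "\<And>s. s \<noteq> 0 \<Longrightarrow> \<not> (b = s \<and> c = - s \<and> a = s)"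
      "\<And>s. s \<noteq> 0 \<Longrightarrow> \<not> (c = s \<and> a = - s \<and> b = s)" for a b c :: int
    using that(1-3) that(4)[of a] that(5)[of b] that(6)[of c] by (smt (verit))
  have "(d i \<ge> 0 \<and> d (i + 1) \<ge> 0 \<and> d (i + 2) \<ge> 0) \<or> (d i \<le> 0 \<and> d (i + 1) \<le> 0 \<and> d (i + 2) \<le> 0)" for i
  proof (rule 2)
    show "(d (i + 1) \<ge> 0 \<and> d i + d (i + 1) \<ge> 0 \<and> d (i + 2) + d (i + 1) \<ge> 0) \<or>
        (d (i + 1) \<le> 0 \<and> d i + d (i + 1) \<le> 0 \<and> d (i + 2) + d (i + 1) \<le> 0)"
      using sign[of i] by linarith
    show "(d (i + 2) \<ge> 0 \<and> d (i + 1) + d (i + 2) \<ge> 0 \<and> d i + d (i + 2) \<ge> 0) \<or>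
        (d (i + 2) \<le> 0 \<and> d (i + 1) + d (i + 2) \<le> 0 \<and> d i + d (i + 2) \<le> 0)"
      using sign[of "i + 1"] unfolding index_simps by linarith
    show "(d i \<ge> 0 \<and> d (i + 2) + d i \<ge> 0 \<and> d (i + 1) + d i \<ge> 0) \<or>
        (d i \<le> 0 \<and> d (i + 2) + d i \<le> 0 \<and> d (i + 1) + d i \<le> 0)"
      using sign[of "i + 2"] unfolding index_simps by linarith
  qed (rule 1; assumption)+
  then show ?thesis unfolding all_index[of _ 1] .
qed

end

text \<open>The condition \<open>q_sign\<close> is the one inequality shared by both families of
  parameters; it makes - K (1 + q i) positive, which is what typicality requires.\<close>

locale Q_algebra = Q_standard A p G X Y \<alpha> hc q M
  for A :: "complex^3^3" and p :: "3 \<Rightarrow> bit"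
    and G :: "('h::ab_group_add, 3, 'g::ab_group_add) contragredient"
    and X Y \<alpha> hc q M +
  assumes hc_span: "hh.span (range hc) = UNIV"
    and q_sign: "(1 + 1 / (q i * q (i + 1) * q (i + 2))) * (1 + q i) < 0"
begin

lemma word_coords_sign:
  obtains d where "\<And>h. \<beta> j (refl_word (rev ws) h) = (\<Sum>k\<in>UNIV. of_int (d k) * \<beta> k h)"
    "refl_word ws (H j) = coroot_comb j d" "(\<forall>i. d i \<ge> 0) \<or> (\<forall>i. d i \<le> 0)"
proof -
  obtain d where d: "\<And>h. \<beta> j (refl_word (rev ws) h) = (\<Sum>k\<in>UNIV. of_int (d k) * \<beta> k h)"
    "refl_word ws (H j) = coroot_comb j d" using word_coords[of j ws] by blast
  have "is_root G (\<beta> j)" using real_root_\<beta> by (simp add: real_root_def)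
  then have "is_root G (\<lambda>h. \<beta> j (refl_word (rev ws) h))" by (rule is_root_word)
  then have "(\<forall>i. d i \<ge> 0) \<or> (\<forall>i. d i \<le> 0)"
    by (intro \<beta>_comb_root_sign) (simp add: d)
  then show ?thesis using that d by blast
qed

text \<open>The deletion property: if the word \<open>ws\<close> makes the simple coroot \<open>H j\<close> negative, then one of its
  letters turns a multiple of the corresponding simple coroot negative, and this letter cancels
  against \<open>j\<close>.\<close>

lemma deletion:
  assumes "\<And>h. \<beta> j (refl_word (rev ws) h) = (\<Sum>k\<in>UNIV. of_int (d k) * \<beta> k h)" "\<forall>i. d i \<le> 0"
  shows "\<exists>ws'. length ws' < length ws \<and> (\<forall>h. refl_word ws (refl j h) = refl_word ws' h)"
  using assms
proof (induction ws arbitrary: d)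
  case Nil
  have "d = (\<lambda>k. if k = j then 1 else 0)"
  proof (rule \<beta>_comb_inject)
    fix h
    have "(\<Sum>i\<in>UNIV. of_int (if i = j then 1 else 0) * \<beta> i h) = \<beta> j h"
      by (simp add: sum_index[of _ j])
    then show "(\<Sum>i\<in>UNIV. of_int (d i) * \<beta> i h) = (\<Sum>i\<in>UNIV. of_int (if i = j then 1 else 0) * \<beta> i h)"
      using Nil(1)[of h] by simp
  qed
  then show ?case using spec[OF Nil(2), of j] by simp
next
  case (Cons i vs)
  obtain e where e: "\<And>h. \<beta> j (refl_word (rev vs) h) = (\<Sum>k\<in>UNIV. of_int (e k) * \<beta> k h)"
    "refl_word vs (H j) = coroot_comb j e" "(\<forall>i. e i \<ge> 0) \<or> (\<forall>i. e i \<le> 0)"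
    using word_coords_sign[of j vs] by blast
  have d: "d = refl_coords i e"
    by (rule \<beta>_comb_inject) (use Cons.prems(1) in \<open>simp add: e(1) flip: \<beta>_comb_refl\<close>)
  show ?case
  proof (cases "\<forall>i. e i \<le> 0")
    case True
    then obtain ws' where "length ws' < length vs" "\<forall>h. refl_word vs (refl j h) = refl_word ws' h"
      using Cons.IH e(1) by blast
    then show ?thesis by (intro exI[of _ "i # ws'"]) auto
  next
    case False
    then have "\<forall>k. e k \<ge> 0" using e(3) by blast
    \<comment> \<open>The reflection i changes coordinate i only. As e is nonnegative and its image
      nonpositive, the other two coordinates vanish, and the root is a multiple of \<beta>
      i.\<close>
    moreover have "e (i + 1) \<le> 0" "e (i + 2) \<le> 0"
      using Cons.prems(2) spec[OF Cons.prems(2), of "i + 1"] spec[OF Cons.prems(2), of "i + 2"]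
      by (simp_all add: d refl_coords_def)
    ultimately have e0: "e (i + 1) = 0" "e (i + 2) = 0" by (simp_all add: order_antisym)
    define c where "c = of_int (e i) * of_int (M j) / (of_int (M i) :: complex)"
    have \<beta>: "\<beta> j (refl_word (rev vs) h) = of_int (e i) * \<beta> i h" for h
      by (simp add: e(1) sum_index[of _ i] e0)
    have H: "refl_word vs (H j) = hscal (cartan G) c (H i)"
      by (simp add: e(2) coroot_comb_def sum_index[of _ i] e0 c_def)
    have "2 = \<beta> j (refl_word (rev vs) (refl_word vs (H j)))" by (simp add: \<beta>_H)
    also have "\<dots> = of_int (e i) * c * 2" unfolding \<beta> H by (simp add: \<beta>_scale \<beta>_H)
    finally have ec: "of_int (e i) * c = 1" by simp
    \<comment> \<open>Conjugating the reflection j by vs gives the reflection i, since root and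
      coroot are multiples of \<beta> i and H i by mutually inverse factors. The leading letter of
      the word then cancels, leaving vs.\<close>
    have "refl_word vs (refl j h) = refl i (refl_word vs h)" for h
    proof -
      have "\<beta> j h = of_int (e i) * \<beta> i (refl_word vs h)"
        using \<beta>[of "refl_word vs h"] by simp
      then have "\<beta> j h * c = \<beta> i (refl_word vs h) * (of_int (e i) * c)" by simp
      then have *: "\<beta> j h * c = \<beta> i (refl_word vs h)" unfolding ec by simp
      have "refl_word vs (refl j h) + hscal (cartan G) (\<beta> j h) (refl_word vs (H j)) = refl_word vs h"
        by (simp add: refl_def flip: refl_word_add refl_word_scale)
      then show ?thesis unfolding H by (simp add: refl_def * eq_diff_eq)
    qed
    then show ?thesis by (intro exI[of _ vs]) simp
  qed
qed

text \<open>The inverse of the scalar factor in \<open>Q_weights\<close>.\<close>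

definition K :: complex where "K = 1 + 1 / of_real (q 1 * q 2 * q 3)"

lemma K_eq: "K = of_real (1 + 1 / (q i * q (i + 1) * q (i + 2)))"
proof -
  \<comment> \<open>The numerals 4 and 5 come from i + 1 and i + 2; in the type of indices they are
    1 and 2.\<close>
  have "q 4 = q 1" "q 5 = q 2" by (rule arg_cong[of _ _ q], simp)+
  then show ?thesis using exhaust_3[of i] by (auto simp: K_def mult_ac)
qed

lemma K_nonzero: "K \<noteq> 0"
  using q_sign[of 1] unfolding K_eq[of 1] of_real_eq_0_iff by auto

lemma K_q_neg: obtains s :: real where "s > 0" "K * (1 + of_real (q i)) = - of_real s"
proof -
  have "K * (1 + of_real (q i)) = of_real ((1 + 1 / (q i * q (i + 1) * q (i + 2))) * (1 + q i))"
    unfolding K_eq[of i] by simp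
  then show ?thesis using q_sign[of i] that[of "- ((1 + 1 / (q i * q (i + 1) * q (i + 2))) * (1 + q i))"] by simp
qed

text \<open>Substituting h_i = H_i - h_(i+1)/q_(i+1) three times returns to h_i with the factor -
  1/(abc), which moved to the left becomes K. This is the origin of the matrix in the theorem and of
  its scalar.\<close>

lemma weight_hc:
  assumes "lam \<in> dual_space (cartan G)"
  shows "K * lam (hc i) = lam (H i) - lam (H (i + 1)) / of_real (q (i + 1))
    + lam (H (i + 2)) / of_real (q (i + 1) * q (i + 2))"
proof -
  interpret l: Vector_Spaces.linear "hscal (cartan G)" "(*)" lam
    using assms by (simp add: dual_space_def)
  show ?thesis
    by (simp add: K_eq[of i] H_def l.add l.scale field_simps)
qed

lemma refl_hc: "refl i (hc i) = hscal (cartan G) (- 1 / of_real (q (i + 1))) (hc (i + 1))"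
  "refl (i + 2) (hc i) = hscal (cartan G) (- of_real (q i)) (hc (i + 2))"
  "refl (i + 1) (hc i) = hc i - hscal (cartan G) (1 + of_real (q i)) (H (i + 1))"
  by (simp_all add: refl_def \<beta>_def \<alpha>_self \<alpha>_next \<alpha>_prev H_def hh.scale_right_distrib)

section \<open>Positivity on isotropic coroots and typicality\<close>

context
  fixes lam and x :: "3 \<Rightarrow> real"
  assumes lam: "lam \<in> dual_space (cartan G)" and x: "\<And>i. lam (H i) = of_real (x i)" "\<And>i. x i > 0"
begin

lemma dominant_coroot_nonneg:
  assumes "\<forall>i. d i \<ge> 0"
  obtains s :: real where "s \<ge> 0" "lam (coroot_comb j d) = of_real s"
proof -
  interpret l: Vector_Spaces.linear "hscal (cartan G)" "(*)" lam
    using lam by (simp add: dual_space_def)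
  let ?s = "\<Sum>k\<in>UNIV. of_int (d k) * of_int (M j) / of_int (M k) * x k"
  have "of_int (d k) * of_int (M j) / of_int (M k) * x k \<ge> 0" for k
    using assms x(2)[of k] M_neg[of j] M_neg[of k]
    by (intro mult_nonneg_nonneg) (auto intro!: divide_nonpos_nonpos mult_nonneg_nonpos)
  then have "?s \<ge> 0" by (intro sum_nonneg)
  moreover have "lam (coroot_comb j d) = of_real ?s"
    by (simp add: coroot_comb_def l.sum l.scale x)
  ultimately show ?thesis using that by blast
qed

text \<open>Induction on the length, for all i at once because the last letter may turn h_i into a
  multiple of another h_j. It is complete induction since deletion shortens a word by an unspecified
  amount.\<close>

lemma dominant_isotropic_positive: "\<exists>s :: real. s > 0 \<and> K * lam (refl_word ws (hc i)) = of_real s"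
proof (induction ws arbitrary: i rule: length_induct)
  case (1 ws)
  interpret l: Vector_Spaces.linear "hscal (cartan G)" "(*)" lam
    using lam by (simp add: dual_space_def)
  show ?case
  proof (cases ws rule: rev_cases)
    case Nil
    \<comment> \<open>All three summands of \<open>weight_hc\<close> are positive because the q are
      negative.\<close>
    let ?r = "x i - x (i + 1) / q (i + 1) + x (i + 2) / (q (i + 1) * q (i + 2))"
    have "K * lam (hc i) = of_real (x i - x (i + 1) / q (i + 1) + x (i + 2) / (q (i + 1) * q (i + 2)))"
      unfolding weight_hc[OF lam] x by simp
    moreover have "x (i + 1) / q (i + 1) < 0" "x (i + 2) / (q (i + 1) * q (i + 2)) > 0"
      using x(2) q_neg by (simp_all add: divide_pos_neg mult_neg_neg)
    moreover have "?r > 0" using x(2)[of i] calculation(2,3) by linarith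
    ultimately show ?thesis using Nil by (intro exI[of _ ?r]) simp
  next
    case (snoc vs j)
    obtain s s' where s: "s > 0" "K * lam (refl_word vs (hc (i + 1))) = of_real s"
        "s' > 0" "K * lam (refl_word vs (hc (i + 2))) = of_real s'"
      using 1 snoc by (metis length_append_singleton lessI)
    obtain s0 where s0: "s0 > 0" "K * lam (refl_word vs (hc i)) = of_real s0"
      using 1 snoc by (metis length_append_singleton lessI)
    consider "j = i" | "j = i + 2" | "j = i + 1" using index_cases by blast
    then show ?thesis
    proof cases
      case 1
      have "K * lam (refl_word ws (hc i)) = - 1 / of_real (q (i + 1)) * (K * lam (refl_word vs (hc (i + 1))))"
        unfolding snoc 1 refl_word_simps refl_hc refl_word_scale l.scale by simp
      also have "\<dots> = of_real (- 1 / q (i + 1) * s)" by (simp add: s)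
      finally show ?thesis using s q_neg[of "i + 1"]
        by (intro exI[of _ "- 1 / q (i + 1) * s"]) (auto simp: divide_pos_neg)
    next
      case 2
      have "K * lam (refl_word ws (hc i)) = - of_real (q i) * (K * lam (refl_word vs (hc (i + 2))))"
        unfolding snoc 2 refl_word_simps refl_hc refl_word_scale l.scale by simp
      also have "\<dots> = of_real (- q i * s')" by (simp add: s)
      finally show ?thesis using s q_neg[of i] by (intro exI[of _ "- q i * s'"]) (auto simp: mult_neg_pos)
    next
      case 3
      obtain d where d: "\<And>h. \<beta> (i + 1) (refl_word (rev vs) h) = (\<Sum>k\<in>UNIV. of_int (d k) * \<beta> k h)"
        "refl_word vs (H (i + 1)) = coroot_comb (i + 1) d" "(\<forall>i. d i \<ge> 0) \<or> (\<forall>i. d i \<le> 0)"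
        using word_coords_sign[of "i + 1" vs] by blast
      show ?thesis
      proof (cases "\<forall>i. d i \<le> 0")
        \<comment> \<open>The last letter would subtract from positivity here, but then the word is
          not reduced: the same group element has a shorter word.\<close>
        case True
        then obtain ws' where ws': "length ws' < length vs" "\<forall>h. refl_word vs (refl (i + 1) h) = refl_word ws' h"
          using deletion[OF d(1)] by blast
        then have "refl_word ws (hc i) = refl_word ws' (hc i)" by (simp add: snoc 3)
        moreover have "length ws' < length ws" using ws' snoc by simp
        ultimately show ?thesis using "1.IH" by metis
      next
        case False
        then obtain r where r: "r \<ge> 0" "lam (coroot_comb (i + 1) d) = of_real r"
          using d(3) dominant_coroot_nonneg by blast
        obtain k where k: "k > 0" "K * (1 + of_real (q i)) = - of_real k" by (rule K_q_neg)
        \<comment> \<open>Applying the last letter changes K lam by - K (1 + q i) times the value on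
          a nonnegative combination of the H k, an increase by \<open>K_q_neg\<close>.\<close>
        have "refl_word ws (hc i) + hscal (cartan G) (1 + of_real (q i)) (coroot_comb (i + 1) d) = refl_word vs (hc i)"
          unfolding d(2)[symmetric] by (simp add: snoc 3 refl_hc flip: refl_word_add refl_word_scale)
        then have "lam (refl_word ws (hc i)) = lam (refl_word vs (hc i)) - (1 + of_real (q i)) * of_real r"
          by (metis l.add l.scale r(2) add_diff_cancel_right')
        then have "K * lam (refl_word ws (hc i)) =
            K * (lam (refl_word vs (hc i)) - (1 + of_real (q i)) * of_real r)"
          by (simp only:)
        also have "\<dots> = of_real s0 - (K * (1 + of_real (q i))) * of_real r"
          unfolding s0(2)[symmetric] by (simp add: algebra_simps)
        also have "\<dots> = of_real (s0 + k * r)" unfolding k by simp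
        finally show ?thesis using s0 k r by (intro exI[of _ "s0 + k * r"]) (auto simp: add_pos_nonneg)
      qed
    qed
  qed
qed

lemma dominant_typical:
  assumes \<rho>: "is_weyl_vector A G \<rho>" and A: "\<And>i. A $ i $ i = 0" "hc = scoroot (cartan G)"
  shows "typical G \<rho> lam"
  unfolding typical_def
proof (intro allI impI)
  fix \<gamma> h assume "real_isotropic_root G \<gamma> \<and> is_coroot G \<gamma> h"
  then obtain \<delta> k h0 where \<gamma>: "is_coroot G \<gamma> h" "is_base G \<delta>" "\<gamma> = \<delta> k" "is_coroot G \<gamma> h0" "\<gamma> h0 = 0"
    unfolding real_isotropic_root_def by blast
  interpret l: Vector_Spaces.linear "hscal (cartan G)" "(*)" lam
    using lam by (simp add: dual_space_def)
  interpret \<rho>: Vector_Spaces.linear "hscal (cartan G)" "(*)" \<rho>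
    using \<rho> by (simp add: is_weyl_vector_def dual_space_def)
  have "\<rho> (hc i) = 0" for i using \<rho> A by (simp add: is_weyl_vector_def)
  \<comment> \<open>\<rho> vanishes on the h_i, which span, so \<rho> = 0 and typicality concerns
    lam alone.\<close>
  then have "\<rho> h = 0" using \<rho>.eq_0_on_span[of "range hc" h] hc_span by auto
  moreover have "\<exists>ws c j. c \<noteq> 0 \<and> refl_word ws h = hscal (cartan G) c (hc j)"
    using \<gamma>(2)
  proof (cases rule: base_classification)
    case (1 ws)
    have "is_coroot G (\<alpha> k) (refl_word ws h)"
      using \<gamma> by (intro is_coroot_wordD) (simp add: 1)
    then show ?thesis by (metis coroot_simple_unique)
  next
    case (2 j ws)
    have "is_coroot G (R\<alpha> j k) (refl_word ws h)" "is_coroot G (R\<alpha> j k) (refl_word ws h0)"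
      using \<gamma> by (auto intro!: is_coroot_wordD simp: 2)
    then obtain c c0 where c: "c \<noteq> 0" "refl_word ws h = hscal (cartan G) c (Rh j k)"
      "c0 \<noteq> 0" "refl_word ws h0 = hscal (cartan G) c0 (Rh j k)"
      by (metis R\<alpha>_coroot_unique)
    \<comment> \<open>Isotropy of the root forces k = j: the other two members of this base take the
      value 2 on their coroots.\<close>
    have "R\<alpha> j k (Rh j k) = 0" using \<gamma>(3,5) c by (simp add: 2 R\<alpha>_scale)
    then have "k = j"
      using index_cases[of k j] by (auto simp: R\<alpha>_simps Rh_simps \<beta>_H)
    then show ?thesis using c by (auto simp: Rh_simps)
  qed
  then obtain ws c j where c: "c \<noteq> 0" "refl_word ws h = hscal (cartan G) c (hc j)" by blast
  have "h = hscal (cartan G) c (refl_word (rev ws) (hc j))"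
    using arg_cong[OF c(2), of "refl_word (rev ws)"] by (simp add: refl_word_scale)
  then have "K * lam h = c * (K * lam (refl_word (rev ws) (hc j)))" by (simp add: l.scale)
  moreover obtain s where "s > 0" "K * lam (refl_word (rev ws) (hc j)) = of_real s"
    using dominant_isotropic_positive by blast
  ultimately show "lam h + \<rho> h \<noteq> 0" using c(1) \<open>\<rho> h = 0\<close> by auto
qed

end

end

section \<open>The classification\<close>

text \<open>\<open>dim\<close> is the cardinality of a basis and hence 0 in infinite dimension; a
  nonempty finite B therefore forces a finite basis.\<close>

lemma (in vector_space) span_UNIV_of_dim:
  assumes dim: "dim UNIV = card B" and B: "independent B" "finite B" "B \<noteq> {}"
  shows "span B = UNIV"
proof -
  obtain C where C: "independent C" "UNIV \<subseteq> span C" "card C = dim UNIV"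
    by (rule basis_exists[of UNIV]) blast
  then have "finite C" using dim B by (metis card.infinite card_0_eq)
  interpret finite_dimensional_vector_space scale C
    using C \<open>finite C\<close> by unfold_locales auto
  show ?thesis using card_ge_dim_independent[of B UNIV] B dim by auto
qed

lemma rank_eq_card:
  fixes A :: "'a::field^'n^'n"
  assumes "det A \<noteq> 0"
  shows "rank A = CARD('n)"
proof -
  obtain B where "B ** A = mat 1"
    using assms invertible_det_nz[of A] unfolding invertible_def by blast
  then have "vec.span (rows A) = UNIV"
    using matrix_left_invertible_span_rows_gen[of A] by blast
  then show ?thesis
    unfolding row_rank_def_gen by (metis vec.dim_span vec_dim_card)
qed

lemma index_succ:
  "(1::3) + 1 = 2" "(1::3) + 2 = 3" "(2::3) + 1 = 3" "(2::3) + 2 = 1" "(3::3) + 1 = 1" "(3::3) + 2 = 2"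
  by simp_all

context Q_algebra
begin

lemma dominant_hc_nonzero:
  assumes "lam \<in> dual_space (cartan G)" "\<And>i. lam (H i) = of_nat (x i)" "\<And>i. x i > 0"
  shows "lam (hc i) \<noteq> 0"
  using dominant_isotropic_positive[of lam "\<lambda>i. real (x i)" "[]" i] assms by auto

theorem classification:
  fixes V :: "('g, 'v::ab_group_add) supermodule"
  defines "\<Lambda> \<equiv> {lam \<in> dual_space (cartan G). \<forall>i. \<exists>x :: nat. x > 0 \<and> lam (H i) = of_nat x}"
  assumes X: "X = genX G"
  shows "is_supermodule G V \<and> irreducible_module V \<and> nontrivial_module V \<and>
      integrable_module G V \<and> (\<exists>lam. has_highest_weight G V lam) \<longleftrightarrow> (\<exists>lam \<in> \<Lambda>. is_L G lam V)"
proof (intro iffI; (elim conjE exE bexE)?)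
  fix lam
  assume V: "is_supermodule G V" "irreducible_module V" "nontrivial_module V" "integrable_module G V"
    and hw: "has_highest_weight G V lam"
  interpret Q_module A p G X Y \<alpha> hc q M V by unfold_locales fact
  obtain v d where v: "lam \<in> dual_space (cartan G)" "v \<in> part V d" "v \<in> weight_space G V lam" "v \<noteq> 0"
    "\<forall>x\<in>n_plus G. act V x v = 0"
    using hw unfolding has_highest_weight_def by blast
  have "X i \<in> n_plus G" for i unfolding n_plus_def X by (intro hull_inc) simp
  then have "act V (X i) v = 0" for i using v(5) by blast
  then have "lam \<in> \<Lambda>"
    using integrable_positive[OF V(2) v(1-4) _ V(4,3) hc_span] v(1) by (simp add: \<Lambda>_def)
  then show "\<exists>lam\<in>\<Lambda>. is_L G lam V" using V hw by (auto simp: is_L_def)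
next
  fix lam assume lam: "lam \<in> \<Lambda>" and L: "is_L G lam V"
  interpret Q_module A p G X Y \<alpha> hc q M V by unfold_locales (use L in \<open>simp add: is_L_def\<close>)
  obtain v d where v: "lam \<in> dual_space (cartan G)" "v \<in> part V d" "v \<in> weight_space G V lam" "v \<noteq> 0"
    "\<forall>x\<in>n_plus G. act V x v = 0"
    using L unfolding is_L_def has_highest_weight_def by blast
  have "X i \<in> n_plus G" for i unfolding n_plus_def X by (intro hull_inc) simp
  then have Xv: "act V (X i) v = 0" for i using v(5) by blast
  obtain x where x: "\<And>i. lam (H i) = of_nat (x i)" "\<And>i. x i > 0"
    using lam unfolding \<Lambda>_def by (simp, metis)
  have irr: "irreducible_module V" using L by (simp add: is_L_def)
  have "integrable_module G V"
    using hw_integrable[OF irr v(1-4) Xv x dominant_hc_nonzero[OF v(1) x]] .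
  \<comment> \<open>The module is nontrivial because H 1 acts on v by a positive integer.\<close>
  moreover have "act V (incl G (H 1)) v \<noteq> 0"
    using v(3,4) x(1)[of 1] x(2)[of 1] by (simp add: weight_space_def)
  ultimately show "is_supermodule G V \<and> irreducible_module V \<and> nontrivial_module V \<and>
      integrable_module G V \<and> (\<exists>lam. has_highest_weight G V lam)"
    using L unfolding is_L_def nontrivial_module_def by blast
qed

text \<open>The matrix equation says that K lam(h_i) is given by \<open>weight_hc\<close> with x, y,
  z for the values on H_1, H_2, H_3; since K is nonzero, this system and the one defining the H_i
  are inverse to each other.\<close>

lemma Q_weights_eq:
  assumes hc: "hc = scoroot (cartan G)"
  shows "Q_weights (of_real (q 1)) (of_real (q 2)) (of_real (q 3)) G =
    {lam \<in> dual_space (cartan G). \<forall>i. \<exists>x :: nat. x > 0 \<and> lam (H i) = of_nat x}"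
proof -
  let ?a = "complex_of_real (q 1)" and ?b = "complex_of_real (q 2)" and ?c = "complex_of_real (q 3)"
  have K: "?a * ?b * ?c / (1 + ?a * ?b * ?c) = 1 / K" "K = (1 + ?a * ?b * ?c) / (?a * ?b * ?c)"
    by (simp_all add: K_def field_simps)
  have "(\<chi> i. lam (scoroot (cartan G) i)) = (?a * ?b * ?c / (1 + ?a * ?b * ?c)) *s
        (Q_weight_matrix ?a ?b ?c *v vector [of_int x, of_int y, of_int z]) \<longleftrightarrow>
      lam (H 1) = of_int x \<and> lam (H 2) = of_int y \<and> lam (H 3) = of_int z"
    (is "?l \<longleftrightarrow> ?r") if lam: "lam \<in> dual_space (cartan G)" for lam x y z
  proof -
    interpret l: Vector_Spaces.linear "hscal (cartan G)" "(*)" lam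
      using lam by (simp add: dual_space_def)
    have H: "lam (H 1) = lam (hc 1) + lam (hc 2) / ?b" "lam (H 2) = lam (hc 2) + lam (hc 3) / ?c"
      "lam (H 3) = lam (hc 3) + lam (hc 1) / ?a"
      unfolding H_def index_succ l.add l.scale by simp_all
    have Khc: "K * lam (hc 1) = lam (H 1) - lam (H 2) / ?b + lam (H 3) / (?b * ?c)"
      "K * lam (hc 2) = lam (H 2) - lam (H 3) / ?c + lam (H 1) / (?c * ?a)"
      "K * lam (hc 3) = lam (H 3) - lam (H 1) / ?a + lam (H 2) / (?a * ?b)"
      using weight_hc[OF lam, of 1] weight_hc[OF lam, of 2] weight_hc[OF lam, of 3]
      unfolding index_succ by simp_all
    have "?l \<longleftrightarrow> lam (hc 1) = 1 / K * (of_int x - of_int y / ?b + of_int z / (?b * ?c)) \<and>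
       lam (hc 2) = 1 / K * (of_int x / (?a * ?c) + of_int y - of_int z / ?c) \<and>
       lam (hc 3) = 1 / K * (- of_int x / ?a + of_int y / (?a * ?b) + of_int z)"
      unfolding K(1) hc by (simp add: vec_eq_iff forall_3 matrix_vector_mult_def sum_3 Q_weight_matrix_def)
    also have "\<dots> \<longleftrightarrow> K * lam (hc 1) = of_int x - of_int y / ?b + of_int z / (?b * ?c) \<and>
       K * lam (hc 2) = of_int x / (?a * ?c) + of_int y - of_int z / ?c \<and>
       K * lam (hc 3) = - of_int x / ?a + of_int y / (?a * ?b) + of_int z"
      using K_nonzero by (simp add: nonzero_eq_divide_eq mult.commute)
    also have "\<dots> \<longleftrightarrow> ?r"
    proof
      assume hc: "K * lam (hc 1) = of_int x - of_int y / ?b + of_int z / (?b * ?c) \<and>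
       K * lam (hc 2) = of_int x / (?a * ?c) + of_int y - of_int z / ?c \<and>
       K * lam (hc 3) = - of_int x / ?a + of_int y / (?a * ?b) + of_int z"
      have "K * lam (H 1) = K * lam (hc 1) + K * lam (hc 2) / ?b"
        "K * lam (H 2) = K * lam (hc 2) + K * lam (hc 3) / ?c"
        "K * lam (H 3) = K * lam (hc 3) + K * lam (hc 1) / ?a"
        by (simp_all add: H distrib_left)
      moreover have "of_int x - of_int y / ?b + of_int z / (?b * ?c) +
          (of_int x / (?a * ?c) + of_int y - of_int z / ?c) / ?b = K * of_int x"
        "of_int x / (?a * ?c) + of_int y - of_int z / ?c +
          (- of_int x / ?a + of_int y / (?a * ?b) + of_int z) / ?c = K * of_int y"
        "- of_int x / ?a + of_int y / (?a * ?b) + of_int z +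
          (of_int x - of_int y / ?b + of_int z / (?b * ?c)) / ?a = K * of_int z"
        by (simp_all add: K(2) field_simps)
      ultimately have "K * lam (H 1) = K * of_int x" "K * lam (H 2) = K * of_int y"
        "K * lam (H 3) = K * of_int z"
        unfolding hc[THEN conjunct1] hc[THEN conjunct2, THEN conjunct1] hc[THEN conjunct2, THEN conjunct2]
        by metis+
      then show ?r using K_nonzero by simp
    next
      assume ?r
      then show "K * lam (hc 1) = of_int x - of_int y / ?b + of_int z / (?b * ?c) \<and>
       K * lam (hc 2) = of_int x / (?a * ?c) + of_int y - of_int z / ?c \<and>
       K * lam (hc 3) = - of_int x / ?a + of_int y / (?a * ?b) + of_int z"
        unfolding Khc by (simp add: mult.commute)
    qed
    finally show ?thesis .
  qed
  then have "Q_weights ?a ?b ?c G = {lam \<in> dual_space (cartan G). \<exists>x y z :: int. x > 0 \<and> y > 0 \<and> z > 0 \<and>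
      lam (H 1) = of_int x \<and> lam (H 2) = of_int y \<and> lam (H 3) = of_int z}"
    unfolding Q_weights_def by (intro Collect_cong conj_cong refl) simp
  moreover have "(\<exists>x y z :: int. x > 0 \<and> y > 0 \<and> z > 0 \<and>
      lam (H 1) = of_int x \<and> lam (H 2) = of_int y \<and> lam (H 3) = of_int z) \<longleftrightarrow>
      (\<forall>i. \<exists>x :: nat. x > 0 \<and> lam (H i) = of_nat x)" for lam :: "'h \<Rightarrow> complex"
  proof -
    have "(\<exists>x :: nat. x > 0 \<and> u = of_nat x) \<longleftrightarrow> (\<exists>x :: int. x > 0 \<and> u = of_int x)" for u :: complex
      by (metis of_int_of_nat_eq of_nat_0_less_iff zero_less_imp_eq_int)
    then show ?thesis unfolding forall_3 by blast
  qed
  ultimately show ?thesis by simp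
qed

end

theorem proposition4p13:
  fixes m n t :: int and a b c :: real
    and G :: "('h::ab_group_add, 3, 'g::ab_group_add) contragredient"
    and V :: "('g, 'v::ab_group_add) supermodule"
  assumes "m \<le> - 1" "n \<le> - 1" "t \<le> - 1"
    and "\<not> (m = - 1 \<and> n = - 1 \<and> t = - 1)"
    and "Q_minus_parameters m n t a b c \<or> Q_plus_parameters m n t a b c"
    and "is_contragredient (Q_matrix (of_real a) (of_real b) (of_real c)) (\<lambda>_. 1) G"
  shows "(is_supermodule G V \<and> irreducible_module V \<and> nontrivial_module V \<and>
            integrable_module G V \<and> (\<exists>lam. has_highest_weight G V lam)
          \<longleftrightarrow> (\<exists>lam \<in> Q_weights (of_real a) (of_real b) (of_real c) G. is_L G lam V))
       \<and> (\<forall>lam \<in> Q_weights (of_real a) (of_real b) (of_real c) G. \<forall>\<rho>.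
            is_weyl_vector (Q_matrix (of_real a) (of_real b) (of_real c)) G \<rho> \<longrightarrow> typical G \<rho> lam)"
proof -
  let ?A = "Q_matrix (of_real a) (of_real b) (of_real c)"
  define q :: "3 \<Rightarrow> real" where "q i = (if i = 1 then a else if i = 2 then b else c)" for i
  define M :: "3 \<Rightarrow> int" where "M i = (if i = 1 then m else if i = 2 then n else t)" for i
  have q: "q 1 = a" "q 2 = b" "q 3 = c" by (simp_all add: q_def)
  have M: "M 1 = m" "M 2 = n" "M 3 = t" by (simp_all add: M_def)
  have neg: "a < 0" "b < 0" "c < 0"
    using assms(5) by (auto simp: Q_minus_parameters_def Q_plus_parameters_def)
  have eqs: "1 + a + 1 / b = of_int m" "1 + b + 1 / c = of_int n" "1 + c + 1 / a = of_int t"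
    using assms(5) by (auto simp: Q_minus_parameters_def Q_plus_parameters_def Q_equations_def)
  \<comment> \<open>For Q^- the product abc is below -1, which makes the first factor positive; for
    Q^+ it lies between -1 and 0, which makes it negative. The second factor has the opposite sign
    in each case.\<close>
  have sign: "(1 + 1 / (a * b * c)) * (1 + r) < 0" if r: "r = a \<or> r = b \<or> r = c" for r
    using assms(5)
  proof
    assume "Q_minus_parameters m n t a b c"
    then have abc: "1 < - a" "1 < - b" "1 < - c" by (auto simp: Q_minus_parameters_def)
    then have "1 < (- a) * (- b) * (- c)" by (intro less_1_mult)
    then have "a * b * c < - 1" by simp
    then have "(a * b * c + 1) / (a * b * c) > 0" by (intro divide_neg_neg) simp_all
    then have "1 + 1 / (a * b * c) > 0" using neg by (simp add: add_divide_distrib)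
    moreover have "1 + r < 0" using r abc by auto
    ultimately show ?thesis by (rule mult_pos_neg)
  next
    assume "Q_plus_parameters m n t a b c"
    then have abc: "- a < 1" "- b < 1" "- c < 1" by (auto simp: Q_plus_parameters_def)
    have "(- a) * (- b) < 1 * 1" using abc neg by (intro mult_strict_mono) auto
    then have "((- a) * (- b)) * (- c) < 1 * 1"
      using abc neg by (intro mult_strict_mono) (auto simp: mult_nonpos_nonpos)
    then have "a * b * c > - 1" by simp
    moreover have "a * b * c < 0" using neg by (simp add: mult_neg_neg mult_pos_neg)
    ultimately have "(a * b * c + 1) / (a * b * c) < 0" by (intro divide_pos_neg) simp_all
    then have "1 + 1 / (a * b * c) < 0" using neg by (simp add: add_divide_distrib)
    moreover have "1 + r > 0" using r abc by auto
    ultimately show ?thesis by (rule mult_neg_pos)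
  qed
  have signs: "(1 + 1 / (a * b * c)) * (1 + a) < 0" "(1 + 1 / (a * b * c)) * (1 + b) < 0"
    "(1 + 1 / (a * b * c)) * (1 + c) < 0"
    using sign by blast+
  interpret contragredient_superalgebra ?A "\<lambda>_. 1" G by unfold_locales fact
  have A: "?A $ 1 $ 1 = 0" "?A $ 1 $ 2 = 1" "?A $ 1 $ 3 = of_real a" "?A $ 2 $ 1 = of_real b" "?A $ 2 $ 2 = 0"
    "?A $ 2 $ 3 = 1" "?A $ 3 $ 1 = 1" "?A $ 3 $ 2 = of_real c" "?A $ 3 $ 3 = 0"
    by (simp_all only: Q_matrix_def vector_3)
  have root: "sroot (cartan G) j (scoroot (cartan G) i) = ?A $ i $ j" for i j
    using realization by (simp add: is_realization_def)
  have indep: "\<forall>i. u i = 0" if "(\<Sum>i\<in>UNIV. hscal (cartan G) (u i) (scoroot (cartan G) i)) = 0" for u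
    using realization that by (simp add: is_realization_def)
  have hc_nonzero: "scoroot (cartan G) i \<noteq> 0" for i
  proof
    assume "scoroot (cartan G) i = 0"
    then have "(\<Sum>j\<in>UNIV. hscal (cartan G) (if j = i then 1 else 0) (scoroot (cartan G) j)) = 0"
      by (intro sum.neutral) auto
    from indep[OF this] show False by (auto dest: spec[of _ i])
  qed
  interpret Q_algebra ?A "\<lambda>_. 1" G "genX G" "genY G" "sroot (cartan G)" "scoroot (cartan G)" q M
  proof unfold_locales
    fix i :: 3
    consider "i = 1" | "i = 2" | "i = 3" using exhaust_3 by blast
    note cases = this
    show "genX G i \<in> part G 1" "genY G i \<in> part G 1" by (rule genX_part genY_part)+
    show "sroot (cartan G) i (scoroot (cartan G) i) = 0" "sroot (cartan G) (i + 1) (scoroot (cartan G) i) = 1"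
      "sroot (cartan G) (i + 2) (scoroot (cartan G) i) = of_real (q i)"
      unfolding root using cases by (cases, simp_all only: index_succ A q)+
    show "q i < 0" "M i \<le> - 1" using cases by (cases, simp_all only: q M neg assms)+
    show "of_int (M i) = 1 + q i + 1 / q (i + 1)"
      using cases by (cases, simp_all only: q M index_succ eqs)
    show "(1 + 1 / (q i * q (i + 1) * q (i + 2))) * (1 + q i) < 0"
      using cases signs by (cases, simp_all only: q index_succ mult_ac)
  next
    fix u :: "3 \<Rightarrow> complex" and i
    assume "\<And>h. (\<Sum>i\<in>UNIV. u i * sroot (cartan G) i h) = 0"
    then show "u i = 0" using realization unfolding is_realization_def by blast
  next
    fix S assume "g.subspace S" "\<And>x y. x \<in> S \<Longrightarrow> y \<in> S \<Longrightarrow> \<langle>x, y\<rangle> \<in> S"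
      "range (genX G) \<subseteq> S" "range (genY G) \<subseteq> S" "range (incl G) \<subseteq> S"
    then show "S = UNIV" by (intro generators_generate)
  next
    show "hh.span (range (scoroot (cartan G))) = UNIV"
    proof (rule hh.span_UNIV_of_dim)
      have inj: "inj (scoroot (cartan G))"
      proof (rule injI, rule ccontr)
        fix i j assume ij: "scoroot (cartan G) i = scoroot (cartan G) j" "i \<noteq> j"
        have "(\<Sum>k\<in>UNIV. hscal (cartan G) ((if k = i then 1 else 0) - (if k = j then 1 else 0)) (scoroot (cartan G) k))
          = (\<Sum>k\<in>UNIV. (if k = i then scoroot (cartan G) k else 0) - (if k = j then scoroot (cartan G) k else 0))"
          by (intro sum.cong) auto
        also have "\<dots> = 0" using ij by (simp add: sum_subtractf)
        finally have "(if i = i then 1 else 0) - (if i = j then 1 else 0) = (0 :: complex)"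
          by (rule spec[OF indep])
        then show False using ij(2) by simp
      qed
      \<comment> \<open>The determinant is abc times the factor K, nonzero by \<open>sign\<close>.
        So the rank is 3, the Cartan subalgebra has dimension 6 - 3 = 3, and the three independent
        coroots span it.\<close>
      have "det ?A = 1 + of_real (a * b * c)"
        by (simp only: det_3 A) simp
      also have "\<dots> = of_real (a * b * c) * of_real (1 + 1 / (a * b * c))"
        using neg by (simp add: field_simps)
      finally have "det ?A \<noteq> 0" using neg sign[of a] by (simp del: of_real_mult of_real_add) auto
      then have "rank ?A = 3" using rank_eq_card[of ?A] by simp
      then show "hh.dim UNIV = card (range (scoroot (cartan G)))"
        using realization by (simp add: is_realization_def card_image[OF inj])
      show "hh.independent (range (scoroot (cartan G)))"
      proof (rule hh.independent_if_scalars_zero)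
        fix f x assume f: "(\<Sum>x\<in>range (scoroot (cartan G)). hscal (cartan G) (f x) x) = 0"
          and x: "x \<in> range (scoroot (cartan G))"
        have "(\<Sum>i\<in>UNIV. hscal (cartan G) (f (scoroot (cartan G) i)) (scoroot (cartan G) i)) = 0"
          using f by (simp add: sum.reindex[OF inj])
        then show "f x = 0" using spec[OF indep] x by auto
      qed simp
    qed auto
  qed (auto simp: br_incl_genX br_incl_genY br_genX_genY hc_nonzero)
  have Qw: "Q_weights (of_real a) (of_real b) (of_real c) G =
      {lam \<in> dual_space (cartan G). \<forall>i. \<exists>x :: nat. x > 0 \<and> lam (H i) = of_nat x}"
    using Q_weights_eq by (simp only: q)
  show ?thesis
  proof (intro conjI ballI allI impI)
    show "is_supermodule G V \<and> irreducible_module V \<and> nontrivial_module V \<and>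
            integrable_module G V \<and> (\<exists>lam. has_highest_weight G V lam)
          \<longleftrightarrow> (\<exists>lam \<in> Q_weights (of_real a) (of_real b) (of_real c) G. is_L G lam V)"
      unfolding Qw by (rule classification) simp
    fix lam \<rho>
    assume "lam \<in> Q_weights (of_real a) (of_real b) (of_real c) G" and \<rho>: "is_weyl_vector ?A G \<rho>"
    then obtain x where lam: "lam \<in> dual_space (cartan G)"
      and x: "\<And>i. lam (H i) = of_real (real (x i))" "\<And>i. real (x i) > 0"
      unfolding Qw by (simp, metis)
    have "?A $ i $ i = 0" for i using exhaust_3[of i] A by metis
    then show "typical G \<rho> lam"
      by (intro dominant_typical[OF lam x \<rho>]) auto
  qed
qed

end
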